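(* Let $n\ge2$, $1\le k\le n-1$, let $\Omega\subset\mathbb R^n$ be a domain with Lipschitz boundary, and let $\mathcal G_h$ be a subdivision of $\Omega$ by simplexes, belonging to a shape-regular family of such subdivisions. For $\omega\in H\Lambda^k(\Omega)\cap H^*_0\Lambda^k(\Omega)$, with a constant $C_{k,n}$ depending on the shape regularity of $\mathcal G_h$, $$\|\omega-\mathbb I_h\omega\|_{L^2\Lambda^k}+\|\mathrm d^k\omega-\mathrm d^k_h\mathbb I_h\omega\|_{L^2\Lambda^{k+1}}+\|\delta_k\omega-\delta_{k,h}\mathbb I_h\omega\|_{L^2\Lambda^{k-1}}$$ $$\le C_{k,n}\inf_{\mu_h\in\mathbf P\Lambda^k(\mathcal G_h)}\big[\|\omega-\mu_h\|_{L^2\Lambda^k}+\|\mathrm d^k_h(\omega-\mu_h)\|_{L^2\Lambda^{k+1}}+\|\delta_{k,h}(\omega-\mu_h)\|_{L^2\Lambda^{k-1}}\big].$$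
   Context: Forms. For a domain $\Xi\subset\mathbb R^n$, $L^2\Lambda^j(\Xi)$ is the space of differential $j$-forms with $L^2(\Xi)$ coefficients component by component, with inner product $\langle\cdot,\cdot\rangle_{L^2\Lambda^j(\Xi)}$; $\Xi$ is omitted when $\Xi=\Omega$. $\mathrm d^j$ is the exterior derivative on $j$-forms, $\star$ the Hodge star, $\delta_j\mu=(-1)^{jn}\star\mathrm d^{n-j}\star\mu$. $H\Lambda^j(\Xi)=\{\omega\in L^2\Lambda^j(\Xi):\mathrm d^j\omega\in L^2\Lambda^{j+1}(\Xi)\}$, $H^*\Lambda^j(\Xi)=\{\mu\in L^2\Lambda^j(\Xi):\delta_j\mu\in L^2\Lambda^{j-1}(\Xi)\}$, with graph norms; $H^*_0\Lambda^j(\Xi)$ is the closure of $\mathcal C_0^\infty\Lambda^j(\Xi)$ in $H^*\Lambda^j(\Xi)$. Local spaces. $\mathcal P_0\Lambda^j(T)$ is the space of constant-coefficient $j$-forms on a simplex $T$. The Koszul operator is $\kappa(\mathrm dx^{\alpha_1}\wedge\dots\wedge \mathrm dx^{\alpha_j})=\sum_{i=1}^j(-1)^{i+1}x^{\alpha_i}\mathrm dx^{\alpha_1}\wedge\dots\wedge\widehat{\mathrm dx^{\alpha_i}}\wedge\dots\wedge \mathrm dx^{\alpha_j}$ (extended linearly; the hat means omission), and $\kappa_T$ is given by the same formula with $x^i$ replaced by $\tilde x^i=x^i-c_i$, $c_i$ the constant such that $\int_T\tilde x^i=0$. For increasing $\alpha=(\alpha_1,\dots,\alpha_k)$ in $\{1,\dots,n\}$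 with complementary increasing index $\beta=(\beta_1,\dots,\beta_{n-k})$, set $\tilde\mu^\alpha_{\mathrm d,T}=\sum_{j=1}^{n-k}[(\tilde x^{\beta_j})^2-c^{\beta_j}]\,\mathrm dx^{\alpha_1}\wedge\dots\wedge \mathrm dx^{\alpha_k}$, with constants $c^{\beta_j}$ such that $\int_T[(\tilde x^{\beta_j})^2-c^{\beta_j}]=0$, and $\mathcal H^2_{\mathrm d}\Lambda^k(T)=\mathrm{span}\{\tilde\mu^\alpha_{\mathrm d,T}\}_\alpha$. Define $\mathcal P^-_1\Lambda^{j}(T)=\mathcal P_0\Lambda^{j}(T)+\kappa(\mathcal P_0\Lambda^{j+1}(T))$, $\mathcal P^{*,-}_1\Lambda^{j}(T)=\mathcal P_0\Lambda^{j}(T)+\star\kappa\star(\mathcal P_0\Lambda^{j-1}(T))$, and $$\mathbf P\Lambda^k(T)=\mathcal P_0\Lambda^k(T)\oplus\kappa_T(\mathcal P_0\Lambda^{k+1}(T))\oplus\star\kappa_T\star(\mathcal P_0\Lambda^{k-1}(T))\oplus\mathcal H^2_{\mathrm d}\Lambda^k(T).$$ $\mathbf P\Lambda^k(\mathcal G_h)$ is the space of piecewise (discontinuous) forms on $\Omega$ whose restriction to each $T\in\mathcal G_h$ belongs to $\mathbf P\Lambda^k(T)$; $\mathrm d^k_h$, $\delta_{k,h}$ are $\mathrm d^k$, $\delta_k$ applied simplex by simplex. Interpolators. $\mathbb I_T:H\Lambda^k(T)\cap H^*\Lambda^k(T)\to\mathbf P\Lambda^k(T)$ assigns to $\mu$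 the (unique) $\mathbb I_T\mu\in\mathbf P\Lambda^k(T)$ with $\langle \mathrm d^k\mathbb I_T\mu,\eta\rangle_{L^2\Lambda^{k+1}(T)}-\langle\mathbb I_T\mu,\delta_{k+1}\eta\rangle_{L^2\Lambda^k(T)}=\langle \mathrm d^k\mu,\eta\rangle_{L^2\Lambda^{k+1}(T)}-\langle\mu,\delta_{k+1}\eta\rangle_{L^2\Lambda^k(T)}$ for all $\eta\in\mathcal P_1^{*,-}\Lambda^{k+1}(T)$ and $\langle\delta_k\mathbb I_T\mu,\tau\rangle_{L^2\Lambda^{k-1}(T)}-\langle\mathbb I_T\mu,\mathrm d^{k-1}\tau\rangle_{L^2\Lambda^k(T)}=\langle\delta_k\mu,\tau\rangle_{L^2\Lambda^{k-1}(T)}-\langle\mu,\mathrm d^{k-1}\tau\rangle_{L^2\Lambda^k(T)}$ for all $\tau\in\mathcal P_1^{-}\Lambda^{k-1}(T)$. The global interpolator is defined by $(\mathbb I_h\mu)|_T=\mathbb I_T(\mu|_T)$ for all $T\in\mathcal G_h$.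
   Formalization: The constant depends on k, n, the shape regularity and also on an upper bound for the diameters of the simplexes (e.g. the diameter of Ω); with dependence on k, n and shape regularity alone the estimate fails for arbitrarily large simplexes. *)

theory Defs
  imports "HOL-Analysis.Analysis"
begin

section \<open>Exterior algebra\<close>

text \<open>
  The coordinates of the space of dimension \<open>n = CARD('n)\<close> are indexed by a finite linearly
  ordered type, so an increasing multi-index is the same thing as a subset of that type. An element
  of the exterior algebra is the vector of its coefficients with respect to the basis
  \<open>dx \<alpha>\<close>, and the library inner product of \<open>real ^ ('n set)\<close> is the one that
  makes this basis orthonormal.
\<close>

type_synonym 'n extalg = "real ^ ('n set)"

type_synonym 'n point = "real ^ 'n"

type_synonym 'n dform = "'n point \<Rightarrow> 'n extalg"

definition dx :: "'n set \<Rightarrow> ('n::{finite,linorder}) extalg"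
  where "dx \<alpha> = axis \<alpha> 1"

definition Alt :: "nat \<Rightarrow> ('n::{finite,linorder}) extalg set"
  where "Alt j = {w. \<forall>\<alpha>. card \<alpha> \<noteq> j \<longrightarrow> w $ \<alpha> = 0}"

text \<open>
  For disjoint \<open>\<alpha>\<close> and \<open>\<beta>\<close>, the sign of the permutation that sorts
  \<open>\<alpha>\<close> followed by \<open>\<beta>\<close>.
\<close>

definition shuffle_sign :: "('n::{finite,linorder}) set \<Rightarrow> 'n set \<Rightarrow> real"
  where "shuffle_sign \<alpha> \<beta> = (- 1) ^ card {(a, b). a \<in> \<alpha> \<and> b \<in> \<beta> \<and> b < a}"

definition wedge :: "('n::{finite,linorder}) extalg \<Rightarrow> 'n extalg \<Rightarrow> 'n extalg"
  where "wedge v w =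
    (\<Sum>\<alpha>\<in>UNIV. \<Sum>\<beta>\<in>UNIV.
       if \<alpha> \<inter> \<beta> = {} then (v $ \<alpha> * w $ \<beta> * shuffle_sign \<alpha> \<beta>) *\<^sub>R dx (\<alpha> \<union> \<beta>) else 0)"

text \<open>
  The Hodge star is normalised by \<open>\<star>v \<and> w = \<langle>v, w\<rangle> vol\<close> for \<open>v\<close>, \<open>w\<close> of the
  same degree, that is, \<open>\<star>dx \<alpha> = \<plusminus> dx (- \<alpha>)\<close> with the sign of the arrangement of
  \<open>- \<alpha>\<close> followed by \<open>\<alpha>\<close>. With this normalisation the operator
  \<open>\<delta>\<^sub>j = (-1)\<^sup>j\<^sup>n \<star> d \<star>\<close> is the formal adjoint of the exterior derivative in every
  dimension. (The normalisation \<open>v \<and> \<star>w = \<langle>v, w\<rangle> vol\<close> would make the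
  same expression \<open>(-1)\<^sup>n\<^sup>+\<^sup>1\<close> times the formal adjoint.)
\<close>

definition hodge :: "('n::{finite,linorder}) extalg \<Rightarrow> 'n extalg"
  where "hodge w = (\<Sum>\<alpha>\<in>UNIV. (shuffle_sign (- \<alpha>) \<alpha> * w $ \<alpha>) *\<^sub>R dx (- \<alpha>))"

definition hodge_form :: "('n::{finite,linorder}) dform \<Rightarrow> 'n dform"
  where "hodge_form \<omega> = (\<lambda>x. hodge (\<omega> x))"

section \<open>Square integrable forms and test forms\<close>

text \<open>
  Forms are represented by functions, not by classes modulo null sets; the values outside of
  \<open>\<Xi>\<close> play no role.
\<close>

definition L2_forms :: "'n point set \<Rightarrow> nat \<Rightarrow> ('n::{finite,linorder}) dform set"
  where "L2_forms \<Xi> j =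
    {\<omega>. (\<forall>x\<in>\<Xi>. \<omega> x \<in> Alt j) \<and> set_borel_measurable lebesgue \<Xi> \<omega> \<and>
        set_integrable lebesgue \<Xi> (\<lambda>x. (norm (\<omega> x))\<^sup>2)}"

definition L2_inner :: "'n point set \<Rightarrow> ('n::{finite,linorder}) dform \<Rightarrow> 'n dform \<Rightarrow> real"
  where "L2_inner \<Xi> \<omega> \<eta> = (LINT x:\<Xi>|lebesgue. \<omega> x \<bullet> \<eta> x)"

definition L2_norm :: "'n point set \<Rightarrow> ('n::{finite,linorder}) dform \<Rightarrow> real"
  where "L2_norm \<Xi> \<omega> = sqrt (L2_inner \<Xi> \<omega> \<omega>)"

definition partial_deriv :: "'n \<Rightarrow> (('n::finite) point \<Rightarrow> real) \<Rightarrow> 'n point \<Rightarrow> real"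
  where "partial_deriv i f x = frechet_derivative f (at x) (axis i 1)"

primrec Ck :: "nat \<Rightarrow> (('n::finite) point \<Rightarrow> real) \<Rightarrow> bool"
  where
    "Ck 0 f \<longleftrightarrow> continuous_on UNIV f"
  | "Ck (Suc m) f \<longleftrightarrow> (\<forall>x. f differentiable at x) \<and> (\<forall>i. Ck m (partial_deriv i f))"

definition test_functions :: "('n::finite) point set \<Rightarrow> ('n point \<Rightarrow> real) set"
  where "test_functions \<Xi> =
    {\<phi>. (\<forall>m. Ck m \<phi>) \<and> compact (closure {x. \<phi> x \<noteq> 0}) \<and> closure {x. \<phi> x \<noteq> 0} \<subseteq> \<Xi>}"

definition test_forms :: "'n point set \<Rightarrow> nat \<Rightarrow> ('n::{finite,linorder}) dform set"
  where "test_forms \<Xi> j =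
    {\<phi>. (\<forall>x. \<phi> x \<in> Alt j) \<and> (\<forall>\<alpha>. (\<lambda>x. \<phi> x $ \<alpha>) \<in> test_functions \<Xi>)}"

section \<open>Weak exterior derivative and codifferential\<close>

definition differential :: "('n point \<Rightarrow> real) \<Rightarrow> ('n::{finite,linorder}) dform"
  where "differential \<phi> x = (\<Sum>i\<in>UNIV. partial_deriv i \<phi> x *\<^sub>R dx {i})"

text \<open>
  The exterior derivative in the sense of distributions, tested coefficient by coefficient: for
  smooth \<open>\<omega>\<close> the identity below is the integral of
  \<open>d (\<phi> \<omega>) = d\<phi> \<and> \<omega> + \<phi> d\<omega>\<close>.
\<close>

definition weak_d :: "'n point set \<Rightarrow> ('n::{finite,linorder}) dform \<Rightarrow> 'n dform \<Rightarrow> bool"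
  where "weak_d \<Xi> \<omega> \<zeta> \<longleftrightarrow>
    (\<forall>\<phi>\<in>test_functions \<Xi>.
       (LINT x:\<Xi>|lebesgue. \<phi> x *\<^sub>R \<zeta> x) = - (LINT x:\<Xi>|lebesgue. wedge (differential \<phi> x) (\<omega> x)))"

definition H_d :: "'n point set \<Rightarrow> nat \<Rightarrow> ('n::{finite,linorder}) dform set"
  where "H_d \<Xi> j = {\<omega> \<in> L2_forms \<Xi> j. \<exists>\<zeta>\<in>L2_forms \<Xi> (j + 1). weak_d \<Xi> \<omega> \<zeta>}"

text \<open>
  Meaningful on \<open>H_d \<Xi> j\<close> only, where it is determined up to a null subset of
  \<open>\<Xi>\<close>; the same applies to \<open>codiff\<close> and \<open>H_delta\<close> below.
\<close>

definition ext_d :: "'n point set \<Rightarrow> nat \<Rightarrow> ('n::{finite,linorder}) dform \<Rightarrow> 'n dform"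
  where "ext_d \<Xi> j \<omega> = (SOME \<zeta>. \<zeta> \<in> L2_forms \<Xi> (j + 1) \<and> weak_d \<Xi> \<omega> \<zeta>)"

definition codiff :: "'n point set \<Rightarrow> nat \<Rightarrow> ('n::{finite,linorder}) dform \<Rightarrow> 'n dform"
  where "codiff \<Xi> j \<mu> =
    (\<lambda>x. (- 1) ^ (j * CARD('n)) *\<^sub>R hodge_form (ext_d \<Xi> (CARD('n) - j) (hodge_form \<mu>)) x)"

text \<open>
  The coefficients of \<open>\<delta>\<^sub>j \<mu>\<close> are, up to sign, those of \<open>d (\<star>\<mu>)\<close>, so the former is
  square integrable if and only if the latter is.
\<close>

definition H_delta :: "'n point set \<Rightarrow> nat \<Rightarrow> ('n::{finite,linorder}) dform set"
  where "H_delta \<Xi> j = {\<mu> \<in> L2_forms \<Xi> j. hodge_form \<mu> \<in> H_d \<Xi> (CARD('n) - j)}"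

definition H_delta_norm :: "'n point set \<Rightarrow> nat \<Rightarrow> ('n::{finite,linorder}) dform \<Rightarrow> real"
  where "H_delta_norm \<Xi> j \<mu> = sqrt ((L2_norm \<Xi> \<mu>)\<^sup>2 + (L2_norm \<Xi> (codiff \<Xi> j \<mu>))\<^sup>2)"

definition H_delta_0 :: "'n point set \<Rightarrow> nat \<Rightarrow> ('n::{finite,linorder}) dform set"
  where "H_delta_0 \<Xi> j =
    {\<mu> \<in> H_delta \<Xi> j. \<forall>\<epsilon>>0. \<exists>\<phi>\<in>test_forms \<Xi> j. H_delta_norm \<Xi> j (\<lambda>x. \<mu> x - \<phi> x) < \<epsilon>}"

section \<open>Local polynomial spaces\<close>

text \<open>
  The constant \<open>c\<close> with \<open>\<integral>\<^sub>T (f - c) = 0\<close>; this fixes the constants in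
  \<open>\<kappa>\<^sub>T\<close> and in \<open>mu_d\<close>.
\<close>

definition mean :: "('n::finite) point set \<Rightarrow> ('n point \<Rightarrow> real) \<Rightarrow> real"
  where "mean T f = (LINT x:T|lebesgue. f x) / measure lebesgue T"

definition centroid :: "('n::finite) point set \<Rightarrow> 'n point"
  where "centroid T = (\<chi> i. mean T (\<lambda>x. x $ i))"

text \<open>
  The Koszul operator with respect to the base point \<open>c\<close>: \<open>c = 0\<close> gives
  \<open>\<kappa>\<close> and \<open>c = centroid T\<close> gives \<open>\<kappa>\<^sub>T\<close>. An index \<open>i \<in> \<alpha>\<close>
  stands at position \<open>1 + card {a \<in> \<alpha>. a < i}\<close>.
\<close>

definition koszul :: "'n point \<Rightarrow> ('n::{finite,linorder}) dform \<Rightarrow> 'n dform"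
  where "koszul c \<omega> x =
    (\<Sum>\<alpha>\<in>UNIV. \<Sum>i\<in>\<alpha>.
       ((- 1) ^ card {a \<in> \<alpha>. a < i} * (x $ i - c $ i) * \<omega> x $ \<alpha>) *\<^sub>R dx (\<alpha> - {i}))"

definition P0 :: "nat \<Rightarrow> ('n::{finite,linorder}) dform set"
  where "P0 j = {\<lambda>x. w |w. w \<in> Alt j}"

definition form_sum :: "('n::{finite,linorder}) dform set \<Rightarrow> 'n dform set \<Rightarrow> 'n dform set"
    (infixl "\<oplus>\<^sub>f" 65)
  where "A \<oplus>\<^sub>f B = {\<lambda>x. p x + q x |p q. p \<in> A \<and> q \<in> B}"

text \<open>To be used for \<open>j \<ge> 1\<close> only, because of the truncated subtraction.\<close>

definition star_koszul_star :: "'n point \<Rightarrow> nat \<Rightarrow> ('n::{finite,linorder}) dform set"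
  where "star_koszul_star c j = (\<lambda>\<omega>. hodge_form (koszul c (hodge_form \<omega>))) ` P0 (j - 1)"

definition P1_minus :: "nat \<Rightarrow> ('n::{finite,linorder}) dform set"
  where "P1_minus j = P0 j \<oplus>\<^sub>f koszul 0 ` P0 (j + 1)"

definition P1_star_minus :: "nat \<Rightarrow> ('n::{finite,linorder}) dform set"
  where "P1_star_minus j = P0 j \<oplus>\<^sub>f star_koszul_star 0 j"

definition mu_d :: "'n point set \<Rightarrow> 'n set \<Rightarrow> ('n::{finite,linorder}) dform"
  where "mu_d T \<alpha> x =
    (\<Sum>b\<in>- \<alpha>. (x $ b - centroid T $ b)\<^sup>2 - mean T (\<lambda>y. (y $ b - centroid T $ b)\<^sup>2)) *\<^sub>R dx \<alpha>"

definition H2_d :: "'n point set \<Rightarrow> nat \<Rightarrow> ('n::{finite,linorder}) dform set"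
  where "H2_d T k = {\<lambda>x. \<Sum>\<alpha> | card \<alpha> = k. a \<alpha> *\<^sub>R mu_d T \<alpha> x |a. True}"

definition P_local :: "'n point set \<Rightarrow> nat \<Rightarrow> ('n::{finite,linorder}) dform set"
  where "P_local T k =
    P0 k \<oplus>\<^sub>f koszul (centroid T) ` P0 (k + 1) \<oplus>\<^sub>f star_koszul_star (centroid T) k \<oplus>\<^sub>f H2_d T k"

section \<open>Domains and subdivisions\<close>

text \<open>
  Near each boundary point the domain is the strict epigraph, in some unit direction \<open>e\<close>, of a
  Lipschitz function of the component orthogonal to \<open>e\<close>.
\<close>

definition lipschitz_domain :: "('n::finite) point set \<Rightarrow> bool"
  where "lipschitz_domain \<Omega> \<longleftrightarrow> open \<Omega> \<and> connected \<Omega> \<and> \<Omega> \<noteq> {} \<and>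
    (\<forall>p\<in>frontier \<Omega>. \<exists>r>0. \<exists>e L. \<exists>g :: 'n point \<Rightarrow> real. norm e = 1 \<and>
       L-lipschitz_on {y. y \<bullet> e = 0} g \<and>
       \<Omega> \<inter> ball p r = {x \<in> ball p r. g (x - (x \<bullet> e) *\<^sub>R e) < x \<bullet> e})"

text \<open>The elements are closed simplexes; forms on an element live on its interior.\<close>

definition simplicial_subdivision :: "('n::finite) point set \<Rightarrow> 'n point set set \<Rightarrow> bool"
  where "simplicial_subdivision \<Omega> \<G> \<longleftrightarrow> finite \<G> \<and> (\<forall>T\<in>\<G>. int CARD('n) simplex T) \<and>
    \<Union>\<G> = closure \<Omega> \<and> (\<forall>S\<in>\<G>. \<forall>T\<in>\<G>. S \<noteq> T \<longrightarrow> interior S \<inter> interior T = {})"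

definition inball_diameter :: "('n::finite) point set \<Rightarrow> real"
  where "inball_diameter T = (SUP r \<in> {r. 0 \<le> r \<and> (\<exists>c. cball c r \<subseteq> T)}. 2 * r)"

text \<open>A family of subdivisions is shape-regular if all its members satisfy this with one \<open>\<sigma>\<close>.\<close>

definition shape_regular :: "real \<Rightarrow> ('n::finite) point set set \<Rightarrow> bool"
  where "shape_regular \<sigma> \<G> \<longleftrightarrow> (\<forall>T\<in>\<G>. diameter T \<le> \<sigma> * inball_diameter T)"

section \<open>Piecewise forms and interpolation\<close>

text \<open>Interiors of distinct elements are disjoint, so at most one summand is nonzero at each point.\<close>

definition piecewise ::
    "'n point set set \<Rightarrow> ('n point set \<Rightarrow> 'n dform) \<Rightarrow> ('n::{finite,linorder}) dform"
  where "piecewise \<G> F x = (\<Sum>T\<in>\<G>. indicator (interior T) x *\<^sub>R F T x)"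

definition ext_d_h :: "'n point set set \<Rightarrow> nat \<Rightarrow> ('n::{finite,linorder}) dform \<Rightarrow> 'n dform"
  where "ext_d_h \<G> k \<mu> = piecewise \<G> (\<lambda>T. ext_d (interior T) k \<mu>)"

definition codiff_h :: "'n point set set \<Rightarrow> nat \<Rightarrow> ('n::{finite,linorder}) dform \<Rightarrow> 'n dform"
  where "codiff_h \<G> k \<mu> = piecewise \<G> (\<lambda>T. codiff (interior T) k \<mu>)"

definition P_global ::
    "'n point set \<Rightarrow> 'n point set set \<Rightarrow> nat \<Rightarrow> ('n::{finite,linorder}) dform set"
  where "P_global \<Omega> \<G> k =
    {\<mu> \<in> L2_forms \<Omega> k. \<forall>T\<in>\<G>. \<exists>p\<in>P_local T k. \<forall>x\<in>interior T. \<mu> x = p x}"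

definition interp_local :: "'n point set \<Rightarrow> nat \<Rightarrow> ('n::{finite,linorder}) dform \<Rightarrow> 'n dform"
  where "interp_local T k \<mu> = (THE p. p \<in> P_local T k \<and>
    (\<forall>\<eta>\<in>P1_star_minus (k + 1).
       L2_inner (interior T) (ext_d (interior T) k p) \<eta>
         - L2_inner (interior T) p (codiff (interior T) (k + 1) \<eta>) =
       L2_inner (interior T) (ext_d (interior T) k \<mu>) \<eta>
         - L2_inner (interior T) \<mu> (codiff (interior T) (k + 1) \<eta>)) \<and>
    (\<forall>\<tau>\<in>P1_minus (k - 1).
       L2_inner (interior T) (codiff (interior T) k p) \<tau>
         - L2_inner (interior T) p (ext_d (interior T) (k - 1) \<tau>) =
       L2_inner (interior T) (codiff (interior T) k \<mu>) \<tau>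
         - L2_inner (interior T) \<mu> (ext_d (interior T) (k - 1) \<tau>)))"

definition interp :: "'n point set set \<Rightarrow> nat \<Rightarrow> ('n::{finite,linorder}) dform \<Rightarrow> 'n dform"
  where "interp \<G> k \<mu> = piecewise \<G> (\<lambda>T. interp_local T k \<mu>)"

end

theory Submission
  imports Defs
begin

text \<open>
  On one element write \<open>X = x - centroid\<close>; a local form is
  \<open>p = w + \<iota>\<^sub>X a + X \<and> b + q\<^sub>c\<close>, where \<open>d q\<^sub>c = 2 X \<and> c\<close> and \<open>\<delta> q\<^sub>c = 0\<close>.
  The interpolation conditions with data \<open>(f, df, \<delta>f)\<close> fix the moments
  \<open>\<integral>dp\<close>, \<open>\<integral>\<delta>p\<close>, \<open>\<integral>(X \<and> \<delta>p - k p)\<close> and \<open>\<integral>(\<iota>\<^sub>X dp + (n - k) p)\<close>, so that the coefficients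
  \<open>a\<close>, \<open>b\<close>, \<open>w\<close> are averages of the data. Eliminating \<open>w\<close> from the last equation cancels \<open>\<integral>f\<close>:
  \<open>2 \<integral>\<iota>\<^sub>X (X \<and> c) = \<integral>\<iota>\<^sub>X df + ((n - k) / k) \<integral>X \<and> \<delta>f\<close>. Without this cancellation one would lose
  a factor \<open>1 / diameter\<close>. Shape regularity makes the quadratic form \<open>\<integral>|X \<and> c|\<^sup>2\<close>
  coercive at the right scale, which gives both unisolvence and a stability bound by the data. For
  \<open>p\<close> in the local space, the difference between the interpolant of \<open>\<omega>\<close> and \<open>p\<close> satisfies
  the same equations with \<open>f = \<omega> - p\<close>, so stability yields quasi-optimality, and the local
  estimates add up in squares.

  The derivatives are chosen weak derivatives, hence the need for their uniqueness almost
  everywhere.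
\<close>

text \<open>The obstacle is the scaling of c. With X the centred variable, h the diameter and m the
  measure of the element, the norm of \<open>X \<and> c\<close> is of order
  \<open>h m\<^sup>1\<^sup>/\<^sup>2 |c|\<close>. Pairing \<open>\<integral>f\<close> with c costs
  \<open>m\<^sup>1\<^sup>/\<^sup>2 |c|\<close> times the norm of f, so this term would bound the
  norm of \<open>X \<and> c\<close> only by that of f divided by h. In the combination free of
  \<open>\<integral>f\<close> each datum is multiplied by X, which supplies the missing h. Positive
  powers of h remain in the norm of p itself, because its linear and quadratic parts carry one and
  two factors of X. The three norms do not scale alike, so these powers go into the constant through
  the bound \<open>h\<^sub>0\<close> on the diameters. The Lipschitz boundary excludes slits: the
  elements fill the closure of \<Omega>, and their interiors must lie in \<Omega> itself, where the
  form has its weak derivatives.\<close>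

section \<open>Smooth bumps and the fundamental lemma of the calculus of variations\<close>

text \<open>The family is closed under differentiation up to linear combinations, whence smoothness.\<close>

definition flat :: "nat \<Rightarrow> real \<Rightarrow> real"
  where "flat k t = (if t > 0 then exp (- (1 / t)) / t ^ k else 0)"

text \<open>The substitution t = 1 / s turns the right-hand limit into the decay of
  \<open>s ^ k / exp s\<close>.\<close>

lemma flat_tendsto_0: "(flat k \<longlongrightarrow> 0) (at 0)"
proof -
  have "((\<lambda>s. s ^ k / exp s) \<longlongrightarrow> (0::real)) at_top"
    by (rule tendsto_power_div_exp_0)
  then have "((\<lambda>t. inverse t ^ k / exp (inverse t)) \<longlongrightarrow> (0::real)) (at_right 0)"
    by (rule filterlim_compose[OF _ filterlim_inverse_at_top_right])
  then have "(flat k \<longlongrightarrow> 0) (at_right 0)"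
    by (rule Lim_transform_eventually)
      (auto simp: eventually_at_filter flat_def exp_minus field_simps)
  moreover have "(flat k \<longlongrightarrow> 0) (at_left 0)"
    by (rule Lim_transform_eventually[OF tendsto_const])
      (auto simp: eventually_at_filter flat_def)
  ultimately show ?thesis
    by (simp add: filterlim_split_at)
qed

lemma flat_has_derivative:
  "(flat k has_real_derivative (flat (k + 2) t - real k * flat (k + 1) t)) (at t)"
proof -
  consider "t > 0" | "t < 0" | "t = 0" by linarith
  then show ?thesis
  proof cases
    case 1
    have E: "((\<lambda>t. exp (- (1 / t))) has_real_derivative exp (- (1 / t)) / t ^ 2) (at t)"
      using 1 by (auto intro!: derivative_eq_intros simp: power2_eq_square)
    have "((\<lambda>t. t ^ k) has_real_derivative real k * t ^ k / t) (at t)"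
      using 1 DERIV_pow[of k t UNIV] by (cases k) auto
    from DERIV_divide[OF E this] have "((\<lambda>t. exp (- (1 / t)) / t ^ k) has_real_derivative
        (flat (k + 2) t - real k * flat (k + 1) t)) (at t)"
    proof (rule DERIV_cong)
      have "(e / t\<^sup>2 * P - e * (real k * P / t)) / (P * P) = e / (P * t\<^sup>2) - real k * (e / (P * t))"
        if "P > 0" for P e :: real
        using 1 that by (simp add: field_simps power2_eq_square)
      from this[of "t ^ k" "exp (- (1 / t))"] 1
      show "(exp (- (1 / t)) / t\<^sup>2 * t ^ k - exp (- (1 / t)) * (real k * t ^ k / t)) / (t ^ k * t ^ k) =
          flat (k + 2) t - real k * flat (k + 1) t"
        by (simp add: flat_def power_add power2_eq_square mult_ac)
    qed (use 1 in simp)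
    then show ?thesis
      by (rule DERIV_cong_ev[THEN iffD1, OF refl _ refl, rotated])
        (use 1 in \<open>auto simp: flat_def eventually_nhds intro!: exI[of _ "{0<..}"]\<close>)
  next
    case 2
    have "((\<lambda>t. 0) has_real_derivative (flat (k + 2) t - real k * flat (k + 1) t)) (at t)"
      using 2 by (simp add: flat_def)
    then show ?thesis
      by (rule DERIV_cong_ev[THEN iffD1, OF refl _ refl, rotated])
        (use 2 in \<open>auto simp: flat_def eventually_nhds intro!: exI[of _ "{..<0}"]\<close>)
  next
    case 3
    \<comment> \<open>At the origin the difference quotient is \<open>flat (Suc k)\<close>, so the
      limit lemma for the next index settles the only delicate point.\<close>
    have "((\<lambda>t. (flat k t - flat k 0) / (t - 0)) \<longlongrightarrow> 0) (at 0)"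
      by (rule Lim_transform_eventually[OF flat_tendsto_0[of "Suc k"]])
        (auto simp: flat_def field_simps eventually_at_filter)
    then show ?thesis
      using 3 by (simp add: has_field_derivative_iff flat_def)
  qed
qed

text \<open>\<open>Ck\<close> recurses on partial derivatives. A set of everywhere differentiable
  functions that is closed under partial differentiation therefore lies in every \<open>Ck m\<close>
  by one induction; sums and products are built in so that no product rule of higher order is
  needed.\<close>

inductive_set smooth_gens :: "(('n::finite) point \<Rightarrow> real) set"
  where
    const: "(\<lambda>x. c) \<in> smooth_gens"
  | flat: "(\<lambda>x. flat k (c * x $ i + d)) \<in> smooth_gens"
  | add: "f \<in> smooth_gens \<Longrightarrow> g \<in> smooth_gens \<Longrightarrow> (\<lambda>x. f x + g x) \<in> smooth_gens"
  | mult: "f \<in> smooth_gens \<Longrightarrow> g \<in> smooth_gens \<Longrightarrow> (\<lambda>x. f x * g x) \<in> smooth_gens"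

lemma partial_derivI:
  "(f has_derivative f') (at x) \<Longrightarrow> partial_deriv i f x = f' (axis i 1)"
  unfolding partial_deriv_def by (metis frechet_derivative_at)

lemma smooth_gens_deriv:
  "f \<in> smooth_gens \<Longrightarrow> (\<forall>x. f differentiable at x) \<and> (\<forall>i. partial_deriv i f \<in> smooth_gens)"
proof (induction rule: smooth_gens.induct)
  case (const c)
  have "partial_deriv i (\<lambda>x. c) = (\<lambda>x. 0)" for i :: 'a
    by (intro ext partial_derivI[THEN trans]) (auto intro: derivative_eq_intros)
  then show ?case by (auto intro: smooth_gens.const)
next
  case (flat k c i d)
  have D: "((\<lambda>x. flat k (c * x $ i + d)) has_derivative
      (\<lambda>h. (flat (k + 2) (c * x $ i + d) - real k * flat (k + 1) (c * x $ i + d)) * (c * h $ i))) (at x)" for x :: "'a point"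
    by (rule has_derivative_compose[OF _ flat_has_derivative[unfolded has_field_derivative_def], of "\<lambda>x. c * x $ i + d"])
      (auto intro!: derivative_eq_intros bounded_linear.has_derivative[OF bounded_linear_vec_nth])
  have "partial_deriv j (\<lambda>x. flat k (c * x $ i + d)) =
      (\<lambda>x. (flat (k + 2) (c * x $ i + d) + (- real k) * flat (k + 1) (c * x $ i + d)) * (c * axis j 1 $ i))" for j
    by (rule ext, subst partial_derivI[OF D]) simp
  moreover have "(\<lambda>x. (flat (k + 2) (c * x $ i + d) + (- real k) * flat (k + 1) (c * x $ i + d)) *
      (c * axis j 1 $ i)) \<in> smooth_gens" for j
    by (intro smooth_gens.intros)
  ultimately show ?case
    using D unfolding differentiable_def by (simp only:) blast
next
  case (add f g)
  have "partial_deriv i (\<lambda>x. f x + g x) = (\<lambda>x. partial_deriv i f x + partial_deriv i g x)" for i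
  proof
    fix x
    have "f differentiable at x" "g differentiable at x" using add by auto
    then have "((\<lambda>x. f x + g x) has_derivative (\<lambda>h. frechet_derivative f (at x) h + frechet_derivative g (at x) h)) (at x)"
      by (auto intro!: has_derivative_add simp: frechet_derivative_works)
    from partial_derivI[OF this] show "partial_deriv i (\<lambda>x. f x + g x) x = partial_deriv i f x + partial_deriv i g x"
      by (simp add: partial_deriv_def)
  qed
  then show ?case using add by (auto intro: smooth_gens.intros)
next
  case (mult f g)
  have "partial_deriv i (\<lambda>x. f x * g x) = (\<lambda>x. f x * partial_deriv i g x + partial_deriv i f x * g x)" for i
  proof
    fix x
    have "f differentiable at x" "g differentiable at x" using mult by auto
    then have "((\<lambda>x. f x * g x) has_derivative (\<lambda>h. f x * frechet_derivative g (at x) h + frechet_derivative f (at x) h * g x)) (at x)"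
      by (auto intro!: has_derivative_mult simp: frechet_derivative_works)
    from partial_derivI[OF this] show "partial_deriv i (\<lambda>x. f x * g x) x = f x * partial_deriv i g x + partial_deriv i f x * g x"
      by (simp add: partial_deriv_def)
  qed
  then show ?case using mult by (auto intro!: smooth_gens.intros)
qed

lemma differentiable_imp_continuous_UNIV:
  fixes f :: "('n::finite) point \<Rightarrow> real"
  shows "(\<And>x. f differentiable at x) \<Longrightarrow> continuous_on UNIV f"
  by (simp add: continuous_at_imp_continuous_on differentiable_imp_continuous_within)

lemma smooth_gens_Ck: "f \<in> smooth_gens \<Longrightarrow> Ck m f"
proof (induction m arbitrary: f)
  case 0
  then show ?case using smooth_gens_deriv[OF 0] by (auto intro: differentiable_imp_continuous_UNIV)
next
  case (Suc m)
  then show ?case using smooth_gens_deriv[OF Suc.prems] by auto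
qed

text \<open>The factor \<open>Suc m\<close> steepens the flanks: \<open>exp (- 1 / (m t))\<close>
  tends to 1 for t > 0, so the bumps tend to the indicator of the open box. This takes the place of
  mollification.\<close>

definition box_bump :: "nat \<Rightarrow> ('n::finite) point \<Rightarrow> 'n point \<Rightarrow> 'n point \<Rightarrow> real"
  where "box_bump m a b x =
    (\<Prod>i\<in>UNIV. flat 0 (real (Suc m) * (x $ i - a $ i)) * flat 0 (real (Suc m) * (b $ i - x $ i)))"

lemma box_bump_smooth: "box_bump m a b \<in> smooth_gens"
proof -
  have "(\<lambda>x. \<Prod>i\<in>I. flat 0 (real (Suc m) * (x $ i - a $ i)) * flat 0 (real (Suc m) * (b $ i - x $ i)))
      \<in> smooth_gens" if "finite I" for I
    using that
  proof induction
    case empty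
    show ?case by (simp add: smooth_gens.const)
  next
    case (insert i I)
    have "(\<lambda>x. flat 0 (real (Suc m) * (x $ i - a $ i))) \<in> smooth_gens"
      using smooth_gens.flat[of 0 "real (Suc m)" i "- real (Suc m) * a $ i"] by (simp add: algebra_simps)
    moreover have "(\<lambda>x. flat 0 (real (Suc m) * (b $ i - x $ i))) \<in> smooth_gens"
      using smooth_gens.flat[of 0 "- real (Suc m)" i "real (Suc m) * b $ i"] by (simp add: algebra_simps)
    ultimately show ?case
      using insert by (auto intro!: smooth_gens.mult)
  qed
  from this[of UNIV] show ?thesis by (simp add: box_bump_def[abs_def])
qed

lemma box_bump_eq_0: "x \<notin> box a b \<Longrightarrow> box_bump m a b x = 0"
proof -
  assume "x \<notin> box a b"
  then obtain i where "x $ i - a $ i \<le> 0 \<or> b $ i - x $ i \<le> 0"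
    by (auto simp: mem_box_cart not_less)
  then have "flat 0 (real (Suc m) * (x $ i - a $ i)) * flat 0 (real (Suc m) * (b $ i - x $ i)) = 0"
    by (auto simp: flat_def zero_less_mult_iff)
  then show ?thesis
    unfolding box_bump_def by (intro prod_zero) auto
qed

lemma box_bump_le_1: "\<bar>box_bump m a b x\<bar> \<le> 1"
proof -
  have "\<bar>flat 0 t\<bar> \<le> 1" for t by (simp add: flat_def)
  then show ?thesis
    by (auto simp: box_bump_def abs_prod abs_mult intro!: prod_le_1 mult_le_one)
qed

lemma box_bump_tendsto: "(\<lambda>m. box_bump m a b x) \<longlonglongrightarrow> indicator (box a b) x"
proof (cases "x \<in> box a b")
  case True
  have *: "(\<lambda>m. flat 0 (real (Suc m) * t)) \<longlonglongrightarrow> 1" if "t > 0" for t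
  proof -
    have "(\<lambda>m. exp (- (inverse t * inverse (real (Suc m))))) \<longlonglongrightarrow> exp (- (inverse t * 0))"
      by (intro tendsto_intros LIMSEQ_inverse_real_of_nat)
    moreover have "t + t * real m > 0" for m
      using that by (simp add: add_pos_nonneg)
    ultimately show ?thesis
      using that by (simp add: flat_def field_simps)
  qed
  have "(\<lambda>m. box_bump m a b x) \<longlonglongrightarrow> (\<Prod>i\<in>(UNIV::'a set). 1 * 1)"
    unfolding box_bump_def using True by (intro tendsto_prod tendsto_mult *) (auto simp: mem_box_cart)
  then show ?thesis using True by simp
qed (simp add: box_bump_eq_0)

lemma box_bump_test:
  assumes "cbox a b \<subseteq> U" shows "box_bump m a b \<in> test_functions U"
proof -
  have "closure {x. box_bump m a b x \<noteq> 0} \<subseteq> cbox a b"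
    by (rule closure_minimal, use box_bump_eq_0[of _ a b m] box_subset_cbox[of a b] in blast)
      (rule closed_cbox)
  moreover from this have "compact (closure {x. box_bump m a b x \<noteq> 0})"
    by (metis bounded_cbox bounded_subset closed_closure compact_eq_bounded_closed)
  ultimately show ?thesis
    using assms by (auto simp: test_functions_def smooth_gens_Ck box_bump_smooth)
qed

lemma test_functions_diff:
  assumes "\<phi> \<in> test_functions U"
  shows "\<phi> differentiable at x" "continuous_on UNIV \<phi>" "continuous_on UNIV (partial_deriv i \<phi>)"
proof -
  have 1: "Ck (Suc 1) \<phi>" using assms by (auto simp only: test_functions_def mem_Collect_eq)
  then show "\<phi> differentiable at x" by simp
  from 1 show "continuous_on UNIV \<phi>" by (auto intro: differentiable_imp_continuous_UNIV)
  from 1 show "continuous_on UNIV (partial_deriv i \<phi>)" by (auto intro: differentiable_imp_continuous_UNIV)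
qed

lemma test_functions_mono: "U \<subseteq> V \<Longrightarrow> test_functions U \<subseteq> test_functions V"
  by (auto simp: test_functions_def)

text \<open>Open boxes form an intersection-stable generator of the Borel sets, so the integral
  vanishes over every Borel set, and densities are unique. The bounding box makes the complement
  step possible: it reduces the integral over the whole space to one over a box.\<close>

lemma integral_boxes_zero_imp_AE_zero:
  fixes g :: "('n::finite) point \<Rightarrow> real"
  assumes g: "integrable lborel g" and supp: "\<And>x. x \<notin> box A B \<Longrightarrow> g x = 0"
    and z: "\<And>a b. box a b \<subseteq> box A B \<Longrightarrow> (LINT x:box a b|lborel. g x) = 0"
  shows "AE x in lborel. g x = 0"
proof -
  have int: "set_integrable lborel S g" if "S \<in> sets borel" for S
    unfolding set_integrable_def using g that by (intro integrable_mult_indicator) auto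
  have zero: "(LINT x:S|lborel. g x) = 0" if "S \<in> sets borel" for S
  proof -
    have "(LINT x:UNIV|lborel. g x) = (LINT x:box A B|lborel. g x)"
      unfolding set_lebesgue_integral_def
      by (intro Bochner_Integration.integral_cong) (auto simp: indicator_def supp)
    then have UN: "(LINT x:UNIV|lborel. g x) = 0"
      using z[of A B] by simp
    have "Int_stable (range (\<lambda>(a, b). box a b :: 'n point set))"
      by (auto simp: Int_stable_def box_Int_box image_iff)
    moreover have "range (\<lambda>(a, b). box a b :: 'n point set) \<subseteq> Pow UNIV"
      by simp
    moreover have "S \<in> sigma_sets UNIV (range (\<lambda>(a, b). box a b))"
      using that by (simp add: borel_eq_box)
    ultimately show ?thesis
    proof (induction rule: sigma_sets_induct_disjoint)
      case (basic S)
      then obtain a b where S: "S = box a b" by auto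
      obtain a' b' where ab: "box a b \<inter> box A B = box a' b'" by (simp add: box_Int_box)
      have "(LINT x:S|lborel. g x) = (LINT x:box a' b'|lborel. g x)"
        unfolding S ab[symmetric] set_lebesgue_integral_def
        by (intro Bochner_Integration.integral_cong) (auto simp: indicator_def supp)
      then show ?case using z[of a' b'] ab by auto
    next
      case (compl S)
      then have "S \<in> sets borel" by (simp add: borel_eq_box)
      then show ?case
        using set_integral_Un[of S "UNIV - S" lborel g] int UN compl by auto
    next
      case (union S)
      then have "S i \<in> sets borel" for i
        unfolding borel_eq_box by (subst sets_measure_of) auto
      then show ?case
        using union by (subst lebesgue_integral_countable_add) (auto simp: disjoint_family_on_def intro!: int)
    qed (simp add: set_lebesgue_integral_def)
  qed
  show ?thesis
    by (rule density_unique_real[of lborel g "\<lambda>_. 0"]) (auto simp: g zero)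
qed


text \<open>The bumps are bounded by 1, so |f| on U is an integrable majorant and the limit of the
  bumps passes under the integral.\<close>

lemma test_orthogonal_imp_box_integral_zero:
  fixes f :: "('n::finite) point \<Rightarrow> real"
  assumes f: "set_integrable lebesgue U f" and ab: "cbox a b \<subseteq> U"
    and z: "\<And>\<phi>. \<phi> \<in> test_functions U \<Longrightarrow> (LINT x:U|lebesgue. \<phi> x * f x) = 0"
  shows "(LINT x:box a b|lebesgue. f x) = 0"
proof -
  have [measurable]: "box_bump m a b \<in> borel_measurable lebesgue" for m
    using test_functions_diff(2)[OF box_bump_test[OF ab]]
    by (simp add: borel_measurable_continuous_onI measurable_completion)
  have [measurable]: "(\<lambda>x. indicator U x * f x) \<in> borel_measurable lebesgue"
    using f by (auto simp: set_integrable_def)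
  have [measurable]: "box a b \<in> sets lebesgue" by simp
  have "(\<lambda>m. LINT x|lebesgue. box_bump m a b x * (indicator U x * f x)) \<longlonglongrightarrow>
     (LINT x|lebesgue. indicator (box a b) x * (indicator U x * f x))"
  proof (rule integral_dominated_convergence[where w = "\<lambda>x. \<bar>indicator U x * f x\<bar>"])
    show "integrable lebesgue (\<lambda>x. \<bar>indicator U x * f x\<bar>)"
      using f by (auto simp: set_integrable_def)
    show "AE x in lebesgue. (\<lambda>m. box_bump m a b x * (indicator U x * f x)) \<longlonglongrightarrow>
        indicator (box a b) x * (indicator U x * f x)"
      by (auto intro!: tendsto_mult_right box_bump_tendsto)
    show "AE x in lebesgue. norm (box_bump m a b x * (indicator U x * f x)) \<le> \<bar>indicator U x * f x\<bar>" for m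
    proof (rule AE_I2)
      fix x
      show "norm (box_bump m a b x * (indicator U x * f x)) \<le> \<bar>indicator U x * f x\<bar>"
        unfolding real_norm_def abs_mult[of "box_bump m a b x"]
        by (rule mult_left_le_one_le[OF abs_ge_zero abs_ge_zero box_bump_le_1])
    qed
  qed measurable
  moreover have "(LINT x|lebesgue. box_bump m a b x * (indicator U x * f x)) = 0" for m
    using z[OF box_bump_test[OF ab], of m]
    by (simp add: set_lebesgue_integral_def mult.left_commute)
  ultimately have "(LINT x|lebesgue. indicator (box a b) x * (indicator U x * f x)) = 0"
    by (simp add: LIMSEQ_const_iff)
  moreover have "indicator (box a b) x * (indicator U x * f x) = indicator (box a b) x *\<^sub>R f x" for x
    using ab box_subset_cbox[of a b] by (auto simp: indicator_def)
  ultimately show ?thesis by (simp add: set_lebesgue_integral_def)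
qed

lemma fundamental_lemma_of_variations:
  fixes f :: "('n::finite) point \<Rightarrow> real"
  assumes U: "open U" and f: "set_integrable lebesgue U f"
    and z: "\<And>\<phi>. \<phi> \<in> test_functions U \<Longrightarrow> (LINT x:U|lebesgue. \<phi> x * f x) = 0"
  shows "AE x in lebesgue. x \<in> U \<longrightarrow> f x = 0"
proof -
  have box: "AE x in lebesgue. x \<in> box A B \<longrightarrow> f x = 0" if AB: "cbox A B \<subseteq> U" for A B
  proof -
    have boxU: "box A B \<subseteq> U" using AB box_subset_cbox by blast
    have "set_integrable lebesgue (box A B) f"
      by (rule set_integrable_subset[OF f _ boxU]) simp
    then have int: "integrable lebesgue (\<lambda>x. indicator (box A B) x * f x)"
      by (simp add: set_integrable_def)
    \<comment> \<open>The generator argument lives on Borel sets, so f is replaced by a Borel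
      function that agrees with it off a null set.\<close>
    then obtain g where g [measurable]: "g \<in> borel_measurable lborel"
      and fg: "AE x in lborel. indicator (box A B) x * f x = g x"
      using completion_ex_borel_measurable_real[OF borel_measurable_integrable] by blast
    define g' where "g' x = indicator (box A B) x * g x" for x
    have fg': "AE x in lebesgue. g' x = indicator (box A B) x * f x"
      using AE_completion[OF fg] by eventually_elim (auto simp: g'_def indicator_def)
    have [measurable]: "g' \<in> borel_measurable lborel"
      unfolding g'_def by measurable
    then have g'm [measurable]: "g' \<in> borel_measurable lebesgue"
      by (rule measurable_completion)
    have "integrable lebesgue g'"
      using int fg' by (subst integrable_cong_AE[of _ _ "\<lambda>x. indicator (box A B) x * f x"]) auto
    then have "integrable lborel g'"
      by (simp add: integrable_completion)
    moreover have "(LINT x:box a b|lborel. g' x) = 0" if ab: "box a b \<subseteq> box A B" for a b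
    proof (cases "box a b = {}")
      case False
      then have "cbox a b \<subseteq> cbox A B"
        using closure_mono[OF ab] by (metis closure_box closure_subset closure_empty
          box_subset_cbox closed_cbox closure_minimal order_trans ab)
      then have "cbox a b \<subseteq> U" using AB by auto
      have "(LINT x:box a b|lborel. g' x) = (LINT x|lebesgue. indicator (box a b) x *\<^sub>R g' x)"
        unfolding set_lebesgue_integral_def by (rule integral_completion[symmetric]) measurable
      also have "\<dots> = (LINT x|lebesgue. indicator (box a b) x *\<^sub>R (indicator (box A B) x * f x))"
      proof (rule integral_cong_AE)
        have [measurable]: "box a b \<in> sets lebesgue" by simp
        show "(\<lambda>x. indicator (box a b) x *\<^sub>R g' x) \<in> borel_measurable lebesgue" by measurable
        have [measurable]: "(\<lambda>x. indicator (box A B) x * f x) \<in> borel_measurable lebesgue"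
          using int by auto
        show "(\<lambda>x. indicator (box a b) x *\<^sub>R (indicator (box A B) x * f x)) \<in> borel_measurable lebesgue"
          by measurable
      qed (use fg' in auto)
      also have "\<dots> = (LINT x:box a b|lebesgue. f x)"
        unfolding set_lebesgue_integral_def using ab
        by (intro Bochner_Integration.integral_cong) (auto simp: indicator_def)
      also have "\<dots> = 0"
        by (rule test_orthogonal_imp_box_integral_zero[OF f \<open>cbox a b \<subseteq> U\<close> z])
      finally show ?thesis .
    qed (simp add: set_lebesgue_integral_def)
    ultimately have "AE x in lborel. g' x = 0"
      by (intro integral_boxes_zero_imp_AE_zero[of g' A B]) (auto simp: g'_def)
    from AE_completion[OF this] fg' show ?thesis
      by eventually_elim (auto simp: indicator_def)
  qed
  \<comment> \<open>Countably many closed boxes exhaust U, and each differs by a null set from its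
    open box, on which f vanishes almost everywhere.\<close>
  obtain D where D: "countable D" "D \<subseteq> Pow U" "\<And>X. X \<in> D \<Longrightarrow> \<exists>a b. X = cbox a b" "\<Union>D = U"
    using open_countable_Union_open_cbox[OF U] by metis
  have "AE x in lebesgue. \<forall>X\<in>D. x \<in> X \<longrightarrow> f x = 0"
  proof (subst AE_ball_countable[OF D(1)], intro ballI)
    fix X assume "X \<in> D"
    then obtain a b where X: "X = cbox a b" "cbox a b \<subseteq> U" using D by blast
    have "cbox a b - box a b \<in> null_sets lebesgue"
      using negligible_frontier_interval[of a b] by (simp add: negligible_iff_null_sets)
    from AE_not_in[OF this] box[OF X(2)] show "AE x in lebesgue. x \<in> X \<longrightarrow> f x = 0"
      unfolding X(1) by eventually_elim auto
  qed
  then show ?thesis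
    using D(4) by (elim eventually_mono) blast
qed

section \<open>Exterior and interior multiplication\<close>

definition pos_sign :: "'n \<Rightarrow> ('n::{finite,linorder}) set \<Rightarrow> real"
  where "pos_sign i \<alpha> = (- 1) ^ card {a \<in> \<alpha>. a < i}"

text \<open>With v read as a covector this is \<open>v \<and> w\<close>, and \<open>imul\<close> is
  the contraction with v. Both are written by their output index, so identities between them reduce
  to reindexing and signs.\<close>

definition emul :: "('n::{finite,linorder}) point \<Rightarrow> 'n extalg \<Rightarrow> 'n extalg"
  where "emul v w = (\<chi> \<alpha>. \<Sum>i\<in>\<alpha>. v $ i * pos_sign i \<alpha> * w $ (\<alpha> - {i}))"

definition imul :: "('n::{finite,linorder}) point \<Rightarrow> 'n extalg \<Rightarrow> 'n extalg"
  where "imul v w = (\<chi> \<alpha>. \<Sum>i\<in>- \<alpha>. v $ i * pos_sign i \<alpha> * w $ insert i \<alpha>)"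

lemma pos_sign_insert [simp]: "pos_sign i (insert i \<alpha>) = pos_sign i \<alpha>"
  unfolding pos_sign_def by (rule arg_cong[of _ _ "\<lambda>S. (- 1) ^ card S"]) auto

lemma pos_sign_remove [simp]: "pos_sign i (\<alpha> - {i}) = pos_sign i \<alpha>"
  unfolding pos_sign_def by (rule arg_cong[of _ _ "\<lambda>S. (- 1) ^ card S"]) auto

lemma pos_sign_square [simp]: "pos_sign i \<alpha> * pos_sign i \<alpha> = 1" "pos_sign i \<alpha> * (pos_sign i \<alpha> * x) = x"
  by (simp_all add: pos_sign_def flip: power_add mult.assoc)

lemma bounded_bilinear_emul: "bounded_bilinear emul"
  unfolding bilinear_conv_bounded_bilinear[symmetric] bilinear_def linear_iff
  by (auto simp: emul_def vec_eq_iff algebra_simps sum.distrib sum_distrib_left)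

lemma bounded_bilinear_imul: "bounded_bilinear imul"
  unfolding bilinear_conv_bounded_bilinear[symmetric] bilinear_def linear_iff
  by (auto simp: imul_def vec_eq_iff algebra_simps sum.distrib sum_distrib_left)

interpretation emul: bounded_bilinear emul by (rule bounded_bilinear_emul)
interpretation imul: bounded_bilinear imul by (rule bounded_bilinear_imul)

lemma emul_axis_nth: "emul (axis i 1) w $ \<alpha> = (if i \<in> \<alpha> then pos_sign i \<alpha> * w $ (\<alpha> - {i}) else 0)"
  by (auto simp: emul_def axis_def if_distrib[of "\<lambda>x. x * _"] sum.delta' cong: if_cong)

lemma imul_axis_nth: "imul (axis i 1) w $ \<alpha> = (if i \<notin> \<alpha> then pos_sign i \<alpha> * w $ insert i \<alpha> else 0)"
  by (auto simp: imul_def axis_def if_distrib[of "\<lambda>x. x * _"] sum.delta' cong: if_cong)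

lemma point_expand: "(\<Sum>i\<in>UNIV. v $ i *\<^sub>R axis i 1) = (v :: ('n::finite) point)"
  using basis_expansion[of v] by (simp add: scalar_mult_eq_scaleR)

lemma emul_expand: "emul v w = (\<Sum>i\<in>UNIV. v $ i *\<^sub>R emul (axis i 1) w)"
  by (subst (1) point_expand[of v, symmetric]) (simp only: emul.sum_left emul.scaleR_left)

lemma imul_expand: "imul v w = (\<Sum>i\<in>UNIV. v $ i *\<^sub>R imul (axis i 1) w)"
  by (subst (1) point_expand[of v, symmetric]) (simp only: imul.sum_left imul.scaleR_left)

text \<open>For a coordinate vector, removing i maps the index sets that contain i bijectively to
  those that omit it; bilinearity does the rest. This adjunction is what later turns
  \<open>gram\<close> into the integral of a square.\<close>

lemma inner_emul: "emul v w \<bullet> u = w \<bullet> imul v u"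
proof -
  have "emul (axis i 1) w \<bullet> u = w \<bullet> imul (axis i 1) u" for i
  proof -
    have "emul (axis i 1) w \<bullet> u = (\<Sum>\<alpha> | i \<in> \<alpha>. pos_sign i \<alpha> * w $ (\<alpha> - {i}) * u $ \<alpha>)"
      by (simp add: inner_vec_def emul_axis_nth if_distrib[of "\<lambda>x. x * _"] flip: sum.inter_filter cong: if_cong)
    also have "\<dots> = (\<Sum>\<alpha> | i \<notin> \<alpha>. w $ \<alpha> * (pos_sign i \<alpha> * u $ insert i \<alpha>))"
      by (rule sum.reindex_bij_witness[of _ "insert i" "\<lambda>\<alpha>. \<alpha> - {i}"]) (auto simp: insert_absorb)
    also have "\<dots> = w \<bullet> imul (axis i 1) u"
      by (simp add: inner_vec_def imul_axis_nth if_distrib[of "\<lambda>x. _ * x"] flip: sum.inter_filter cong: if_cong)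
    finally show ?thesis .
  qed
  then show ?thesis
    by (subst emul_expand, subst imul_expand) (simp add: inner_sum_left inner_sum_right)
qed

lemma card_complement: "card (- \<alpha>) = CARD('n) - card (\<alpha> :: ('n::finite) set)"
  by (simp add: Compl_eq_Diff_UNIV card_Diff_subset)

lemma Alt_subspace: "subspace (Alt j)"
  by (auto simp: subspace_def Alt_def)

lemma emul_Alt: "w \<in> Alt j \<Longrightarrow> emul v w \<in> Alt (Suc j)"
  by (auto simp: Alt_def emul_def intro!: sum.neutral)
    (metis card_Suc_Diff1 finite)

lemma imul_Alt: "w \<in> Alt (Suc j) \<Longrightarrow> imul v w \<in> Alt j"
  by (auto simp: Alt_def imul_def intro!: sum.neutral)

lemma emul_axis_emul_axis: "emul (axis i 1) (emul (axis i 1) w) = 0"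
  by (simp add: vec_eq_iff emul_axis_nth)

lemma imul_axis_imul_axis: "imul (axis i 1) (imul (axis i 1) w) = 0"
  by (simp add: vec_eq_iff imul_axis_nth)

text \<open>The i-th summand keeps the coefficient of \<alpha> exactly when i belongs to \<alpha>,
  so the sum counts elements. Together with the complementary count in the next lemma it is the
  source of the factors k, k + 1, n - k and n - k + 1 in the derivatives of local and test
  forms.\<close>

lemma sum_emul_imul:
  assumes "w \<in> Alt j"
  shows "(\<Sum>i\<in>UNIV. emul (axis i 1) (imul (axis i 1) w)) = real j *\<^sub>R w"
proof -
  have "emul (axis i 1) (imul (axis i 1) w) $ \<alpha> = (if i \<in> \<alpha> then w $ \<alpha> else 0)" for i \<alpha>
    by (simp add: emul_axis_nth imul_axis_nth insert_absorb)
  then show ?thesis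
    using assms by (auto simp: vec_eq_iff Alt_def sum.If_cases)
qed

lemma sum_imul_emul:
  fixes w :: "('n::{finite,linorder}) extalg"
  assumes "w \<in> Alt j"
  shows "(\<Sum>i\<in>UNIV. imul (axis i 1) (emul (axis i 1) w)) = (real CARD('n) - real j) *\<^sub>R w"
proof -
  have "imul (axis i 1) (emul (axis i 1) w) $ \<alpha> = (if i \<in> - \<alpha> then w $ \<alpha> else 0)" for i \<alpha>
    by (auto simp add: emul_axis_nth imul_axis_nth)
  then have "(\<Sum>i\<in>UNIV. imul (axis i 1) (emul (axis i 1) w)) $ \<alpha> = real (card (- \<alpha>)) * w $ \<alpha>" for \<alpha>
    by (simp add: sum.If_cases Compl_eq)
  moreover have "real (card (- \<alpha>)) = real CARD('n) - real (card \<alpha>)" for \<alpha> :: "'n set"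
    by (simp add: card_complement of_nat_diff card_mono)
  ultimately show ?thesis
    using assms by (auto simp: vec_eq_iff Alt_def)
qed

section \<open>Permutation signs and the Hodge star\<close>

lemma shuffle_sign_single: "shuffle_sign {i} \<alpha> = pos_sign i \<alpha>"
proof -
  have "{(a, b). a \<in> {i} \<and> b \<in> \<alpha> \<and> b < a} = Pair i ` {a \<in> \<alpha>. a < i}" by auto
  then show ?thesis by (simp add: shuffle_sign_def pos_sign_def card_image inj_on_def)
qed

lemma shuffle_sign_square [simp]: "shuffle_sign \<alpha> \<beta> * shuffle_sign \<alpha> \<beta> = 1"
  by (simp add: shuffle_sign_def flip: power_add)

lemma shuffle_sign_insert_left:
  assumes "i \<notin> \<alpha>" shows "shuffle_sign (insert i \<alpha>) \<beta> = shuffle_sign \<alpha> \<beta> * pos_sign i \<beta>"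
proof -
  have "{(a, b). a \<in> insert i \<alpha> \<and> b \<in> \<beta> \<and> b < a} =
      {(a, b). a \<in> \<alpha> \<and> b \<in> \<beta> \<and> b < a} \<union> Pair i ` {b \<in> \<beta>. b < i}" by auto
  moreover have "card \<dots> = card {(a, b). a \<in> \<alpha> \<and> b \<in> \<beta> \<and> b < a} + card (Pair i ` {b \<in> \<beta>. b < i})"
    using assms by (intro card_Un_disjoint) auto
  ultimately show ?thesis
    by (simp add: shuffle_sign_def pos_sign_def power_add card_image inj_on_def)
qed

lemma shuffle_sign_insert_right:
  assumes "i \<notin> \<beta>"
  shows "shuffle_sign \<alpha> (insert i \<beta>) = shuffle_sign \<alpha> \<beta> * (- 1) ^ card {a \<in> \<alpha>. i < a}"
proof -
  have "{(a, b). a \<in> \<alpha> \<and> b \<in> insert i \<beta> \<and> b < a} =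
      {(a, b). a \<in> \<alpha> \<and> b \<in> \<beta> \<and> b < a} \<union> (\<lambda>a. (a, i)) ` {a \<in> \<alpha>. i < a}" by auto
  moreover have "card \<dots> = card {(a, b). a \<in> \<alpha> \<and> b \<in> \<beta> \<and> b < a} + card ((\<lambda>a. (a, i)) ` {a \<in> \<alpha>. i < a})"
    using assms by (intro card_Un_disjoint) auto
  ultimately show ?thesis
    by (simp add: shuffle_sign_def power_add card_image inj_on_def)
qed

text \<open>Every pair in the product set is an inversion for exactly one of the two orders.\<close>

lemma shuffle_sign_swap:
  assumes "\<alpha> \<inter> \<beta> = {}"
  shows "shuffle_sign \<alpha> \<beta> * shuffle_sign \<beta> \<alpha> = (- 1) ^ (card \<alpha> * card \<beta>)"
proof -
  have "card {(a, b). a \<in> \<beta> \<and> b \<in> \<alpha> \<and> b < a} = card {(a, b). a \<in> \<alpha> \<and> b \<in> \<beta> \<and> a < b}"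
    by (rule bij_betw_same_card[of prod.swap]) (auto simp: bij_betw_def inj_on_def)
  moreover have "\<alpha> \<times> \<beta> = {(a, b). a \<in> \<alpha> \<and> b \<in> \<beta> \<and> b < a} \<union> {(a, b). a \<in> \<alpha> \<and> b \<in> \<beta> \<and> a < b}"
    using assms by (auto simp: set_eq_iff) (metis linorder_neqE)
  moreover have "card \<dots> = card {(a, b). a \<in> \<alpha> \<and> b \<in> \<beta> \<and> b < a} + card {(a, b). a \<in> \<alpha> \<and> b \<in> \<beta> \<and> a < b}"
    by (intro card_Un_disjoint) auto
  ultimately have "card {(a, b). a \<in> \<alpha> \<and> b \<in> \<beta> \<and> b < a} + card {(a, b). a \<in> \<beta> \<and> b \<in> \<alpha> \<and> b < a} = card \<alpha> * card \<beta>"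
    using card_cartesian_product[of \<alpha> \<beta>] by argo
  then show ?thesis
    unfolding shuffle_sign_def power_add[symmetric] by simp
qed

lemma pos_sign_split:
  "i \<notin> \<alpha> \<Longrightarrow> pos_sign i \<alpha> * (- 1) ^ card {a \<in> \<alpha>. i < a} = (- 1) ^ card \<alpha>"
proof -
  assume "i \<notin> \<alpha>"
  then have "\<alpha> = {a \<in> \<alpha>. a < i} \<union> {a \<in> \<alpha>. i < a}" by auto (metis linorder_neqE)
  moreover have "card \<dots> = card {a \<in> \<alpha>. a < i} + card {a \<in> \<alpha>. i < a}"
    by (intro card_Un_disjoint) auto
  ultimately show ?thesis by (simp add: pos_sign_def flip: power_add)
qed

lemma hodge_nth: "hodge w $ \<alpha> = shuffle_sign \<alpha> (- \<alpha>) * w $ (- \<alpha>)"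
proof -
  have "hodge w $ \<alpha> = (\<Sum>\<beta>\<in>UNIV. if \<beta> = - \<alpha> then shuffle_sign \<alpha> (- \<alpha>) * w $ (- \<alpha>) else 0)"
    unfolding hodge_def sum_component
    by (intro sum.cong refl) (auto simp: dx_def axis_def)
  also have "\<dots> = shuffle_sign \<alpha> (- \<alpha>) * w $ (- \<alpha>)"
    by simp
  finally show ?thesis .
qed

lemma linear_hodge: "linear hodge"
  by (auto simp: linear_iff vec_eq_iff hodge_nth algebra_simps)

lemma hodge_Alt:
  fixes w :: "('n::{finite,linorder}) extalg"
  assumes "w \<in> Alt j" "j \<le> CARD('n)" shows "hodge w \<in> Alt (CARD('n) - j)"
proof -
  have "card (- \<alpha>) \<noteq> j" if "card \<alpha> \<noteq> CARD('n) - j" for \<alpha> :: "'n set"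
    using that card_complement[of "- \<alpha>"] by auto
  then show ?thesis using assms by (auto simp: Alt_def hodge_nth)
qed

lemma norm_hodge: "norm (hodge w) = norm w"
proof -
  have "hodge w \<bullet> hodge w = (\<Sum>\<alpha>\<in>UNIV. w $ (- \<alpha>) * w $ (- \<alpha>))"
    unfolding inner_vec_def
    by (intro sum.cong refl) (simp add: hodge_nth mult.left_commute[of _ "shuffle_sign _ _"] flip: mult.assoc)
  also have "\<dots> = w \<bullet> w"
    unfolding inner_vec_def by (simp, rule sum.reindex_bij_witness[of _ uminus uminus]) auto
  finally show ?thesis by (simp add: norm_eq_sqrt_inner)
qed

text \<open>The sign depends on the degree and the dimension but on no index set. It can therefore
  be absorbed into the constant form when the range of the starred Koszul operator is
  described.\<close>

lemma hodge_imul_hodge: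
  fixes w :: "('n::{finite,linorder}) extalg"
  assumes "w \<in> Alt j" "j < CARD('n)"
  shows "hodge (imul v (hodge w)) = (- 1) ^ (j * (CARD('n) - j - 1)) *\<^sub>R emul v w"
proof -
  have "shuffle_sign \<alpha> (- \<alpha>) * (v $ i * pos_sign i (- \<alpha>) * hodge w $ insert i (- \<alpha>))
      = (- 1) ^ (j * (CARD('n) - j - 1)) * (v $ i * pos_sign i \<alpha> * w $ (\<alpha> - {i}))"
    if i: "i \<in> \<alpha>" for i \<alpha>
  proof (cases "card (\<alpha> - {i}) = j")
    case True
    define \<gamma> where "\<gamma> = \<alpha> - {i}"
    have \<alpha>: "\<alpha> = insert i \<gamma>" "i \<notin> \<gamma>" using i by (auto simp: \<gamma>_def)
    have c: "- insert i (- \<alpha>) = \<gamma>" by (auto simp: \<gamma>_def)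
    have cc: "card (- \<alpha>) = CARD('n) - j - 1"
      using True \<alpha> by (simp add: card_complement \<gamma>_def[symmetric])
    have "shuffle_sign \<alpha> (- \<alpha>) * pos_sign i (- \<alpha>) * shuffle_sign (insert i (- \<alpha>)) \<gamma>
       = (shuffle_sign \<gamma> (- \<alpha>) * shuffle_sign (- \<alpha>) \<gamma>) * (pos_sign i (- \<alpha>) * pos_sign i (- \<alpha>)) * pos_sign i \<gamma>"
      using \<alpha>(2) i by (subst (1) \<alpha>(1)) (simp add: shuffle_sign_insert_left)
    also have "\<dots> = (- 1) ^ (j * (CARD('n) - j - 1)) * pos_sign i \<alpha>"
      using True cc by (subst shuffle_sign_swap) (auto simp: \<gamma>_def)
    finally have "shuffle_sign \<alpha> (- \<alpha>) * pos_sign i (- \<alpha>) * shuffle_sign (insert i (- \<alpha>)) \<gamma>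
       = (- 1) ^ (j * (CARD('n) - j - 1)) * pos_sign i \<alpha>" .
    then show ?thesis
      unfolding hodge_nth c by (simp add: \<gamma>_def mult_ac)
  next
    case False
    then have "w $ (\<alpha> - {i}) = 0" using assms by (auto simp: Alt_def)
    moreover have "- insert i (- \<alpha>) = \<alpha> - {i}" by auto
    ultimately show ?thesis by (simp add: hodge_nth)
  qed
  then have "(\<Sum>i\<in>\<alpha>. shuffle_sign \<alpha> (- \<alpha>) * (v $ i * pos_sign i (- \<alpha>) * hodge w $ insert i (- \<alpha>)))
      = (\<Sum>i\<in>\<alpha>. (- 1) ^ (j * (CARD('n) - j - 1)) * (v $ i * pos_sign i \<alpha> * w $ (\<alpha> - {i})))" for \<alpha>
    by (rule sum.cong[OF refl])
  then show ?thesis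
    unfolding vec_eq_iff hodge_nth[of "imul _ _"] sum_distrib_left[symmetric]
    by (simp add: imul_def emul_def)
qed

text \<open>Because of this identity the codifferential of a smooth form is minus the sum of the
  contractions of its partial derivatives, without any sign that depends on degree or
  dimension.\<close>

lemma hodge_emul_hodge:
  fixes w :: "('n::{finite,linorder}) extalg"
  assumes "w \<in> Alt j"
  shows "(- 1) ^ (j * CARD('n)) *\<^sub>R hodge (emul v (hodge w)) = - imul v w"
proof -
  have "(- 1) ^ (j * CARD('n)) * (shuffle_sign \<alpha> (- \<alpha>) * (v $ i * pos_sign i (- \<alpha>) * hodge w $ (- \<alpha> - {i})))
      = - (v $ i * pos_sign i \<alpha> * w $ insert i \<alpha>)"
    if i: "i \<in> - \<alpha>" for i \<alpha>
  proof (cases "card (insert i \<alpha>) = j")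
    case True
    define \<gamma> where "\<gamma> = - \<alpha> - {i}"
    have \<alpha>: "- \<alpha> = insert i \<gamma>" "i \<notin> \<gamma>" "- \<gamma> = insert i \<alpha>" "i \<notin> \<alpha>" using i by (auto simp: \<gamma>_def)
    have cj: "j = Suc (card \<alpha>)" using True i by simp
    have cn: "CARD('n) = card \<alpha> + card \<gamma> + 1"
    proof -
      have "card (- \<alpha>) = Suc (card \<gamma>)" using \<alpha> by simp
      moreover have "card \<alpha> + card (- \<alpha>) = CARD('n)"
        using card_Un_disjoint[of \<alpha> "- \<alpha>"] by simp
      ultimately show ?thesis by simp
    qed
    have "shuffle_sign \<alpha> (- \<alpha>) * pos_sign i (- \<alpha>) * shuffle_sign \<gamma> (insert i \<alpha>)
       = (shuffle_sign \<alpha> \<gamma> * shuffle_sign \<gamma> \<alpha>) * (pos_sign i \<gamma> * (- 1) ^ card {a \<in> \<gamma>. i < a})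
          * (- 1) ^ card {a \<in> \<alpha>. i < a}"
      using \<alpha>(2,4) unfolding \<alpha>(1) by (simp add: shuffle_sign_insert_right)
    also have "\<dots> = (- 1) ^ (card \<alpha> * card \<gamma>) * (- 1) ^ card \<gamma> * (- 1) ^ card {a \<in> \<alpha>. i < a}"
      using \<alpha>(2) by (subst shuffle_sign_swap, force simp: \<gamma>_def) (simp add: pos_sign_split)
    also have "(- 1) ^ card {a \<in> \<alpha>. i < a} = (- 1) ^ card \<alpha> * pos_sign i \<alpha>"
      unfolding pos_sign_split[OF \<alpha>(4), symmetric] by (simp add: mult.commute[of _ "pos_sign i \<alpha>"])
    finally have S: "shuffle_sign \<alpha> (- \<alpha>) * pos_sign i (- \<alpha>) * shuffle_sign \<gamma> (insert i \<alpha>)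
       = (- 1) ^ (card \<alpha> * card \<gamma>) * (- 1) ^ card \<gamma> * ((- 1) ^ card \<alpha> * pos_sign i \<alpha>)" .
    \<comment> \<open>With a and g the sizes of \<alpha> and \<gamma> the exponent is (a + 1)(a + g
      + 1) + a g + g + a, which is a (a + 1) + 1 modulo 2.\<close>
    have "odd (j * CARD('n) + card \<alpha> * card \<gamma> + card \<gamma> + card \<alpha>)"
      unfolding cj cn by auto
    then have "(- 1::real) ^ (j * CARD('n)) * ((- 1) ^ (card \<alpha> * card \<gamma>) * (- 1) ^ card \<gamma> * (- 1) ^ card \<alpha>) = - 1"
      by (simp flip: power_add add: add.assoc)
    with S have "(- 1) ^ (j * CARD('n)) * (shuffle_sign \<alpha> (- \<alpha>) * pos_sign i (- \<alpha>) * shuffle_sign \<gamma> (insert i \<alpha>))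
       = - pos_sign i \<alpha>"
      by (metis (no_types, opaque_lifting) mult.assoc mult_minus1)
    then have "(- 1) ^ (j * CARD('n)) * (shuffle_sign \<alpha> (- \<alpha>) * pos_sign i (- \<alpha>) * shuffle_sign \<gamma> (insert i \<alpha>))
       * (v $ i * w $ insert i \<alpha>) = - pos_sign i \<alpha> * (v $ i * w $ insert i \<alpha>)"
      by simp
    then show ?thesis
      unfolding hodge_nth \<gamma>_def[symmetric] \<alpha>(3) by (simp only: mult_ac mult_minus_left mult_minus_right)
  next
    case False
    then have "w $ insert i \<alpha> = 0" using assms by (auto simp: Alt_def)
    moreover have "- (- \<alpha> - {i}) = insert i \<alpha>" by auto
    ultimately show ?thesis by (simp add: hodge_nth)
  qed
  then have "(\<Sum>i\<in>- \<alpha>. (- 1) ^ (j * CARD('n)) * (shuffle_sign \<alpha> (- \<alpha>) * (v $ i * pos_sign i (- \<alpha>) * hodge w $ (- \<alpha> - {i}))))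
      = (\<Sum>i\<in>- \<alpha>. - (v $ i * pos_sign i \<alpha> * w $ insert i \<alpha>))" for \<alpha>
    by (rule sum.cong[OF refl])
  then show ?thesis
    unfolding vec_eq_iff vector_scaleR_component hodge_nth[of "emul _ _"] sum_distrib_left[symmetric] sum_negf
    by (simp add: imul_def emul_def)
qed

lemma wedge_nth: "wedge v w $ \<gamma> = (\<Sum>\<alpha>\<in>Pow \<gamma>. v $ \<alpha> * w $ (\<gamma> - \<alpha>) * shuffle_sign \<alpha> (\<gamma> - \<alpha>))"
proof -
  have eq: "(\<alpha> \<inter> \<beta> = {} \<and> \<gamma> = \<alpha> \<union> \<beta>) \<longleftrightarrow> (\<alpha> \<subseteq> \<gamma> \<and> \<beta> = \<gamma> - \<alpha>)" for \<alpha> \<beta> by auto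
  have "wedge v w $ \<gamma> = (\<Sum>\<alpha>\<in>UNIV. \<Sum>\<beta>\<in>UNIV. if \<alpha> \<inter> \<beta> = {} \<and> \<gamma> = \<alpha> \<union> \<beta> then v $ \<alpha> * w $ \<beta> * shuffle_sign \<alpha> \<beta> else 0)"
    unfolding wedge_def by (auto simp: dx_def axis_def intro!: sum.cong)
  also have "\<dots> = (\<Sum>\<alpha>\<in>UNIV. \<Sum>\<beta>\<in>UNIV. if \<beta> = \<gamma> - \<alpha> then (if \<alpha> \<subseteq> \<gamma> then v $ \<alpha> * w $ \<beta> * shuffle_sign \<alpha> \<beta> else 0) else 0)"
    unfolding eq by (intro sum.cong) auto
  also have "\<dots> = (\<Sum>\<alpha>\<in>UNIV. if \<alpha> \<in> Pow \<gamma> then v $ \<alpha> * w $ (\<gamma> - \<alpha>) * shuffle_sign \<alpha> (\<gamma> - \<alpha>) else 0)"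
    by (intro sum.cong) auto
  finally show ?thesis by (simp add: sum.If_cases del: Pow_iff)
qed

section \<open>The wedge with a differential and the Koszul operator as multiplications by a
  vector\<close>

definition grad :: "(('n::finite) point \<Rightarrow> real) \<Rightarrow> 'n point \<Rightarrow> 'n point"
  where "grad \<phi> x = (\<chi> i. partial_deriv i \<phi> x)"

text \<open>A differential has coefficients on singletons only, so among the subsets in the wedge
  product just the singletons survive.\<close>

lemma wedge_differential: "wedge (differential \<phi> x) w = emul (grad \<phi> x) w"
proof (subst vec_eq_iff, intro allI)
  fix \<gamma>
  have d1: "differential \<phi> x $ {i} = partial_deriv i \<phi> x" for i
    by (simp add: differential_def dx_def axis_def if_distrib[of "\<lambda>x. _ * x"] cong: if_cong)
  have d0: "differential \<phi> x $ \<alpha> = 0" if "\<alpha> \<notin> range (\<lambda>i. {i})" for \<alpha>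
    using that by (auto simp: differential_def dx_def axis_def intro!: sum.neutral)
  have "wedge (differential \<phi> x) w $ \<gamma> =
      (\<Sum>\<alpha>\<in>(\<lambda>i. {i}) ` \<gamma>. differential \<phi> x $ \<alpha> * w $ (\<gamma> - \<alpha>) * shuffle_sign \<alpha> (\<gamma> - \<alpha>))"
    unfolding wedge_nth by (rule sum.mono_neutral_right) (use d0 in \<open>auto simp: image_iff\<close>)
  also have "\<dots> = emul (grad \<phi> x) w $ \<gamma>"
    by (subst sum.reindex) (auto simp: d1 emul_def grad_def shuffle_sign_single mult_ac intro!: sum.cong)
  finally show "wedge (differential \<phi> x) w $ \<gamma> = emul (grad \<phi> x) w $ \<gamma>" .
qed

lemma koszul_eq: "koszul c \<omega> x = imul (x - c) (\<omega> x)"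
proof (subst vec_eq_iff, intro allI)
  fix \<beta>
  have "koszul c \<omega> x $ \<beta> = (\<Sum>\<alpha>\<in>UNIV. \<Sum>i\<in>UNIV. if i \<in> \<alpha> \<and> \<beta> = \<alpha> - {i} then pos_sign i \<alpha> * (x $ i - c $ i) * \<omega> x $ \<alpha> else 0)"
    unfolding koszul_def sum_component
    by (intro sum.cong refl sum.mono_neutral_cong_left)
      (auto simp: dx_def axis_def pos_sign_def)
  also have "\<dots> = (\<Sum>i\<in>UNIV. \<Sum>\<alpha>\<in>UNIV. if i \<in> \<alpha> \<and> \<beta> = \<alpha> - {i} then pos_sign i \<alpha> * (x $ i - c $ i) * \<omega> x $ \<alpha> else 0)"
    by (rule sum.swap)
  also have "\<dots> = (\<Sum>i\<in>UNIV. \<Sum>\<alpha>\<in>UNIV. if \<alpha> = insert i \<beta> then (if i \<notin> \<beta> then (x $ i - c $ i) * pos_sign i \<beta> * \<omega> x $ insert i \<beta> else 0) else 0)"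
    by (intro sum.cong refl) (auto simp: insert_absorb)
  also have "\<dots> = imul (x - c) (\<omega> x) $ \<beta>"
    by (simp add: imul_def sum.If_cases Compl_eq)
  finally show "koszul c \<omega> x $ \<beta> = imul (x - c) (\<omega> x) $ \<beta>" .
qed

section \<open>Integration by parts\<close>

lemma integrable_compact_support:
  fixes F :: "('n::finite) point \<Rightarrow> 'b::euclidean_space"
  assumes F: "continuous_on UNIV F" and K: "compact K" and z: "\<And>x. x \<notin> K \<Longrightarrow> F x = 0"
  shows "integrable lborel F"
proof -
  have "integrable lborel (\<lambda>x. indicator K x *\<^sub>R F x)"
    by (rule borel_integrable_compact[OF K continuous_on_subset[OF F subset_UNIV]])
  moreover have "(\<lambda>x. indicator K x *\<^sub>R F x) = F"
    using z by (auto simp: indicator_def)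
  ultimately show ?thesis by simp
qed

lemma set_integral_compact_support:
  fixes F :: "('n::finite) point \<Rightarrow> 'b::euclidean_space"
  assumes F: "continuous_on UNIV F" and z: "\<And>x. x \<notin> U \<Longrightarrow> F x = 0"
  shows "(LINT x:U|lebesgue. F x) = integral\<^sup>L lborel F"
proof -
  have "(\<lambda>x. indicator U x *\<^sub>R F x) = F"
    using z by (auto simp: indicator_def)
  moreover have "F \<in> borel_measurable lborel"
    using F by (simp add: borel_measurable_continuous_onI)
  ultimately show ?thesis
    by (simp add: set_lebesgue_integral_def integral_completion)
qed

lemma lborel_integral_translation:
  fixes F :: "('n::finite) point \<Rightarrow> 'b::euclidean_space"
  assumes F: "F \<in> borel_measurable borel"
  shows "(LINT x|lborel. F (c + x)) = integral\<^sup>L lborel F"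
    and "integrable lborel F \<Longrightarrow> integrable lborel (\<lambda>x. F (c + x))"
proof -
  have c: "(+) c \<in> measurable lborel borel" by simp
  show "(LINT x|lborel. F (c + x)) = integral\<^sup>L lborel F"
    using integral_distr[OF c F] by (simp add: lborel_distr_plus)
  show "integrable lborel F \<Longrightarrow> integrable lborel (\<lambda>x. F (c + x))"
    using integrable_distr_eq[OF c F] by (simp add: lborel_distr_plus)
qed

lemma derivative_zero_outside_closed:
  assumes g: "(g has_derivative g') (at x)" and K: "closed K" "x \<notin> K" and z: "\<And>y. y \<notin> K \<Longrightarrow> g y = 0"
  shows "g' h = 0"
proof -
  have "(g has_derivative (\<lambda>_. 0)) (at x)"
    by (rule has_derivative_transform_within_open[of "\<lambda>_. 0" _ _ _ "- K"]) (use K z in auto)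
  then show ?thesis using has_derivative_unique[OF g] by metis
qed

text \<open>By translation invariance every difference quotient in direction e has integral zero,
  and dominated convergence carries this over to the derivative; no coordinate has to be split
  off.\<close>

lemma integral_derivative_compact_support:
  fixes g :: "('n::finite) point \<Rightarrow> 'b::euclidean_space"
  assumes g: "\<And>x. (g has_derivative g' x) (at x)" and cont: "continuous_on UNIV (\<lambda>x. g' x e)"
    and K: "compact K" and z: "\<And>x. x \<notin> K \<Longrightarrow> g x = 0"
  shows "(LINT x|lborel. g' x e) = 0"
proof -
  have z': "g' x e = 0" if "x \<notin> K" for x
    by (rule derivative_zero_outside_closed[OF g compact_imp_closed[OF K] that z])
  have gc: "continuous_on UNIV g"
    using g by (auto intro: continuous_at_imp_continuous_on has_derivative_continuous)
  obtain R where R: "K \<subseteq> cball 0 R"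
    using bounded_subset_ballD[OF compact_imp_bounded[OF K], of 0] ball_subset_cball by blast
  have "bounded ((\<lambda>x. g' x e) ` K)"
    by (intro compact_imp_bounded compact_continuous_image continuous_on_subset[OF cont] K) auto
  then obtain M where M: "M > 0" "\<And>x. x \<in> K \<Longrightarrow> norm (g' x e) \<le> M"
    by (auto simp: bounded_pos)
  then have M': "norm (g' x e) \<le> M" for x
    using z'[of x] by (cases "x \<in> K") auto
  \<comment> \<open>Steps of at most 1 keep all shifted supports in one ball of radius R + |e|,
    which carries the majorant.\<close>
  define t where "t m = inverse (real (Suc m))" for m
  have t: "0 < t m" "t m \<le> 1" for m by (auto simp: t_def inverse_le_1_iff)
  have t0: "t \<longlonglongrightarrow> 0" unfolding t_def by (rule LIMSEQ_inverse_real_of_nat)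
  have lip: "norm (g (s *\<^sub>R e + x) - g x) \<le> M * s" if "s \<ge> 0" for s x
  proof -
    have "norm ((\<lambda>s. g (s *\<^sub>R e + x)) s - (\<lambda>s. g (s *\<^sub>R e + x)) 0) \<le> M * norm (s - 0)"
    proof (rule differentiable_bound[of UNIV])
      fix r :: real
      have "((\<lambda>s. g (s *\<^sub>R e + x)) has_derivative (\<lambda>h. g' (r *\<^sub>R e + x) (h *\<^sub>R e))) (at r)"
        by (rule has_derivative_compose[OF _ g]) (auto intro!: derivative_eq_intros)
      then show "((\<lambda>s. g (s *\<^sub>R e + x)) has_derivative (\<lambda>h. g' (r *\<^sub>R e + x) (h *\<^sub>R e))) (at r within UNIV)"
        by simp
      have lin: "linear (g' (r *\<^sub>R e + x))" using g has_derivative_linear by blast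
      show "onorm (\<lambda>h. g' (r *\<^sub>R e + x) (h *\<^sub>R e)) \<le> M"
        using M' M(1) by (intro onorm_le) (auto simp: linear_cmul[OF lin] mult.commute[of M] intro: mult_left_mono)
    qed auto
    then show ?thesis using that by simp
  qed
  have "(\<lambda>m. LINT x|lborel. (1 / t m) *\<^sub>R (g (t m *\<^sub>R e + x) - g x)) \<longlonglongrightarrow> (LINT x|lborel. g' x e)"
  proof (rule integral_dominated_convergence[where w = "\<lambda>x. M * indicator (cball 0 (R + norm e)) x"])
    show "(\<lambda>x. g' x e) \<in> borel_measurable lborel"
      using cont by (simp add: borel_measurable_continuous_onI)
    have "continuous_on UNIV (\<lambda>x. (1 / t m) *\<^sub>R (g (t m *\<^sub>R e + x) - g x))" for m
      by (intro continuous_intros continuous_on_compose2[OF gc] gc) auto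
    then show "(\<lambda>x. (1 / t m) *\<^sub>R (g (t m *\<^sub>R e + x) - g x)) \<in> borel_measurable lborel" for m
      by (simp add: borel_measurable_continuous_onI)
    show "integrable lborel (\<lambda>x :: 'n point. M * indicator (cball 0 (R + norm e)) x)"
      using emeasure_bounded_finite[OF bounded_cball, of "0 :: 'n point" "R + norm e"]
      by (intro integrable_mult_right integrable_real_indicator) auto
    show "AE x in lborel. (\<lambda>m. (1 / t m) *\<^sub>R (g (t m *\<^sub>R e + x) - g x)) \<longlonglongrightarrow> g' x e"
    proof (rule AE_I2)
      fix x
      have "((\<lambda>s. g (x + s *\<^sub>R e)) has_vector_derivative g' x e) (at 0)"
      proof -
        have "((\<lambda>s. g (x + s *\<^sub>R e)) has_derivative (\<lambda>h. g' x (h *\<^sub>R e))) (at 0)"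
          by (rule has_derivative_compose[of _ "\<lambda>h. h *\<^sub>R e" _ _ g]) (use g[of x] in \<open>auto intro!: derivative_eq_intros\<close>)
        then show ?thesis
          using linear_cmul[OF has_derivative_linear[OF g]] by (simp add: has_vector_derivative_def)
      qed
      then have "((\<lambda>s. norm (g (s *\<^sub>R e + x) - g x - s *\<^sub>R g' x e) / \<bar>s\<bar>) \<longlongrightarrow> 0) (at 0)"
        by (simp add: has_vector_derivative_def has_derivative_at add.commute)
      moreover have "norm (g (s *\<^sub>R e + x) - g x - s *\<^sub>R g' x e) / \<bar>s\<bar>
          = norm ((1 / s) *\<^sub>R (g (s *\<^sub>R e + x) - g x) - g' x e)" if "s \<noteq> 0" for s
      proof -
        have "(1 / s) *\<^sub>R (g (s *\<^sub>R e + x) - g x) - g' x e = (1 / s) *\<^sub>R (g (s *\<^sub>R e + x) - g x - s *\<^sub>R g' x e)"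
          using that by (simp add: scaleR_diff_right)
        then show ?thesis by simp
      qed
      ultimately have "((\<lambda>s. norm ((1 / s) *\<^sub>R (g (s *\<^sub>R e + x) - g x) - g' x e)) \<longlongrightarrow> 0) (at 0)"
        by (elim Lim_transform_eventually) (simp add: eventually_at_filter)
      then have "((\<lambda>s. (1 / s) *\<^sub>R (g (s *\<^sub>R e + x) - g x)) \<longlongrightarrow> g' x e) (at 0)"
        by (rule LIM_zero_cancel[OF tendsto_norm_zero_cancel])
      then show "(\<lambda>m. (1 / t m) *\<^sub>R (g (t m *\<^sub>R e + x) - g x)) \<longlonglongrightarrow> g' x e"
        by (rule filterlim_compose) (use t t0 in \<open>auto simp: filterlim_at less_imp_neq[symmetric]\<close>)
    qed
    show "AE x in lborel. norm ((1 / t m) *\<^sub>R (g (t m *\<^sub>R e + x) - g x)) \<le> M * indicator (cball 0 (R + norm e)) x" for m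
    proof (rule AE_I2)
      fix x
      show "norm ((1 / t m) *\<^sub>R (g (t m *\<^sub>R e + x) - g x)) \<le> M * indicator (cball 0 (R + norm e)) x"
      proof (cases "x \<in> cball 0 (R + norm e)")
        case True
        have "norm ((1 / t m) *\<^sub>R (g (t m *\<^sub>R e + x) - g x)) = norm (g (t m *\<^sub>R e + x) - g x) / t m"
          using t[of m] by simp
        also have "\<dots> \<le> M"
          using lip[of "t m" x] t[of m] by (simp add: pos_divide_le_eq)
        finally show ?thesis using True by simp
      next
        case False
        have "norm x \<le> norm (t m *\<^sub>R e + x) + t m * norm e"
          using norm_triangle_ineq4[of "t m *\<^sub>R e + x" "t m *\<^sub>R e"] t[of m] by simp
        moreover have "t m * norm e \<le> norm e" using t[of m] by (simp add: mult_left_le_one_le)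
        moreover have "norm x > R + norm e" using False by simp
        ultimately have "\<not> norm (t m *\<^sub>R e + x) \<le> R" "\<not> norm x \<le> R"
          using norm_ge_zero[of e] by linarith+
        then have "t m *\<^sub>R e + x \<notin> K" "x \<notin> K"
          using R by (auto simp: subset_iff)
        then show ?thesis using False z by simp
      qed
    qed
  qed
  moreover have "(LINT x|lborel. (1 / t m) *\<^sub>R (g (t m *\<^sub>R e + x) - g x)) = 0" for m
    using lborel_integral_translation[OF borel_measurable_continuous_onI[OF gc]] integrable_compact_support[OF gc K z] by simp
  ultimately have "(\<lambda>m :: nat. 0) \<longlonglongrightarrow> (LINT x|lborel. g' x e)"
    by (simp only:)
  then show ?thesis by (simp add: LIMSEQ_const_iff)
qed

lemma test_functions_support:
  assumes "\<phi> \<in> test_functions U"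
  obtains K where "compact K" "K \<subseteq> U" "\<And>x. x \<notin> K \<Longrightarrow> \<phi> x = 0" "\<And>x. x \<notin> K \<Longrightarrow> grad \<phi> x = 0"
proof
  let ?K = "closure {x. \<phi> x \<noteq> 0}"
  show "compact ?K" "?K \<subseteq> U"
    using assms by (auto simp: test_functions_def)
  show z: "\<phi> y = 0" if "y \<notin> ?K" for y
    using that closure_subset[of "{x. \<phi> x \<noteq> 0}"] by blast
  fix x assume x: "x \<notin> ?K"
  have "(\<phi> has_derivative frechet_derivative \<phi> (at x)) (at x)"
    using test_functions_diff(1)[OF assms] by (simp add: frechet_derivative_works[symmetric])
  from derivative_zero_outside_closed[OF this closed_closure x z]
  show "grad \<phi> x = 0" unfolding grad_def partial_deriv_def vec_eq_iff by simp
qed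

lemma continuous_grad: "\<phi> \<in> test_functions U \<Longrightarrow> continuous_on UNIV (grad \<phi>)"
  unfolding grad_def[abs_def] by (intro continuous_on_vec_lambda) (rule test_functions_diff(3))

text \<open>The form \<open>\<phi> \<zeta> + grad \<phi> \<and> p\<close> is the sum over i of the
  i-th coordinate covector wedged with the i-th partial derivative of \<open>\<phi> p\<close>, and
  each such derivative has integral zero.\<close>

lemma weak_d_classical:
  fixes p :: "('n::{finite,linorder}) dform"
  assumes p: "\<And>x. (p has_derivative p' x) (at x)"
    and cont: "\<And>i. continuous_on UNIV (\<lambda>x. p' x (axis i 1))"
  shows "weak_d U p (\<lambda>x. \<Sum>i\<in>UNIV. emul (axis i 1) (p' x (axis i 1)))"
  unfolding weak_d_def wedge_differential
proof
  fix \<phi> :: "'n point \<Rightarrow> real" assume \<phi>: "\<phi> \<in> test_functions U"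
  obtain K where K: "compact K" "K \<subseteq> U" and z: "\<And>x. x \<notin> K \<Longrightarrow> \<phi> x = 0" "\<And>x. x \<notin> K \<Longrightarrow> grad \<phi> x = 0"
    using test_functions_support[OF \<phi>] by blast
  let ?\<zeta> = "\<lambda>x. \<Sum>i\<in>UNIV. emul (axis i 1) (p' x (axis i 1))"
  have pc: "continuous_on UNIV p"
    using p by (auto intro: continuous_at_imp_continuous_on has_derivative_continuous)
  note \<phi>c = test_functions_diff(2)[OF \<phi>]
  have outside: "x \<notin> K" if "x \<notin> U" for x using K(2) that by blast
  have G0: "(LINT x|lborel. grad \<phi> x $ i *\<^sub>R p x + \<phi> x *\<^sub>R p' x (axis i 1)) = 0" for i
  proof -
    have "((\<lambda>x. \<phi> x *\<^sub>R p x) has_derivative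
        (\<lambda>h. frechet_derivative \<phi> (at x) h *\<^sub>R p x + \<phi> x *\<^sub>R p' x h)) (at x)" for x
      using test_functions_diff(1)[OF \<phi>, of x]
      by (auto simp: frechet_derivative_works add.commute intro!: derivative_eq_intros p)
    moreover have "continuous_on UNIV (\<lambda>x. frechet_derivative \<phi> (at x) (axis i 1) *\<^sub>R p x + \<phi> x *\<^sub>R p' x (axis i 1))"
      using test_functions_diff(3)[OF \<phi>, of i] unfolding partial_deriv_def[abs_def]
      by (intro continuous_intros pc \<phi>c cont)
    ultimately have "(LINT x|lborel. frechet_derivative \<phi> (at x) (axis i 1) *\<^sub>R p x + \<phi> x *\<^sub>R p' x (axis i 1)) = 0"
      using z(1) by (intro integral_derivative_compact_support[where g = "\<lambda>x. \<phi> x *\<^sub>R p x" and K = K and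
        g' = "\<lambda>x h. frechet_derivative \<phi> (at x) h *\<^sub>R p x + \<phi> x *\<^sub>R p' x h"] K(1)) auto
    then show ?thesis by (simp add: grad_def partial_deriv_def)
  qed
  have Gc: "continuous_on UNIV (\<lambda>x. grad \<phi> x $ i *\<^sub>R p x + \<phi> x *\<^sub>R p' x (axis i 1))" for i
    by (intro continuous_intros pc \<phi>c cont continuous_grad[OF \<phi>])
  have Gi: "integrable lborel (\<lambda>x. grad \<phi> x $ i *\<^sub>R p x + \<phi> x *\<^sub>R p' x (axis i 1))" for i
    by (rule integrable_compact_support[OF Gc K(1)]) (simp add: z)
  have c1: "continuous_on UNIV (\<lambda>x. \<phi> x *\<^sub>R ?\<zeta> x)"
    by (intro continuous_intros \<phi>c emul.continuous_on cont)
  have c2: "continuous_on UNIV (\<lambda>x. emul (grad \<phi> x) (p x))"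
    by (intro emul.continuous_on pc continuous_grad[OF \<phi>])
  have i1: "integrable lborel (\<lambda>x. \<phi> x *\<^sub>R ?\<zeta> x)"
    by (rule integrable_compact_support[OF c1 K(1)]) (simp add: z)
  have i2: "integrable lborel (\<lambda>x. emul (grad \<phi> x) (p x))"
    by (rule integrable_compact_support[OF c2 K(1)]) (simp add: z emul.zero_left)
  have "(LINT x|lborel. \<phi> x *\<^sub>R ?\<zeta> x) + (LINT x|lborel. emul (grad \<phi> x) (p x))
     = (LINT x|lborel. \<phi> x *\<^sub>R ?\<zeta> x + emul (grad \<phi> x) (p x))"
    using i1 i2 by simp
  also have "\<dots> = (LINT x|lborel. (\<Sum>i\<in>UNIV. emul (axis i 1) (grad \<phi> x $ i *\<^sub>R p x + \<phi> x *\<^sub>R p' x (axis i 1))))"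
    by (intro Bochner_Integration.integral_cong refl, subst (1) emul_expand)
      (simp add: emul.add_right emul.scaleR_right sum.distrib scaleR_sum_right add.commute)
  also have "\<dots> = (\<Sum>i\<in>UNIV. LINT x|lborel. emul (axis i 1) (grad \<phi> x $ i *\<^sub>R p x + \<phi> x *\<^sub>R p' x (axis i 1)))"
    by (intro Bochner_Integration.integral_sum integrable_bounded_linear[OF emul.bounded_linear_right Gi])
  also have "\<dots> = (\<Sum>i\<in>UNIV. emul (axis i 1) (LINT x|lborel. grad \<phi> x $ i *\<^sub>R p x + \<phi> x *\<^sub>R p' x (axis i 1)))"
    by (intro sum.cong refl integral_bounded_linear[OF emul.bounded_linear_right Gi])
  also have "\<dots> = 0" by (simp add: G0 emul.zero_right)
  finally have "(LINT x|lborel. \<phi> x *\<^sub>R ?\<zeta> x) = - (LINT x|lborel. emul (grad \<phi> x) (p x))"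
    by (simp add: eq_neg_iff_add_eq_0)
  moreover have "(LINT x:U|lebesgue. \<phi> x *\<^sub>R ?\<zeta> x) = (LINT x|lborel. \<phi> x *\<^sub>R ?\<zeta> x)"
    by (rule set_integral_compact_support[OF c1]) (simp add: z outside)
  moreover have "(LINT x:U|lebesgue. emul (grad \<phi> x) (p x)) = (LINT x|lborel. emul (grad \<phi> x) (p x))"
    by (rule set_integral_compact_support[OF c2]) (simp add: z outside emul.zero_left)
  ultimately show "(LINT x:U|lebesgue. \<phi> x *\<^sub>R ?\<zeta> x) = - (LINT x:U|lebesgue. emul (grad \<phi> x) (p x))"
    by simp
qed

section \<open>Weak derivatives of square integrable forms\<close>

text \<open>The analytic half of \<open>L2_forms\<close>, detached from the degree and the value
  space, so that it also serves scalar coordinates and the identity map.\<close>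

definition sq_int :: "('n::finite) point set \<Rightarrow> ('n point \<Rightarrow> 'b::euclidean_space) \<Rightarrow> bool"
  where "sq_int U f \<longleftrightarrow> set_borel_measurable lebesgue U f \<and> set_integrable lebesgue U (\<lambda>x. (norm (f x))\<^sup>2)"

lemma L2_forms_iff: "\<omega> \<in> L2_forms U j \<longleftrightarrow> (\<forall>x\<in>U. \<omega> x \<in> Alt j) \<and> sq_int U \<omega>"
  by (auto simp: L2_forms_def sq_int_def)

lemma Alt_diff: "v \<in> Alt j \<Longrightarrow> w \<in> Alt j \<Longrightarrow> v - w \<in> Alt j"
  by (rule subspace_diff[OF Alt_subspace])

lemma Alt_scaleR: "w \<in> Alt j \<Longrightarrow> c *\<^sub>R w \<in> Alt j"
  by (rule subspace_scale[OF Alt_subspace])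

lemma sq_int_dominated:
  assumes "set_borel_measurable lebesgue U f" "set_integrable lebesgue U g"
    and "\<And>x. x \<in> U \<Longrightarrow> (norm (f x))\<^sup>2 \<le> g x"
  shows "sq_int U f"
proof -
  have [measurable]: "(\<lambda>x. indicator U x *\<^sub>R f x) \<in> borel_measurable lebesgue"
    using assms(1) by (simp add: set_borel_measurable_def)
  have "(\<lambda>x. (norm (indicator U x *\<^sub>R f x))\<^sup>2) \<in> borel_measurable lebesgue" by measurable
  moreover have "(\<lambda>x. (norm (indicator U x *\<^sub>R f x))\<^sup>2) = (\<lambda>x. indicator U x *\<^sub>R (norm (f x))\<^sup>2)"
    by (auto simp: indicator_def)
  ultimately have meas: "(\<lambda>x. indicator U x *\<^sub>R (norm (f x))\<^sup>2) \<in> borel_measurable lebesgue"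
    by simp
  have "integrable lebesgue (\<lambda>x. indicator U x *\<^sub>R (norm (f x))\<^sup>2)"
  proof (intro Bochner_Integration.integrable_bound[OF assms(2)[unfolded set_integrable_def]] AE_I2)
    fix x
    show "norm (indicator U x *\<^sub>R (norm (f x))\<^sup>2) \<le> norm (indicator U x *\<^sub>R g x)"
      using assms(3)[of x] by (cases "x \<in> U") auto
  qed (rule meas)
  then show ?thesis
    using assms(1) by (simp add: sq_int_def set_integrable_def)
qed

lemma norm_add_square: "(norm (a + b))\<^sup>2 \<le> 2 * (norm a)\<^sup>2 + 2 * (norm b)\<^sup>2"
proof -
  have "(norm (a + b))\<^sup>2 \<le> (norm a + norm b)\<^sup>2"
    by (intro power_mono norm_triangle_ineq norm_ge_zero)
  also have "\<dots> \<le> 2 * (norm a)\<^sup>2 + 2 * (norm b)\<^sup>2"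
    using sum_squares_bound[of "norm a" "norm b"] by (simp add: power2_sum)
  finally show ?thesis .
qed

lemma sq_int_add:
  assumes "sq_int U f" "sq_int U g" shows "sq_int U (\<lambda>x. f x + g x)"
proof (rule sq_int_dominated)
  show "set_borel_measurable lebesgue U (\<lambda>x. f x + g x)"
    using assms by (auto simp: sq_int_def set_borel_measurable_def scaleR_add_right)
  show "set_integrable lebesgue U (\<lambda>x. 2 * (norm (f x))\<^sup>2 + 2 * (norm (g x))\<^sup>2)"
    using assms by (auto simp: sq_int_def intro!: set_integral_add)
qed (rule norm_add_square)

lemma sq_int_isometry:
  assumes "sq_int U f" "bounded_linear h" "\<And>w. norm (h w) = norm w" shows "sq_int U (\<lambda>x. h (f x))"
proof -
  interpret h: bounded_linear h by fact
  have "(\<lambda>x. h (indicator U x *\<^sub>R f x)) \<in> borel_measurable lebesgue"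
    using assms(1)
    by (intro measurable_compose[OF _ borel_measurable_continuous_onI[OF h.continuous_on[OF continuous_on_id]]])
      (auto simp: sq_int_def set_borel_measurable_def)
  then show ?thesis
    using assms(1,3) by (simp add: sq_int_def set_borel_measurable_def h.scaleR)
qed

lemma sq_int_scaleR:
  assumes "sq_int U f" shows "sq_int U (\<lambda>x. c *\<^sub>R f x)"
proof (rule sq_int_dominated)
  have [measurable]: "(\<lambda>x. indicator U x *\<^sub>R f x) \<in> borel_measurable lebesgue"
    using assms by (simp add: sq_int_def set_borel_measurable_def)
  have "(\<lambda>x. c *\<^sub>R (indicator U x *\<^sub>R f x)) \<in> borel_measurable lebesgue"
    by measurable
  then show "set_borel_measurable lebesgue U (\<lambda>x. c *\<^sub>R f x)"
    by (simp add: set_borel_measurable_def mult.commute)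
  show "set_integrable lebesgue U (\<lambda>x. c\<^sup>2 * (norm (f x))\<^sup>2)"
    using assms by (auto simp: sq_int_def)
qed (simp add: power_mult_distrib)

lemma sq_int_diff: "sq_int U f \<Longrightarrow> sq_int U g \<Longrightarrow> sq_int U (\<lambda>x. f x - g x)"
  using sq_int_add[of U f "\<lambda>x. - 1 *\<^sub>R g x"] sq_int_scaleR[of U g "- 1"] by simp

lemma sq_int_cong: "(\<And>x. x \<in> U \<Longrightarrow> f x = g x) \<Longrightarrow> sq_int U f \<longleftrightarrow> sq_int U g"
proof -
  assume eq: "\<And>x. x \<in> U \<Longrightarrow> f x = g x"
  then have "(\<lambda>x. indicator U x *\<^sub>R f x) = (\<lambda>x. indicator U x *\<^sub>R g x)"
    "(\<lambda>x. indicator U x *\<^sub>R (norm (f x))\<^sup>2) = (\<lambda>x. indicator U x *\<^sub>R (norm (g x))\<^sup>2)"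
    by (auto simp: fun_eq_iff indicator_def)
  then show ?thesis by (simp add: sq_int_def set_borel_measurable_def set_integrable_def)
qed

lemma sq_int_subset:
  assumes "sq_int V f" "U \<subseteq> V" "U \<in> sets lebesgue" shows "sq_int U f"
  using assms by (auto simp: sq_int_def intro: set_integrable_subset set_borel_measurable_subset)

lemma sq_int_inner:
  assumes f: "sq_int U f" and g: "sq_int U g"
  shows "set_integrable lebesgue U (\<lambda>x. f x \<bullet> g x)"
proof -
  have "(\<lambda>x. (indicator U x *\<^sub>R f x) \<bullet> (indicator U x *\<^sub>R g x)) \<in> borel_measurable lebesgue"
    using f g by (intro borel_measurable_inner) (auto simp: sq_int_def set_borel_measurable_def)
  moreover have "(\<lambda>x. (indicator U x *\<^sub>R f x) \<bullet> (indicator U x *\<^sub>R g x)) = (\<lambda>x. indicator U x *\<^sub>R (f x \<bullet> g x))"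
    by (auto simp: indicator_def)
  moreover have "integrable lebesgue (\<lambda>x. indicator U x *\<^sub>R ((norm (f x))\<^sup>2 + (norm (g x))\<^sup>2))"
    using f g set_integral_add(1)[of lebesgue U "\<lambda>x. (norm (f x))\<^sup>2" "\<lambda>x. (norm (g x))\<^sup>2"]
    by (simp add: sq_int_def set_integrable_def)
  moreover have "norm (indicator U x *\<^sub>R (f x \<bullet> g x)) \<le> norm (indicator U x *\<^sub>R ((norm (f x))\<^sup>2 + (norm (g x))\<^sup>2))" for x
  proof -
    have "\<bar>f x \<bullet> g x\<bar> \<le> norm (f x) * norm (g x)" by (rule Cauchy_Schwarz_ineq2)
    also have "\<dots> \<le> (norm (f x))\<^sup>2 + (norm (g x))\<^sup>2"
      using sum_squares_bound[of "norm (f x)" "norm (g x)"] mult_nonneg_nonneg[OF norm_ge_zero[of "f x"] norm_ge_zero[of "g x"]] by linarith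
    finally show ?thesis by (auto simp: indicator_def)
  qed
  ultimately show ?thesis
    unfolding set_integrable_def by (auto intro: Bochner_Integration.integrable_bound)
qed

lemma set_integral_bounded_linear:
  assumes "bounded_linear h" "set_integrable M U f"
  shows "(LINT x:U|M. h (f x)) = h (LINT x:U|M. f x)" "set_integrable M U (\<lambda>x. h (f x))"
proof -
  interpret h: bounded_linear h by fact
  show "(LINT x:U|M. h (f x)) = h (LINT x:U|M. f x)"
    using integral_bounded_linear[OF assms(1) assms(2)[unfolded set_integrable_def]]
    by (simp add: set_lebesgue_integral_def h.scaleR)
  show "set_integrable M U (\<lambda>x. h (f x))"
    using integrable_bounded_linear[OF assms(1) assms(2)[unfolded set_integrable_def]]
    by (simp add: set_integrable_def h.scaleR)
qed

lemma set_integral_cong_on: "(\<And>x. x \<in> U \<Longrightarrow> f x = g x) \<Longrightarrow> (LINT x:U|M. f x) = (LINT x:U|M. g x)"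
  unfolding set_lebesgue_integral_def by (intro Bochner_Integration.integral_cong) (auto simp: indicator_def)

text \<open>Finite measure makes square integrable functions integrable, and boundedness makes
  continuous coefficients bounded. Both \<Omega> and the interiors of the elements are
  instances.\<close>

locale bounded_open =
  fixes U :: "('n::{finite,linorder}) point set"
  assumes open_U: "open U" and bounded_U: "bounded U"
begin

lemma sets_U [simp, intro]: "U \<in> sets lebesgue"
  using open_U by simp

lemma lmeasurable_U: "U \<in> lmeasurable"
  by (rule lmeasurable_open[OF bounded_U open_U])

lemma const_integrable: "set_integrable lebesgue U (\<lambda>x. c)"
  using lmeasurable_U unfolding set_integrable_def fmeasurable_def
  by (intro integrable_scaleR_left integrable_real_indicator) auto

lemma sq_int_const: "sq_int U (\<lambda>x. c)"
  using const_integrable[of c] const_integrable[of "(norm c)\<^sup>2"]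
  by (auto simp: sq_int_def set_borel_measurable_def set_integrable_def)

lemma bounded_image: "continuous_on UNIV (c :: 'n point \<Rightarrow> 'b::real_normed_vector) \<Longrightarrow> \<exists>M. \<forall>x\<in>U. norm (c x) \<le> M"
proof -
  assume "continuous_on UNIV c"
  then have "compact (c ` closure U)"
    using bounded_U by (intro compact_continuous_image) (auto intro: continuous_on_subset)
  then have "bounded (c ` closure U)" by (rule compact_imp_bounded)
  then show ?thesis using closure_subset[of U] by (force simp: bounded_iff)
qed

text \<open>One lemma for scalar multiplication, \<open>emul\<close> and \<open>imul\<close>: a
  coefficient that is continuous on the whole space is bounded on the compact closure of U.\<close>

lemma sq_int_bilinear:
  fixes B :: "'b::euclidean_space \<Rightarrow> 'c::euclidean_space \<Rightarrow> 'd::euclidean_space"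
  assumes B: "bounded_bilinear B" and c: "continuous_on UNIV c" and f: "sq_int U f"
  shows "sq_int U (\<lambda>x. B (c x) (f x))"
proof -
  interpret B: bounded_bilinear B by fact
  obtain K where K: "K > 0" "\<And>a b. norm (B a b) \<le> norm a * norm b * K" using B.pos_bounded by blast
  obtain M where M: "\<And>x. x \<in> U \<Longrightarrow> norm (c x) \<le> M" using bounded_image[OF c] by blast
  show ?thesis
  proof (rule sq_int_dominated)
    have "(\<lambda>x. B (c x) (indicator U x *\<^sub>R f x)) \<in> borel_measurable lebesgue"
    proof (rule borel_measurable_continuous_Pair[where H = B])
      show "c \<in> borel_measurable lebesgue"
        using c by (simp add: borel_measurable_continuous_onI measurable_completion)
      show "(\<lambda>x. indicator U x *\<^sub>R f x) \<in> borel_measurable lebesgue"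
        using f by (simp add: sq_int_def set_borel_measurable_def)
      show "continuous_on UNIV (\<lambda>x. B (fst x) (snd x))"
        by (intro B.continuous_on continuous_intros)
    qed
    then show "set_borel_measurable lebesgue U (\<lambda>x. B (c x) (f x))"
      by (simp add: set_borel_measurable_def B.scaleR_right)
    show "set_integrable lebesgue U (\<lambda>x. (M * K)\<^sup>2 * (norm (f x))\<^sup>2)"
      using f by (auto simp: sq_int_def)
    fix x assume x: "x \<in> U"
    have "norm (B (c x) (f x)) \<le> norm (c x) * norm (f x) * K" by (rule K)
    also have "\<dots> \<le> M * norm (f x) * K"
      using M[OF x] K(1) by (intro mult_right_mono) auto
    finally have "(norm (B (c x) (f x)))\<^sup>2 \<le> (M * norm (f x) * K)\<^sup>2"
      by (rule power_mono) simp
    then show "(norm (B (c x) (f x)))\<^sup>2 \<le> (M * K)\<^sup>2 * (norm (f x))\<^sup>2"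
      by (simp add: power_mult_distrib mult_ac)
  qed
qed

lemma sq_int_continuous:
  fixes c :: "'n point \<Rightarrow> 'b::euclidean_space"
  assumes "continuous_on UNIV c" shows "sq_int U c"
  using sq_int_bilinear[OF bounded_bilinear.flip[OF bounded_bilinear_scaleR] assms sq_int_const[of "1::real"]]
  by simp

lemma sq_int_integrable:
  fixes f :: "'n point \<Rightarrow> 'b::euclidean_space"
  assumes f: "sq_int U f" shows "set_integrable lebesgue U f"
  unfolding set_integrable_def
proof (rule Bochner_Integration.integrable_bound[of _ "\<lambda>x. indicator U x *\<^sub>R (1 + (norm (f x))\<^sup>2)"])
  show "integrable lebesgue (\<lambda>x. indicator U x *\<^sub>R (1 + (norm (f x))\<^sup>2))"
    using set_integral_add(1)[of lebesgue U "\<lambda>x. 1" "\<lambda>x. (norm (f x))\<^sup>2"] f const_integrable[of "1 :: real"]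
    by (simp add: sq_int_def set_integrable_def)
  show "(\<lambda>x. indicator U x *\<^sub>R f x) \<in> borel_measurable lebesgue"
    using f by (simp add: sq_int_def set_borel_measurable_def)
  show "AE x in lebesgue. norm (indicator U x *\<^sub>R f x) \<le> norm (indicator U x *\<^sub>R (1 + (norm (f x))\<^sup>2))"
  proof (rule AE_I2)
    fix x
    \<comment> \<open>Expanding this square yields \<open>|f| \<le> 1 + |f|\<^sup>2\<close>, and the
      constant 1 is integrable because U has finite measure.\<close>
    have "0 \<le> (norm (f x) - 1)\<^sup>2" "0 \<le> (norm (f x))\<^sup>2" by simp_all
    then have "norm (f x) \<le> 1 + (norm (f x))\<^sup>2"
      using norm_ge_zero[of "f x"] unfolding power2_diff one_power2 by linarith
    then show "norm (indicator U x *\<^sub>R f x) \<le> norm (indicator U x *\<^sub>R (1 + (norm (f x))\<^sup>2))"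
      by (cases "x \<in> U") auto
  qed
qed

section \<open>Uniqueness and calculus of weak derivatives\<close>

lemma test_integrable:
  fixes \<zeta> :: "'n dform"
  assumes "\<phi> \<in> test_functions V" "sq_int U \<zeta>"
  shows "set_integrable lebesgue U (\<lambda>x. \<phi> x *\<^sub>R \<zeta> x)"
    and "set_integrable lebesgue U (\<lambda>x. emul (grad \<phi> x) (\<zeta> x))"
proof -
  show "set_integrable lebesgue U (\<lambda>x. \<phi> x *\<^sub>R \<zeta> x)"
    by (rule sq_int_integrable[OF sq_int_bilinear[OF bounded_bilinear_scaleR test_functions_diff(2)[OF assms(1)] assms(2)]])
  show "set_integrable lebesgue U (\<lambda>x. emul (grad \<phi> x) (\<zeta> x))"
    by (rule sq_int_integrable[OF sq_int_bilinear[OF bounded_bilinear_emul continuous_grad[OF assms(1)] assms(2)]])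
qed

lemma weak_d_unique:
  fixes \<zeta> :: "'n dform"
  assumes w: "weak_d U \<omega> \<zeta>" "weak_d U \<omega> \<zeta>'" and s: "sq_int U \<zeta>" "sq_int U \<zeta>'"
  shows "AE x in lebesgue. x \<in> U \<longrightarrow> \<zeta> x = \<zeta>' x"
proof -
  have "AE x in lebesgue. x \<in> U \<longrightarrow> (\<zeta> x - \<zeta>' x) $ \<alpha> = 0" for \<alpha>
  proof (rule fundamental_lemma_of_variations[OF open_U])
    have s': "sq_int U (\<lambda>x. \<zeta> x - \<zeta>' x)" by (rule sq_int_diff[OF s])
    show "set_integrable lebesgue U (\<lambda>x. (\<zeta> x - \<zeta>' x) $ \<alpha>)"
      by (rule set_integral_bounded_linear(2)[OF bounded_linear_vec_nth sq_int_integrable[OF s']])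
    fix \<phi> assume \<phi>: "\<phi> \<in> test_functions U"
    have "(LINT x:U|lebesgue. \<phi> x * (\<zeta> x - \<zeta>' x) $ \<alpha>) = (LINT x:U|lebesgue. (\<phi> x *\<^sub>R (\<zeta> x - \<zeta>' x)) $ \<alpha>)"
      by simp
    also have "\<dots> = (LINT x:U|lebesgue. \<phi> x *\<^sub>R (\<zeta> x - \<zeta>' x)) $ \<alpha>"
      by (rule set_integral_bounded_linear(1)[OF bounded_linear_vec_nth test_integrable(1)[OF \<phi> s']])
    also have "(LINT x:U|lebesgue. \<phi> x *\<^sub>R (\<zeta> x - \<zeta>' x)) = 0"
      using w \<phi> set_integral_diff(2)[OF test_integrable(1)[OF \<phi> s(1)] test_integrable(1)[OF \<phi> s(2)]]
      by (simp add: weak_d_def scaleR_diff_right)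
    finally show "(LINT x:U|lebesgue. \<phi> x * (\<zeta> x - \<zeta>' x) $ \<alpha>) = 0" by simp
  qed
  then have "AE x in lebesgue. \<forall>\<alpha>\<in>UNIV. x \<in> U \<longrightarrow> (\<zeta> x - \<zeta>' x) $ \<alpha> = 0"
    by (intro AE_finite_allI) auto
  then show ?thesis
    by eventually_elim (simp add: vec_eq_iff)
qed

text \<open>A relation instead of a chosen function: explicit derivatives can be supplied for
  polynomial forms, and the choice made in \<open>ext_d\<close> is met only through
  \<open>ext_d_spec\<close>.\<close>

definition is_d :: "nat \<Rightarrow> 'n dform \<Rightarrow> 'n dform \<Rightarrow> bool"
  where "is_d j \<omega> \<zeta> \<longleftrightarrow> \<omega> \<in> L2_forms U j \<and> \<zeta> \<in> L2_forms U (j + 1) \<and> weak_d U \<omega> \<zeta>"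

text \<open>The witness \<xi> is kept because \<open>codiff\<close> stars a chosen derivative of the
  starred form; sign and star are applied after that choice.\<close>

definition is_delta :: "nat \<Rightarrow> 'n dform \<Rightarrow> 'n dform \<Rightarrow> bool"
  where "is_delta j \<mu> \<zeta> \<longleftrightarrow> \<mu> \<in> L2_forms U j \<and>
    (\<exists>\<xi>. is_d (CARD('n) - j) (hodge_form \<mu>) \<xi> \<and> \<zeta> = (\<lambda>x. (- 1) ^ (j * CARD('n)) *\<^sub>R hodge (\<xi> x)))"

text \<open>One weak derivative is enough to make the choice legitimate. Uniqueness then identifies
  the chosen one almost everywhere, which suffices under integrals.\<close>

lemma ext_d_spec:
  assumes "is_d j \<omega> \<zeta>"
  shows "is_d j \<omega> (ext_d U j \<omega>)" "AE x in lebesgue. x \<in> U \<longrightarrow> ext_d U j \<omega> x = \<zeta> x"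
proof -
  have "ext_d U j \<omega> \<in> L2_forms U (j + 1) \<and> weak_d U \<omega> (ext_d U j \<omega>)"
    unfolding ext_d_def by (rule someI[of _ \<zeta>]) (use assms in \<open>auto simp: is_d_def\<close>)
  then show "is_d j \<omega> (ext_d U j \<omega>)" using assms by (auto simp: is_d_def)
  then show "AE x in lebesgue. x \<in> U \<longrightarrow> ext_d U j \<omega> x = \<zeta> x"
    using assms by (intro weak_d_unique) (auto simp: is_d_def L2_forms_iff)
qed

lemma is_d_diff:
  assumes "is_d j \<omega> \<zeta>" "is_d j \<omega>' \<zeta>'"
  shows "is_d j (\<lambda>x. \<omega> x - \<omega>' x) (\<lambda>x. \<zeta> x - \<zeta>' x)"
proof -
  have s: "sq_int U \<omega>" "sq_int U \<omega>'" "sq_int U \<zeta>" "sq_int U \<zeta>'"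
    using assms by (auto simp: is_d_def L2_forms_iff)
  have "weak_d U (\<lambda>x. \<omega> x - \<omega>' x) (\<lambda>x. \<zeta> x - \<zeta>' x)"
    unfolding weak_d_def wedge_differential
  proof
    fix \<phi> assume \<phi>: "\<phi> \<in> test_functions U"
    show "(LINT x:U|lebesgue. \<phi> x *\<^sub>R (\<zeta> x - \<zeta>' x)) = - (LINT x:U|lebesgue. emul (grad \<phi> x) (\<omega> x - \<omega>' x))"
      using assms \<phi> test_integrable[OF \<phi> s(1)] test_integrable[OF \<phi> s(2)] test_integrable[OF \<phi> s(3)] test_integrable[OF \<phi> s(4)]
      by (simp add: is_d_def weak_d_def wedge_differential scaleR_diff_right emul.diff_right set_integral_diff(2))
  qed
  then show ?thesis
    using assms s by (auto simp: is_d_def L2_forms_iff sq_int_diff intro!: Alt_diff)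
qed

lemma is_d_cong:
  assumes "is_d j \<omega> \<zeta>" "\<And>x. x \<in> U \<Longrightarrow> \<omega>' x = \<omega> x"
  shows "is_d j \<omega>' \<zeta>"
proof -
  have "(LINT x:U|lebesgue. wedge (differential \<phi> x) (\<omega>' x)) = (LINT x:U|lebesgue. wedge (differential \<phi> x) (\<omega> x))" for \<phi>
    by (rule set_integral_cong_on) (simp add: assms)
  then show ?thesis
    using assms(1) sq_int_cong[of U \<omega>' \<omega>] assms(2) by (auto simp: is_d_def L2_forms_iff weak_d_def)
qed

lemma sq_int_hodge: "sq_int V \<omega> \<Longrightarrow> sq_int V (\<lambda>x. hodge (\<omega> x))"
  by (rule sq_int_isometry[OF _ linear_conv_bounded_linear[THEN iffD1, OF linear_hodge] norm_hodge])

lemma is_delta_L2: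
  assumes "is_delta j \<mu> \<zeta>" "1 \<le> j" "j \<le> CARD('n)"
  shows "\<zeta> \<in> L2_forms U (j - 1)"
proof -
  obtain \<xi> where \<xi>: "is_d (CARD('n) - j) (hodge_form \<mu>) \<xi>" "\<zeta> = (\<lambda>x. (- 1) ^ (j * CARD('n)) *\<^sub>R hodge (\<xi> x))"
    using assms(1) by (auto simp: is_delta_def)
  then have "hodge (\<xi> x) \<in> Alt (j - 1)" if "x \<in> U" for x
    using hodge_Alt[of "\<xi> x" "CARD('n) - j + 1"] that assms(2,3) by (auto simp: is_d_def L2_forms_iff)
  then show ?thesis
    using \<xi> by (auto simp: L2_forms_iff is_d_def intro!: sq_int_scaleR sq_int_hodge Alt_scaleR)
qed

lemma codiff_spec:
  assumes "is_delta j \<mu> \<zeta>"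
  shows "is_delta j \<mu> (codiff U j \<mu>)" "AE x in lebesgue. x \<in> U \<longrightarrow> codiff U j \<mu> x = \<zeta> x"
proof -
  obtain \<xi> where \<xi>: "is_d (CARD('n) - j) (hodge_form \<mu>) \<xi>" "\<zeta> = (\<lambda>x. (- 1) ^ (j * CARD('n)) *\<^sub>R hodge (\<xi> x))"
    using assms(1) by (auto simp: is_delta_def)
  show "is_delta j \<mu> (codiff U j \<mu>)"
    using assms ext_d_spec(1)[OF \<xi>(1)] by (auto simp: is_delta_def codiff_def hodge_form_def[of "ext_d _ _ _"])
  show "AE x in lebesgue. x \<in> U \<longrightarrow> codiff U j \<mu> x = \<zeta> x"
    using ext_d_spec(2)[OF \<xi>(1)] by eventually_elim (simp add: codiff_def \<xi>(2) hodge_form_def[of "ext_d _ _ _"])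
qed

lemma is_delta_diff:
  assumes "is_delta j \<mu> \<zeta>" "is_delta j \<mu>' \<zeta>'"
  shows "is_delta j (\<lambda>x. \<mu> x - \<mu>' x) (\<lambda>x. \<zeta> x - \<zeta>' x)"
proof -
  obtain \<xi> where \<xi>: "is_d (CARD('n) - j) (hodge_form \<mu>) \<xi>" "\<zeta> = (\<lambda>x. (- 1) ^ (j * CARD('n)) *\<^sub>R hodge (\<xi> x))"
    using assms(1) by (auto simp: is_delta_def)
  obtain \<xi>' where \<xi>': "is_d (CARD('n) - j) (hodge_form \<mu>') \<xi>'" "\<zeta>' = (\<lambda>x. (- 1) ^ (j * CARD('n)) *\<^sub>R hodge (\<xi>' x))"
    using assms(2) by (auto simp: is_delta_def)
  have "is_d (CARD('n) - j) (hodge_form (\<lambda>x. \<mu> x - \<mu>' x)) (\<lambda>x. \<xi> x - \<xi>' x)"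
    using is_d_diff[OF \<xi>(1) \<xi>'(1)] by (simp add: hodge_form_def linear_diff[OF linear_hodge])
  moreover have "(\<lambda>x. \<mu> x - \<mu>' x) \<in> L2_forms U j"
    using assms unfolding is_delta_def L2_forms_iff
    by (auto intro!: Alt_diff sq_int_diff)
  ultimately show ?thesis
    unfolding is_delta_def
    by (intro conjI exI[of _ "\<lambda>x. \<xi> x - \<xi>' x"])
      (simp_all only: \<xi>(2) \<xi>'(2) linear_diff[OF linear_hodge] scaleR_diff_right)
qed

lemma is_delta_cong:
  assumes "is_delta j \<mu> \<zeta>" "\<And>x. x \<in> U \<Longrightarrow> \<mu>' x = \<mu> x"
  shows "is_delta j \<mu>' \<zeta>"
  using assms sq_int_cong[of U \<mu>' \<mu>] is_d_cong[of "CARD('n) - j" "hodge_form \<mu>" _ "hodge_form \<mu>'"]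
  unfolding is_delta_def L2_forms_iff by (auto simp: hodge_form_def)

section \<open>Classical derivatives as weak ones, and restriction to subsets\<close>

lemma is_d_classical:
  assumes p: "\<And>x. (p has_derivative p' x) (at x)" and A: "\<And>x. p x \<in> Alt j" "\<And>x i. p' x (axis i 1) \<in> Alt j"
    and cont: "\<And>i. continuous_on UNIV (\<lambda>x. p' x (axis i 1))"
  shows "is_d j p (\<lambda>x. \<Sum>i\<in>UNIV. emul (axis i 1) (p' x (axis i 1)))"
  unfolding is_d_def L2_forms_iff
proof (intro conjI ballI weak_d_classical[OF p cont] A)
  show "sq_int U p"
    using p by (intro sq_int_continuous) (auto intro: continuous_at_imp_continuous_on has_derivative_continuous)
  show "sq_int U (\<lambda>x. \<Sum>i\<in>UNIV. emul (axis i 1) (p' x (axis i 1)))"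
    by (intro sq_int_continuous continuous_intros emul.continuous_on cont)
  show "(\<Sum>i\<in>UNIV. emul (axis i 1) (p' x (axis i 1))) \<in> Alt (j + 1)" for x
    using emul_Alt[OF A(2)] by (auto intro!: subspace_sum[OF Alt_subspace])
qed

lemma is_delta_classical:
  assumes p: "\<And>x. (p has_derivative p' x) (at x)" and A: "\<And>x. p x \<in> Alt j" "\<And>x i. p' x (axis i 1) \<in> Alt j"
    and cont: "\<And>i. continuous_on UNIV (\<lambda>x. p' x (axis i 1))" and j: "j \<le> CARD('n)"
  shows "is_delta j p (\<lambda>x. - (\<Sum>i\<in>UNIV. imul (axis i 1) (p' x (axis i 1))))"
proof -
  have bl: "bounded_linear hodge" by (rule linear_conv_bounded_linear[THEN iffD1, OF linear_hodge])
  have "is_d (CARD('n) - j) (hodge_form p) (\<lambda>x. \<Sum>i\<in>UNIV. emul (axis i 1) (hodge (p' x (axis i 1))))"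
    unfolding hodge_form_def
    by (intro is_d_classical bounded_linear.has_derivative[OF bl p] hodge_Alt A j
      bounded_linear.continuous_on[OF bl] cont)
  moreover have "- (\<Sum>i\<in>UNIV. imul (axis i 1) (p' x (axis i 1))) =
      (- 1) ^ (j * CARD('n)) *\<^sub>R hodge (\<Sum>i\<in>UNIV. emul (axis i 1) (hodge (p' x (axis i 1))))" for x
    using hodge_emul_hodge[OF A(2)] by (simp add: linear_sum[OF linear_hodge] scaleR_sum_right sum_negf)
  ultimately show ?thesis
    using is_d_classical[OF p A cont] unfolding is_delta_def by (auto simp: is_d_def)
qed

end

text \<open>A test function on U is also one on V, and both integrands vanish off a compact subset
  of U, so integrating over U or over V makes no difference.\<close>

lemma weak_d_subset:
  assumes w: "weak_d V \<omega> \<zeta>" and UV: "U \<subseteq> V"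
  shows "weak_d U \<omega> \<zeta>"
  unfolding weak_d_def wedge_differential
proof
  fix \<phi> assume \<phi>: "\<phi> \<in> test_functions U"
  obtain K where "compact K" and K: "K \<subseteq> U" and z: "\<And>x. x \<notin> K \<Longrightarrow> \<phi> x = 0" "\<And>x. x \<notin> K \<Longrightarrow> grad \<phi> x = 0"
    using test_functions_support[OF \<phi>] by blast
  have "indicator U x *\<^sub>R (\<phi> x *\<^sub>R \<zeta> x) = indicator V x *\<^sub>R (\<phi> x *\<^sub>R \<zeta> x)"
    "indicator U x *\<^sub>R (emul (grad \<phi> x) (\<omega> x)) = indicator V x *\<^sub>R (emul (grad \<phi> x) (\<omega> x))" for x
    using K UV z[of x] by (cases "x \<in> K"; auto simp: indicator_def emul.zero_left)+
  then have "(LINT x:U|lebesgue. \<phi> x *\<^sub>R \<zeta> x) = (LINT x:V|lebesgue. \<phi> x *\<^sub>R \<zeta> x)"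
    "(LINT x:U|lebesgue. emul (grad \<phi> x) (\<omega> x)) = (LINT x:V|lebesgue. emul (grad \<phi> x) (\<omega> x))"
    unfolding set_lebesgue_integral_def by (simp_all only:)
  moreover have "\<phi> \<in> test_functions V" using \<phi> test_functions_mono[OF UV] by blast
  ultimately show "(LINT x:U|lebesgue. \<phi> x *\<^sub>R \<zeta> x) = - (LINT x:U|lebesgue. emul (grad \<phi> x) (\<omega> x))"
    using w by (simp only: weak_d_def wedge_differential)
qed

lemma is_d_subset:
  assumes "bounded_open V" "bounded_open U" "U \<subseteq> V" "bounded_open.is_d V j \<omega> \<zeta>"
  shows "bounded_open.is_d U j \<omega> \<zeta>"
proof -
  interpret V: bounded_open V by fact
  interpret U: bounded_open U by fact
  show ?thesis
    using assms(3,4) weak_d_subset[of V \<omega> \<zeta> U] sq_int_subset[OF _ assms(3) U.sets_U]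
    by (auto simp: V.is_d_def U.is_d_def L2_forms_iff)
qed

lemma is_delta_subset:
  assumes "bounded_open V" "bounded_open U" "U \<subseteq> V" "bounded_open.is_delta V j \<omega> \<zeta>"
  shows "bounded_open.is_delta U j \<omega> \<zeta>"
proof -
  interpret V: bounded_open V by fact
  interpret U: bounded_open U by fact
  show ?thesis
    using assms(3,4) is_d_subset[OF assms(1,2,3)] sq_int_subset[OF _ assms(3) U.sets_U]
    unfolding V.is_delta_def U.is_delta_def L2_forms_iff by blast
qed

section \<open>Moments on a cell\<close>

lemma emul_imul_emul_axis: "emul (axis i 1) (imul (axis i 1) (emul (axis i 1) w)) = emul (axis i 1) w"
  by (simp add: vec_eq_iff emul_axis_nth imul_axis_nth)

lemma Alt_add: "v \<in> Alt j \<Longrightarrow> w \<in> Alt j \<Longrightarrow> v + w \<in> Alt j"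
  by (rule subspace_add[OF Alt_subspace])

lemma Alt_0 [simp]: "0 \<in> Alt j"
  by (rule subspace_0[OF Alt_subspace])

lemma Alt_sum: "(\<And>i. i \<in> I \<Longrightarrow> f i \<in> Alt j) \<Longrightarrow> (\<Sum>i\<in>I. f i) \<in> Alt j"
  by (rule subspace_sum[OF Alt_subspace])

lemma Alt_eqI:
  assumes "v \<in> Alt j" "w \<in> Alt j" "\<And>u. u \<in> Alt j \<Longrightarrow> u \<bullet> v = u \<bullet> w" shows "v = w"
proof -
  have "(v - w) \<bullet> (v - w) = 0"
    using assms(3)[OF Alt_diff[OF assms(1,2)]] by (simp add: inner_diff_right)
  then show ?thesis by simp
qed

context bounded_open
begin

lemma L2_inner_AE:
  assumes "sq_int U f" "sq_int U g" "sq_int U \<eta>" "AE x in lebesgue. x \<in> U \<longrightarrow> f x = g x"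
  shows "L2_inner U f \<eta> = L2_inner U g \<eta>" "L2_inner U \<eta> f = L2_inner U \<eta> g"
proof -
  have "indicator U x *\<^sub>R (f x \<bullet> \<eta> x) = indicator U x *\<^sub>R (g x \<bullet> \<eta> x)" if "x \<in> U \<longrightarrow> f x = g x" for x
    using that by (auto simp: indicator_def)
  then show "L2_inner U f \<eta> = L2_inner U g \<eta>"
    using assms sq_int_inner[OF assms(1,3)] sq_int_inner[OF assms(2,3)]
    unfolding L2_inner_def set_lebesgue_integral_def set_integrable_def
    by (intro integral_cong_AE) (auto elim: eventually_mono)
  then show "L2_inner U \<eta> f = L2_inner U \<eta> g"
    by (simp add: L2_inner_def inner_commute)
qed

lemma integral_inner_const:
  assumes "sq_int U f"
  shows "(LINT x:U|lebesgue. f x \<bullet> e) = (LINT x:U|lebesgue. f x) \<bullet> e"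
  by (rule set_integral_bounded_linear(1)[OF bounded_linear_inner_left sq_int_integrable[OF assms]])

lemma integral_const: "(LINT x:U|lebesgue. c :: 'b::euclidean_space) = measure lebesgue U *\<^sub>R c"
  using lmeasurable_U by (intro set_integral_const) (auto simp: fmeasurable_def less_top)

lemma integral_in_Alt:
  assumes "f \<in> L2_forms U j" shows "(LINT x:U|lebesgue. f x) \<in> Alt j"
  unfolding Alt_def
proof safe
  fix \<alpha> :: "'n set" assume \<alpha>: "card \<alpha> \<noteq> j"
  have "(LINT x:U|lebesgue. f x) $ \<alpha> = (LINT x:U|lebesgue. f x $ \<alpha>)"
    using assms by (intro set_integral_bounded_linear(1)[symmetric, OF bounded_linear_vec_nth] sq_int_integrable)
      (simp add: L2_forms_iff)
  also have "\<dots> = (LINT x:U|lebesgue. 0)"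
    using assms \<alpha> by (intro set_integral_cong_on) (auto simp: L2_forms_iff Alt_def)
  finally show "(LINT x:U|lebesgue. f x) $ \<alpha> = 0" by simp
qed

text \<open>Cauchy-Schwarz against the constant 1, obtained by expanding the integral of the squared
  distance between f and its mean.\<close>

lemma norm_integral_le:
  fixes f :: "'n point \<Rightarrow> 'b::euclidean_space"
  assumes "sq_int U f" "measure lebesgue U > 0"
  shows "(norm (LINT x:U|lebesgue. f x))\<^sup>2 \<le> measure lebesgue U * (LINT x:U|lebesgue. (norm (f x))\<^sup>2)"
proof -
  define m c where "m = measure lebesgue U" and "c = (LINT x:U|lebesgue. f x)"
  have m: "m > 0" using assms by (simp add: m_def)
  have i1: "set_integrable lebesgue U (\<lambda>x. (norm (f x))\<^sup>2)" using assms by (simp add: sq_int_def)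
  have i2: "set_integrable lebesgue U (\<lambda>x. f x \<bullet> ((2 / m) *\<^sub>R c))"
    by (rule sq_int_inner[OF assms(1) sq_int_const])
  have "0 \<le> (LINT x:U|lebesgue. (norm (f x - (1 / m) *\<^sub>R c))\<^sup>2)"
    by (simp add: set_lebesgue_integral_def)
  also have "\<dots> = (LINT x:U|lebesgue. ((norm (f x))\<^sup>2 - f x \<bullet> ((2 / m) *\<^sub>R c)) + (norm c / m)\<^sup>2)"
    by (intro set_integral_cong_on)
      (simp add: power2_norm_eq_inner inner_diff_left inner_diff_right inner_commute power_divide, simp add: power2_eq_square)
  also have "\<dots> = (LINT x:U|lebesgue. (norm (f x))\<^sup>2) - c \<bullet> ((2 / m) *\<^sub>R c) + m * (norm c / m)\<^sup>2"
    using i1 i2 const_integrable[of "(norm c / m)\<^sup>2"] integral_inner_const[OF assms(1), of "(2 / m) *\<^sub>R c"] integral_const[of "(norm c / m)\<^sup>2"]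
    by (simp only: set_integral_add(2) set_integral_diff(1,2) c_def m_def real_scaleR_def)
  also have "\<dots> = (LINT x:U|lebesgue. (norm (f x))\<^sup>2) - (norm c)\<^sup>2 / m"
    using m by (simp add: power2_norm_eq_inner power_divide) (simp add: power2_eq_square field_simps)
  finally show ?thesis using m by (simp add: c_def m_def field_simps)
qed

text \<open>Both families of interpolation conditions have this shape, with \<open>emul\<close> and
  \<open>imul\<close> in the two possible roles. Writing x as z + (x - z) recentres the test form:
  its value at z pairs with the integral of g1, and the rest produces the moment.\<close>

lemma affine_functional:
  fixes B B' :: "'n point \<Rightarrow> 'n extalg \<Rightarrow> 'n extalg"
  assumes B: "bounded_bilinear B" "bounded_bilinear B'" and adj: "\<And>v w u. B v w \<bullet> u = w \<bullet> B' v u"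
    and s: "sq_int U g" "sq_int U g1" "sq_int U gd" "sq_int U \<eta>d"
    and ae: "AE x in lebesgue. x \<in> U \<longrightarrow> gd x = g1 x" "AE x in lebesgue. x \<in> U \<longrightarrow> \<eta>d x = r *\<^sub>R v"
  shows "L2_inner U gd (\<lambda>x. a + B x v) - L2_inner U g \<eta>d
    = (a + B z v) \<bullet> (LINT x:U|lebesgue. g1 x) + v \<bullet> ((LINT x:U|lebesgue. B' (x - z) (g1 x)) - r *\<^sub>R (LINT x:U|lebesgue. g x))"
proof -
  interpret B: bounded_bilinear B by fact
  have s\<eta>: "sq_int U (\<lambda>x. a + B x v)"
    by (intro sq_int_continuous continuous_intros B.continuous_on)
  have sB: "sq_int U (\<lambda>x. B' (x - z) (g1 x))"
    by (intro sq_int_bilinear[OF B(2) _ s(2)] continuous_intros)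
  have "L2_inner U gd (\<lambda>x. a + B x v) = L2_inner U g1 (\<lambda>x. a + B x v)"
    by (rule L2_inner_AE(1)[OF s(3,2) s\<eta> ae(1)])
  also have "\<dots> = (LINT x:U|lebesgue. g1 x \<bullet> (a + B z v) + B' (x - z) (g1 x) \<bullet> v)"
    unfolding L2_inner_def
  proof (rule set_integral_cong_on)
    fix x
    have "a + B x v = (a + B z v) + B (x - z) v" by (simp add: B.diff_left)
    then show "g1 x \<bullet> (a + B x v) = g1 x \<bullet> (a + B z v) + B' (x - z) (g1 x) \<bullet> v"
      using adj[of "x - z" v "g1 x"] by (simp add: inner_add_right inner_commute)
  qed
  also have "\<dots> = (LINT x:U|lebesgue. g1 x) \<bullet> (a + B z v) + (LINT x:U|lebesgue. B' (x - z) (g1 x)) \<bullet> v"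
    using sq_int_inner[OF s(2) sq_int_const, of "a + B z v"] sq_int_inner[OF sB sq_int_const, of v]
    by (simp only: set_integral_add(2) integral_inner_const s sB)
  moreover have "L2_inner U g \<eta>d = L2_inner U g (\<lambda>x. r *\<^sub>R v)"
    by (rule L2_inner_AE(2)[OF s(4) sq_int_const s(1) ae(2)])
  moreover have "\<dots> = (LINT x:U|lebesgue. g x) \<bullet> (r *\<^sub>R v)"
    unfolding L2_inner_def by (rule integral_inner_const[OF s(1)])
  ultimately show ?thesis
    by (simp add: inner_diff_right inner_add_right inner_commute)
qed

end

text \<open>The geometric facts on which the local estimate rests, detached from simplexes: z stands
  for the centroid, M for the mean squares of the centred coordinates, h for a radius around z and
  \<gamma> for the coercivity constant. \<open>simplex_cell\<close> provides the instances.\<close>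

locale cell = bounded_open U for U :: "('n::{finite,linorder}) point set" +
  fixes k :: nat and z :: "'n point" and M :: "'n \<Rightarrow> real" and h \<gamma> :: real
  assumes k: "1 \<le> k" "k < CARD('n)"
    and measure_pos: "measure lebesgue U > 0"
    and h: "h > 0" "\<And>x. x \<in> U \<Longrightarrow> norm (x - z) \<le> h"
    and centered: "(LINT x:U|lebesgue. x - z) = 0"
    and M: "\<And>b. (LINT x:U|lebesgue. (x $ b - z $ b)\<^sup>2) = measure lebesgue U * M b"
    and \<gamma>: "\<gamma> > 0"
    and coercive: "\<And>c. c \<in> Alt k \<Longrightarrow>
      \<gamma> * h\<^sup>2 * measure lebesgue U * (norm c)\<^sup>2 \<le> (LINT x:U|lebesgue. (norm (emul (x - z) c))\<^sup>2)"
begin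

text \<open>This is \<open>q\<^sub>c\<close> of the overview. Although b ranges over all
  coordinates, multiplication followed by contraction annihilates the basis forms whose index
  contains b, and this reproduces the sum over the complement in \<open>mu_d\<close>.\<close>

definition quad :: "'n extalg \<Rightarrow> 'n dform"
  where "quad c x = (\<Sum>b\<in>UNIV. ((x $ b - z $ b)\<^sup>2 - M b) *\<^sub>R imul (axis b 1) (emul (axis b 1) c))"

definition pform :: "'n extalg \<Rightarrow> 'n extalg \<Rightarrow> 'n extalg \<Rightarrow> 'n extalg \<Rightarrow> 'n dform"
  where "pform w a b c x = w + imul (x - z) a + emul (x - z) b + quad c x"

definition pform_d :: "'n extalg \<Rightarrow> 'n extalg \<Rightarrow> 'n dform"
  where "pform_d a c x = real (k + 1) *\<^sub>R a + 2 *\<^sub>R emul (x - z) c"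

definition pform_delta :: "'n extalg \<Rightarrow> 'n dform"
  where "pform_delta b x = - (real (CARD('n) - k + 1) *\<^sub>R b)"

text \<open>The operator behind the quadratic form \<open>\<integral>|X \<and> c|\<^sup>2\<close>,
  as \<open>gram_inner\<close> shows.\<close>

definition gram :: "'n extalg \<Rightarrow> 'n extalg"
  where "gram c = (LINT x:U|lebesgue. imul (x - z) (emul (x - z) c))"

abbreviation m :: real where "m \<equiv> measure lebesgue U"

lemma emul_Alt': "b \<in> Alt (k - 1) \<Longrightarrow> emul v b \<in> Alt k"
  using emul_Alt[of b "k - 1" v] k by simp

lemma imul_Alt': "b \<in> Alt k \<Longrightarrow> imul v b \<in> Alt (k - 1)"
  using imul_Alt[of b "k - 1" v] k by simp

text \<open>On the quadratic part the multiplication in d undoes the contraction and leaves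
  \<open>2 X \<and> c\<close>, whereas \<delta> contracts twice with the same vector and gives zero.
  For the same reason \<open>\<iota>\<^sub>X a\<close> survives in d only and
  \<open>X \<and> b\<close> in \<delta> only.\<close>

lemma pform_classical:
  assumes "w \<in> Alt k" "a \<in> Alt (k + 1)" "b \<in> Alt (k - 1)" "c \<in> Alt k"
  shows "is_d k (pform w a b c) (pform_d a c)" "is_delta k (pform w a b c) (pform_delta b)"
proof -
  define p' where "p' x v = imul v a + emul v b + (\<Sum>b\<in>UNIV. (2 * v $ b * (x $ b - z $ b)) *\<^sub>R imul (axis b 1) (emul (axis b 1) c))" for x v
  have D: "(pform w a b c has_derivative p' x) (at x)" for x
    unfolding pform_def quad_def p'_def
    by (auto intro!: derivative_eq_intros bounded_linear.has_derivative[OF bounded_linear_vec_nth]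
        bounded_linear.has_derivative[OF imul.bounded_linear_left] bounded_linear.has_derivative[OF emul.bounded_linear_left])
  have ax: "p' x (axis i 1) = imul (axis i 1) a + emul (axis i 1) b + (2 * (x $ i - z $ i)) *\<^sub>R imul (axis i 1) (emul (axis i 1) c)" for x i
  proof -
    have "(\<Sum>b\<in>UNIV. (2 * axis i 1 $ b * (x $ b - z $ b)) *\<^sub>R imul (axis b 1) (emul (axis b 1) c))
      = (\<Sum>b\<in>UNIV. if b = i then (2 * (x $ i - z $ i)) *\<^sub>R imul (axis i 1) (emul (axis i 1) c) else 0)"
      by (intro sum.cong) (auto simp: axis_def)
    then show ?thesis by (simp add: p'_def)
  qed
  have A: "imul (axis i 1) a \<in> Alt k" "emul (axis i 1) b \<in> Alt k" "imul (axis i 1) (emul (axis i 1) c) \<in> Alt k" for i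
    using assms by (auto intro!: imul_Alt emul_Alt emul_Alt')
  have A1: "pform w a b c x \<in> Alt k" for x
    unfolding pform_def quad_def using assms
    by (intro Alt_add Alt_sum Alt_scaleR A imul_Alt emul_Alt') auto
  have A2: "p' x (axis i 1) \<in> Alt k" for x i
    unfolding ax by (intro Alt_add Alt_scaleR A)
  have cont: "continuous_on UNIV (\<lambda>x. p' x (axis i 1))" for i
    unfolding ax by (intro continuous_intros)
  have "(\<Sum>i\<in>UNIV. emul (axis i 1) (p' x (axis i 1))) = pform_d a c x" for x
    unfolding ax emul.add_right emul.scaleR_right emul_imul_emul_axis emul_axis_emul_axis sum.distrib
      sum_emul_imul[OF assms(2)] pform_d_def
    by (subst (2) emul_expand) (simp add: scaleR_sum_right)
  then show "is_d k (pform w a b c) (pform_d a c)"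
    using is_d_classical[OF D A1 A2 cont] by simp
  have "- (\<Sum>i\<in>UNIV. imul (axis i 1) (p' x (axis i 1))) = pform_delta b x" for x
    unfolding ax imul.add_right imul.scaleR_right imul_axis_imul_axis sum.distrib
      sum_imul_emul[OF assms(3)] pform_delta_def using k by (simp add: of_nat_diff)
  then show "is_delta k (pform w a b c) (pform_delta b)"
    using is_delta_classical[OF D A1 A2 cont] k by simp
qed

lemma affine_classical:
  assumes "a \<in> Alt (k + 1)" "v \<in> Alt k"
  shows "is_delta (k + 1) (\<lambda>x. a + emul x v) (\<lambda>x. - (real (CARD('n) - k) *\<^sub>R v))"
proof -
  have D: "((\<lambda>x. a + emul x v) has_derivative (\<lambda>h. emul h v)) (at x)" for x
    by (auto intro!: derivative_eq_intros bounded_linear.has_derivative[OF emul.bounded_linear_left])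
  have "is_delta (k + 1) (\<lambda>x. a + emul x v) (\<lambda>x. - (\<Sum>i\<in>UNIV. imul (axis i 1) (emul (axis i 1) v)))"
    using assms emul_Alt[OF assms(2)] k by (intro is_delta_classical[OF D]) (auto intro!: Alt_add)
  then show ?thesis
    using k by (simp add: sum_imul_emul[OF assms(2)] of_nat_diff)
qed

lemma affine_classical':
  assumes "b \<in> Alt (k - 1)" "u \<in> Alt k"
  shows "is_d (k - 1) (\<lambda>x. b + imul x u) (\<lambda>x. real k *\<^sub>R u)"
proof -
  have D: "((\<lambda>x. b + imul x u) has_derivative (\<lambda>h. imul h u)) (at x)" for x
    by (auto intro!: derivative_eq_intros bounded_linear.has_derivative[OF imul.bounded_linear_left])
  have "is_d (k - 1) (\<lambda>x. b + imul x u) (\<lambda>x. \<Sum>i\<in>UNIV. emul (axis i 1) (imul (axis i 1) u))"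
    using assms imul_Alt'[OF assms(2)] by (intro is_d_classical[OF D]) (auto intro!: Alt_add)
  then show ?thesis
    by (simp add: sum_emul_imul[OF assms(2)])
qed

text \<open>What a linear test form centred at z sees. The factor n - k stems from
  \<open>\<delta> (X \<and> v) = - (n - k) v\<close>, and the factor k in \<open>mom4\<close> from
  \<open>d (\<iota>\<^sub>X u) = k u\<close>.\<close>

definition mom2 :: "'n dform \<Rightarrow> 'n dform \<Rightarrow> 'n extalg"
  where "mom2 g g1 = (LINT x:U|lebesgue. imul (x - z) (g1 x)) + real (CARD('n) - k) *\<^sub>R (LINT x:U|lebesgue. g x)"

definition mom4 :: "'n dform \<Rightarrow> 'n dform \<Rightarrow> 'n extalg"
  where "mom4 g g2 = (LINT x:U|lebesgue. emul (x - z) (g2 x)) - real k *\<^sub>R (LINT x:U|lebesgue. g x)"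

lemma sq_int_moments: "sq_int U f \<Longrightarrow> sq_int U (\<lambda>x. imul (x - z) (f x))" "sq_int U f \<Longrightarrow> sq_int U (\<lambda>x. emul (x - z) (f x))"
  by (intro sq_int_bilinear[OF bounded_bilinear_imul] sq_int_bilinear[OF bounded_bilinear_emul] continuous_intros; assumption)+

text \<open>The chosen derivatives may be replaced under the integral: by g1 for g, and by the
  constant codifferential for the affine test form.\<close>

lemma functional_eta:
  assumes g: "is_d k g g1" and a: "a \<in> Alt (k + 1)" and v: "v \<in> Alt k"
  defines "\<eta> \<equiv> (\<lambda>x. a + emul x v)"
  shows "L2_inner U (ext_d U k g) \<eta> - L2_inner U g (codiff U (k + 1) \<eta>)
    = (a + emul z v) \<bullet> (LINT x:U|lebesgue. g1 x) + v \<bullet> mom2 g g1"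
proof -
  note A = affine_classical[OF a v]
  have "sq_int U g" "sq_int U g1" "sq_int U (ext_d U k g)" "sq_int U (codiff U (k + 1) \<eta>)"
    using g ext_d_spec(1)[OF g] is_delta_L2[OF codiff_spec(1)[OF A]] k
    by (auto simp: is_d_def L2_forms_iff \<eta>_def)
  moreover have "AE x in lebesgue. x \<in> U \<longrightarrow> codiff U (k + 1) \<eta> x = (- real (CARD('n) - k)) *\<^sub>R v"
    using codiff_spec(2)[OF A] by (simp add: \<eta>_def)
  ultimately show ?thesis
    using affine_functional[where r = "- real (CARD('n) - k)" and v = v and a = a and z = z,
        OF bounded_bilinear_emul bounded_bilinear_imul inner_emul _ _ _ _ ext_d_spec(2)[OF g]]
    by (simp add: mom2_def \<eta>_def)
qed

lemma functional_tau:
  assumes g: "is_delta k g g2" and b: "b \<in> Alt (k - 1)" and u: "u \<in> Alt k"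
  defines "\<tau> \<equiv> (\<lambda>x. b + imul x u)"
  shows "L2_inner U (codiff U k g) \<tau> - L2_inner U g (ext_d U (k - 1) \<tau>)
    = (b + imul z u) \<bullet> (LINT x:U|lebesgue. g2 x) + u \<bullet> mom4 g g2"
proof -
  note A = affine_classical'[OF b u]
  have "imul v w \<bullet> u = w \<bullet> emul v u" for v :: "'n point" and w u
    by (metis inner_commute inner_emul)
  moreover have "sq_int U g" "sq_int U g2" "sq_int U (codiff U k g)" "sq_int U (ext_d U (k - 1) \<tau>)"
    using g is_delta_L2[OF g] is_delta_L2[OF codiff_spec(1)[OF g]] ext_d_spec(1)[OF A] k
    by (auto simp: is_d_def is_delta_def L2_forms_iff \<tau>_def)
  ultimately show ?thesis
    using affine_functional[where r = "real k" and v = u and a = b and z = z,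
        OF bounded_bilinear_imul bounded_bilinear_emul _ _ _ _ _ codiff_spec(2)[OF g]] ext_d_spec(2)[OF A]
    by (simp add: mom4_def \<tau>_def)
qed

end

section \<open>Unisolvence\<close>

lemma star_koszul_star_eq:
  assumes k: "k < CARD('n::{finite,linorder})"
  shows "star_koszul_star c (k + 1) = {\<lambda>x. emul (x - c) v |v. v \<in> (Alt k :: 'n extalg set)}"
proof -
  define \<epsilon> :: real where "\<epsilon> = (- 1) ^ (k * (CARD('n) - k - 1))"
  have \<epsilon>: "\<epsilon> * \<epsilon> = 1"
    by (simp add: \<epsilon>_def flip: power_add)
  have eq: "hodge_form (koszul c (hodge_form (\<lambda>x. w))) = (\<lambda>x. emul (x - c) (\<epsilon> *\<^sub>R w))"
    if "w \<in> Alt k" for w :: "'n extalg"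
    using hodge_imul_hodge[OF that k]
    by (simp add: fun_eq_iff hodge_form_def koszul_eq \<epsilon>_def emul.scaleR_right)
  show ?thesis
  proof (intro set_eqI iffI)
    fix \<omega> assume "\<omega> \<in> star_koszul_star c (k + 1)"
    then obtain w where "w \<in> Alt k" "\<omega> = hodge_form (koszul c (hodge_form (\<lambda>x. w)))"
      by (auto simp: star_koszul_star_def P0_def)
    then show "\<omega> \<in> {\<lambda>x. emul (x - c) v |v. v \<in> Alt k}"
      using Alt_scaleR eq by blast
  next
    fix \<omega> assume "\<omega> \<in> {\<lambda>x. emul (x - c) v |v. v \<in> (Alt k :: 'n extalg set)}"
    then obtain v where v: "v \<in> Alt k" "\<omega> = (\<lambda>x. emul (x - c) v)" by blast
    then have "\<omega> = hodge_form (koszul c (hodge_form (\<lambda>x. \<epsilon> *\<^sub>R v)))"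
      by (simp add: eq[OF Alt_scaleR] \<epsilon>)
    then show "\<omega> \<in> star_koszul_star c (k + 1)"
      using Alt_scaleR[OF v(1)] by (auto simp: star_koszul_star_def P0_def)
  qed
qed

lemma koszul_P0_eq: "koszul c ` P0 j = {\<lambda>x. imul (x - c) u |u. u \<in> Alt j}"
proof -
  have "koszul c (\<lambda>x. u) = (\<lambda>x. imul (x - c) u)" for u
    by (simp add: fun_eq_iff koszul_eq)
  moreover have "koszul c ` P0 j = (\<lambda>u. koszul c (\<lambda>x. u)) ` Alt j"
    unfolding P0_def by blast
  ultimately show ?thesis by auto
qed

lemma form_sum_ranges:
  "{f a |a. a \<in> A} \<oplus>\<^sub>f {g b |b. b \<in> B} = {\<lambda>x. f a x + g b x |a b. a \<in> A \<and> b \<in> B}"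
proof (intro set_eqI iffI)
  fix \<omega> assume "\<omega> \<in> {\<lambda>x. f a x + g b x |a b. a \<in> A \<and> b \<in> B}"
  then obtain a b where "a \<in> A" "b \<in> B" "\<omega> = (\<lambda>x. f a x + g b x)" by blast
  then show "\<omega> \<in> {f a |a. a \<in> A} \<oplus>\<^sub>f {g b |b. b \<in> B}"
    unfolding form_sum_def by (intro CollectI exI[of _ "f a"] exI[of _ "g b"]) auto
qed (auto simp: form_sum_def)

lemma P1_star_minus_eq:
  assumes "k < CARD('n::{finite,linorder})"
  shows "P1_star_minus (k + 1) = {\<lambda>x. a + emul x v |a v. a \<in> (Alt (k + 1) :: 'n extalg set) \<and> v \<in> Alt k}"
  unfolding P1_star_minus_def star_koszul_star_eq[OF assms] P0_def form_sum_ranges diff_zero ..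

lemma P1_minus_eq: "P1_minus j = {\<lambda>x. b + imul x u |b u. b \<in> Alt j \<and> u \<in> Alt (j + 1)}"
  unfolding P1_minus_def koszul_P0_eq unfolding P0_def form_sum_ranges diff_zero ..

context bounded_open
begin

lemma integral_diff:
  fixes f g :: "'n point \<Rightarrow> 'b::euclidean_space"
  assumes "sq_int U f" "sq_int U g"
  shows "(LINT x:U|lebesgue. f x - g x) = (LINT x:U|lebesgue. f x) - (LINT x:U|lebesgue. g x)"
  by (rule set_integral_diff(2)[OF sq_int_integrable[OF assms(1)] sq_int_integrable[OF assms(2)]])

lemma integral_add:
  fixes f g :: "'n point \<Rightarrow> 'b::euclidean_space"
  assumes "sq_int U f" "sq_int U g"
  shows "(LINT x:U|lebesgue. f x + g x) = (LINT x:U|lebesgue. f x) + (LINT x:U|lebesgue. g x)"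
  by (rule set_integral_add(2)[OF sq_int_integrable[OF assms(1)] sq_int_integrable[OF assms(2)]])

lemma integral_sum:
  fixes f :: "'i \<Rightarrow> 'n point \<Rightarrow> 'b::euclidean_space"
  assumes "\<And>i. sq_int U (f i)"
  shows "(LINT x:U|lebesgue. (\<Sum>i\<in>I. f i x)) = (\<Sum>i\<in>I. LINT x:U|lebesgue. f i x)"
  unfolding set_lebesgue_integral_def scaleR_sum_right
  using sq_int_integrable[OF assms] by (intro Bochner_Integration.integral_sum) (simp add: set_integrable_def)

end

section \<open>The interpolation conditions as equations between moments\<close>

context cell
begin

definition same_moments where
  "same_moments g g1 g2 g' g1' g2' \<longleftrightarrow>
    (LINT x:U|lebesgue. g1 x) = (LINT x:U|lebesgue. g1' x) \<and> mom2 g g1 = mom2 g' g1' \<and>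
    (LINT x:U|lebesgue. g2 x) = (LINT x:U|lebesgue. g2' x) \<and> mom4 g g2 = mom4 g' g2'"

lemma moments_Alt:
  assumes "is_d k g g1" "is_delta k g g2"
  shows "(LINT x:U|lebesgue. g1 x) \<in> Alt (k + 1)" "mom2 g g1 \<in> Alt k"
    "(LINT x:U|lebesgue. g2 x) \<in> Alt (k - 1)" "mom4 g g2 \<in> Alt k"
proof -
  have L: "g \<in> L2_forms U k" "g1 \<in> L2_forms U (k + 1)" "g2 \<in> L2_forms U (k - 1)"
    using assms is_delta_L2[OF assms(2)] k by (auto simp: is_d_def)
  then have "(\<lambda>x. imul (x - z) (g1 x)) \<in> L2_forms U k" "(\<lambda>x. emul (x - z) (g2 x)) \<in> L2_forms U k"
    by (auto simp: L2_forms_iff intro: sq_int_moments imul_Alt emul_Alt')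
  then show "(LINT x:U|lebesgue. g1 x) \<in> Alt (k + 1)" "mom2 g g1 \<in> Alt k"
    "(LINT x:U|lebesgue. g2 x) \<in> Alt (k - 1)" "mom4 g g2 \<in> Alt k"
    unfolding mom2_def mom4_def using L by (auto intro!: Alt_add Alt_diff Alt_scaleR integral_in_Alt)
qed

definition interp_cond :: "'n dform \<Rightarrow> 'n dform \<Rightarrow> bool"
  where "interp_cond \<mu> p \<longleftrightarrow>
    (\<forall>\<eta>\<in>P1_star_minus (k + 1).
       L2_inner U (ext_d U k p) \<eta> - L2_inner U p (codiff U (k + 1) \<eta>) =
       L2_inner U (ext_d U k \<mu>) \<eta> - L2_inner U \<mu> (codiff U (k + 1) \<eta>)) \<and>
    (\<forall>\<tau>\<in>P1_minus (k - 1).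
       L2_inner U (codiff U k p) \<tau> - L2_inner U p (ext_d U (k - 1) \<tau>) =
       L2_inner U (codiff U k \<mu>) \<tau> - L2_inner U \<mu> (ext_d U (k - 1) \<tau>))"

text \<open>Testing with v = 0 gives X = X'. After that the terms with E cancel and a = 0 gives Y =
  Y', so the recentring of the test forms costs nothing.\<close>

lemma affine_functional_eq_iff:
  assumes A: "X \<in> Alt j" "X' \<in> Alt j" "Y \<in> Alt l" "Y' \<in> Alt l" and E: "E 0 = 0"
  shows "(\<forall>a\<in>Alt j. \<forall>v\<in>Alt l. (a + E v) \<bullet> X + v \<bullet> Y = (a + E v) \<bullet> X' + v \<bullet> Y') \<longleftrightarrow> X = X' \<and> Y = Y'"
proof safe
  assume H: "\<forall>a\<in>Alt j. \<forall>v\<in>Alt l. (a + E v) \<bullet> X + v \<bullet> Y = (a + E v) \<bullet> X' + v \<bullet> Y'"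
  show 1: "X = X'"
    by (rule Alt_eqI[OF A(1,2)]) (use bspec[OF bspec[OF H] Alt_0] E in simp)
  show "Y = Y'"
    by (rule Alt_eqI[OF A(3,4)]) (use bspec[OF bspec[OF H Alt_0]] 1 in simp)
qed

lemma interp_cond_iff:
  assumes p: "is_d k p p1" "is_delta k p p2" and \<mu>: "is_d k \<mu> \<mu>1" "is_delta k \<mu> \<mu>2"
  shows "interp_cond \<mu> p \<longleftrightarrow> same_moments p p1 p2 \<mu> \<mu>1 \<mu>2"
proof -
  note A = moments_Alt[OF p] moments_Alt[OF \<mu>]
  have "(\<forall>\<eta>\<in>P1_star_minus (k + 1).
       L2_inner U (ext_d U k p) \<eta> - L2_inner U p (codiff U (k + 1) \<eta>) =
       L2_inner U (ext_d U k \<mu>) \<eta> - L2_inner U \<mu> (codiff U (k + 1) \<eta>)) \<longleftrightarrow>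
    (\<forall>a\<in>Alt (k + 1). \<forall>v\<in>Alt k. (a + emul z v) \<bullet> (LINT x:U|lebesgue. p1 x) + v \<bullet> mom2 p p1
      = (a + emul z v) \<bullet> (LINT x:U|lebesgue. \<mu>1 x) + v \<bullet> mom2 \<mu> \<mu>1)"
  proof -
    have ball: "(\<forall>\<eta>\<in>{\<lambda>x. a + emul x v |a v. a \<in> Alt (k + 1) \<and> v \<in> Alt k}. R \<eta>) \<longleftrightarrow>
        (\<forall>a\<in>Alt (k + 1). \<forall>v\<in>Alt k. R (\<lambda>x. a + emul x v))" for R by blast
    show ?thesis
      unfolding P1_star_minus_eq[OF k(2)] ball
      by (intro ball_cong refl, simp only: functional_eta[OF p(1)] functional_eta[OF \<mu>(1)])
  qed
  also have "\<dots> \<longleftrightarrow> (LINT x:U|lebesgue. p1 x) = (LINT x:U|lebesgue. \<mu>1 x) \<and> mom2 p p1 = mom2 \<mu> \<mu>1"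
    by (rule affine_functional_eq_iff[OF A(1,5,2,6)]) (rule emul.zero_right)
  finally have 1: "(\<forall>\<eta>\<in>P1_star_minus (k + 1).
       L2_inner U (ext_d U k p) \<eta> - L2_inner U p (codiff U (k + 1) \<eta>) =
       L2_inner U (ext_d U k \<mu>) \<eta> - L2_inner U \<mu> (codiff U (k + 1) \<eta>)) \<longleftrightarrow>
     (LINT x:U|lebesgue. p1 x) = (LINT x:U|lebesgue. \<mu>1 x) \<and> mom2 p p1 = mom2 \<mu> \<mu>1" .
  have k1: "k - 1 + 1 = k" using k by simp
  have "(\<forall>\<tau>\<in>P1_minus (k - 1).
       L2_inner U (codiff U k p) \<tau> - L2_inner U p (ext_d U (k - 1) \<tau>) =
       L2_inner U (codiff U k \<mu>) \<tau> - L2_inner U \<mu> (ext_d U (k - 1) \<tau>)) \<longleftrightarrow>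
    (\<forall>b\<in>Alt (k - 1). \<forall>u\<in>Alt k. (b + imul z u) \<bullet> (LINT x:U|lebesgue. p2 x) + u \<bullet> mom4 p p2
      = (b + imul z u) \<bullet> (LINT x:U|lebesgue. \<mu>2 x) + u \<bullet> mom4 \<mu> \<mu>2)"
  proof -
    have ball: "(\<forall>\<eta>\<in>{\<lambda>x. b + imul x u |b u. b \<in> Alt (k - 1) \<and> u \<in> Alt k}. R \<eta>) \<longleftrightarrow>
        (\<forall>b\<in>Alt (k - 1). \<forall>u\<in>Alt k. R (\<lambda>x. b + imul x u))" for R by blast
    show ?thesis
      unfolding P1_minus_eq k1 ball
      by (intro ball_cong refl, simp only: functional_tau[OF p(2)] functional_tau[OF \<mu>(2)])
  qed
  also have "\<dots> \<longleftrightarrow> (LINT x:U|lebesgue. p2 x) = (LINT x:U|lebesgue. \<mu>2 x) \<and> mom4 p p2 = mom4 \<mu> \<mu>2"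
    by (rule affine_functional_eq_iff[OF A(3,7,4,8)]) (rule imul.zero_right)
  finally show ?thesis
    unfolding interp_cond_def same_moments_def 1 by blast
qed

section \<open>Moments of the local forms and solution of the moment equations\<close>

lemma integral_imul_centered: "(LINT x:U|lebesgue. imul (x - z) a) = 0"
  by (subst set_integral_bounded_linear(1)[OF imul.bounded_linear_left])
    (auto intro!: sq_int_integrable sq_int_continuous continuous_intros simp: centered imul.zero_left)

lemma integral_emul_centered: "(LINT x:U|lebesgue. emul (x - z) a) = 0"
  by (subst set_integral_bounded_linear(1)[OF emul.bounded_linear_left])
    (auto intro!: sq_int_integrable sq_int_continuous continuous_intros simp: centered emul.zero_left)

lemma continuous_quad: "continuous_on UNIV (quad c)"
  unfolding quad_def[abs_def] by (intro continuous_intros)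

lemma continuous_pform: "continuous_on UNIV (pform w a b c)"
  unfolding pform_def[abs_def]
  by (intro continuous_intros imul.continuous_on emul.continuous_on continuous_quad)

lemma integral_quad: "(LINT x:U|lebesgue. quad c x) = 0"
proof -
  have s1: "sq_int U (\<lambda>x. (x $ b - z $ b)\<^sup>2)" for b
    by (intro sq_int_continuous continuous_intros)
  have s: "sq_int U (\<lambda>x. ((x $ b - z $ b)\<^sup>2 - M b) *\<^sub>R imul (axis b 1) (emul (axis b 1) c))" for b
    by (intro sq_int_continuous continuous_intros)
  have "(LINT x:U|lebesgue. quad c x) =
      (\<Sum>b\<in>UNIV. LINT x:U|lebesgue. ((x $ b - z $ b)\<^sup>2 - M b) *\<^sub>R imul (axis b 1) (emul (axis b 1) c))"
    unfolding quad_def by (rule integral_sum[OF s])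
  moreover have "(LINT x:U|lebesgue. ((x $ b - z $ b)\<^sup>2 - M b) *\<^sub>R imul (axis b 1) (emul (axis b 1) c)) = 0" for b
  proof -
    have "(LINT x:U|lebesgue. (x $ b - z $ b)\<^sup>2 - M b) = 0"
      using integral_diff[OF s1[of b] sq_int_const[of "M b"]] integral_const[of "M b"] M[of b] by simp
    then show ?thesis
      by (subst set_integral_bounded_linear(1)[OF bounded_linear_scaleR_left])
        (auto intro!: sq_int_integrable sq_int_diff s1 sq_int_const)
  qed
  ultimately show ?thesis by simp
qed

lemma integral_pform: "(LINT x:U|lebesgue. pform w a b c x) = m *\<^sub>R w"
proof -
  have s: "sq_int U (\<lambda>x. w)" "sq_int U (\<lambda>x. imul (x - z) a)" "sq_int U (\<lambda>x. emul (x - z) b)" "sq_int U (quad c)"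
    by (intro sq_int_continuous continuous_intros imul.continuous_on emul.continuous_on continuous_quad)+
  show ?thesis
    unfolding pform_def
    by (simp add: integral_add s sq_int_add integral_imul_centered integral_emul_centered integral_quad integral_const)
qed

lemma sq_int_gram: "sq_int U (\<lambda>x. imul (x - z) (emul (x - z) c))"
  by (intro sq_int_continuous continuous_intros imul.continuous_on emul.continuous_on)

lemma integral_scaleR: "(LINT x:U|lebesgue. r *\<^sub>R f x) = r *\<^sub>R (LINT x:U|lebesgue. f x :: 'n extalg)"
  by (rule set_integral_scaleR_right)

text \<open>The system is triangular: the first and third moments fix a and b, the fourth fixes w,
  and the second then prescribes \<open>gram c\<close>. Centring at z and the constants
  \<open>M b\<close> remove all other terms.\<close>

lemma pform_moments:
  "(LINT x:U|lebesgue. pform_d a c x) = (real (k + 1) * m) *\<^sub>R a"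
  "mom2 (pform w a b c) (pform_d a c) = 2 *\<^sub>R gram c + (real (CARD('n) - k) * m) *\<^sub>R w"
  "(LINT x:U|lebesgue. pform_delta b x) = - ((real (CARD('n) - k + 1) * m) *\<^sub>R b)"
  "mom4 (pform w a b c) (pform_delta b) = - ((real k * m) *\<^sub>R w)"
proof -
  have s: "sq_int U (\<lambda>x. emul (x - z) c)" "sq_int U (\<lambda>x. imul (x - z) a)"
    by (intro sq_int_continuous continuous_intros imul.continuous_on emul.continuous_on)+
  show "(LINT x:U|lebesgue. pform_d a c x) = (real (k + 1) * m) *\<^sub>R a"
    unfolding pform_d_def integral_add[OF sq_int_const sq_int_scaleR[OF s(1)]] integral_scaleR
      integral_emul_centered integral_const by (simp add: mult.commute)
  have "(LINT x:U|lebesgue. imul (x - z) (pform_d a c x)) =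
      (LINT x:U|lebesgue. real (k + 1) *\<^sub>R imul (x - z) a + 2 *\<^sub>R imul (x - z) (emul (x - z) c))"
    by (simp add: pform_d_def imul.add_right imul.scaleR_right)
  also have "\<dots> = 2 *\<^sub>R gram c"
    unfolding integral_add[OF sq_int_scaleR[OF s(2)] sq_int_scaleR[OF sq_int_gram]] integral_scaleR
      integral_imul_centered gram_def by simp
  finally show "mom2 (pform w a b c) (pform_d a c) = 2 *\<^sub>R gram c + (real (CARD('n) - k) * m) *\<^sub>R w"
    by (simp add: mom2_def integral_pform)
  show "(LINT x:U|lebesgue. pform_delta b x) = - ((real (CARD('n) - k + 1) * m) *\<^sub>R b)"
    unfolding pform_delta_def integral_const by (simp add: mult.commute)
  have "(LINT x:U|lebesgue. emul (x - z) (pform_delta b x)) = (LINT x:U|lebesgue. (- real (CARD('n) - k + 1)) *\<^sub>R emul (x - z) b)"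
    by (simp only: pform_delta_def emul.minus_right emul.scaleR_right scaleR_minus_left)
  also have "\<dots> = 0" unfolding integral_scaleR integral_emul_centered by simp
  finally show "mom4 (pform w a b c) (pform_delta b) = - ((real k * m) *\<^sub>R w)"
    by (simp add: mom4_def integral_pform)
qed

lemma gram_inner: "c \<bullet> gram c = (LINT x:U|lebesgue. (norm (emul (x - z) c))\<^sup>2)"
proof -
  have "c \<bullet> gram c = (LINT x:U|lebesgue. imul (x - z) (emul (x - z) c) \<bullet> c)"
    unfolding gram_def integral_inner_const[OF sq_int_gram] by (simp add: inner_commute)
  also have "\<dots> = (LINT x:U|lebesgue. (norm (emul (x - z) c))\<^sup>2)"
    by (intro set_integral_cong_on) (simp add: power2_norm_eq_inner inner_emul inner_commute[of "imul _ _" c])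
  finally show ?thesis .
qed

lemma linear_gram: "linear gram"
proof (rule linearI)
  fix c d r
  show "gram (c + d) = gram c + gram d"
    unfolding gram_def emul.add_right imul.add_right integral_add[OF sq_int_gram sq_int_gram] ..
  show "gram (r *\<^sub>R c) = r *\<^sub>R gram c"
    unfolding gram_def emul.scaleR_right imul.scaleR_right integral_scaleR ..
qed

lemma gram_Alt: "c \<in> Alt k \<Longrightarrow> gram c \<in> Alt k"
  unfolding gram_def by (intro integral_in_Alt) (auto simp: L2_forms_iff sq_int_gram intro!: imul_Alt emul_Alt)

lemma gram_eq_0: "c \<in> Alt k \<Longrightarrow> gram c = 0 \<Longrightarrow> c = 0"
  using coercive[of c] gram_inner[of c] h(1) \<gamma> measure_pos by (simp add: mult_le_0_iff)

text \<open>Coercivity makes \<open>gram\<close> injective on \<open>Alt k\<close>, which it maps to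
  itself, and equal dimensions give surjectivity.\<close>

lemma gram_surj: "gram ` Alt k = Alt k"
proof (rule subspace_dim_equal)
  have "inj_on gram (Alt k)"
    unfolding linear_inj_on_iff_eq_0[OF linear_gram Alt_subspace] using gram_eq_0 by blast
  then have "inj_on gram (span (Alt k))" by (simp add: span_eq_iff[THEN iffD2, OF Alt_subspace])
  then show "dim (gram ` Alt k) \<ge> dim (Alt k :: 'n extalg set)"
    using dim_image_eq[OF linear_gram] by simp
qed (use gram_Alt linear_subspace_image[OF linear_gram Alt_subspace] Alt_subspace in auto)

lemma quad_diff: "quad c x - quad c' x = quad (c - c') x"
  by (simp add: quad_def imul.diff_right emul.diff_right scaleR_diff_right sum_subtractf)

lemma pform_diff: "pform w a b c x - pform w' a' b' c' x = pform (w - w') (a - a') (b - b') (c - c') x"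
  by (simp add: pform_def imul.diff_right emul.diff_right flip: quad_diff)

definition pforms :: "'n dform set"
  where "pforms = {pform w a b c |w a b c. w \<in> Alt k \<and> a \<in> Alt (k + 1) \<and> b \<in> Alt (k - 1) \<and> c \<in> Alt k}"

text \<open>This justifies the definite description in \<open>interp_local\<close>. The conditions
  force the coefficients of any representation, so the function is unique although nothing is proved
  about unique representation of a given function.\<close>

lemma interp_unique:
  assumes \<mu>: "is_d k \<mu> \<mu>1" "is_delta k \<mu> \<mu>2"
  shows "\<exists>!p. p \<in> pforms \<and> interp_cond \<mu> p"
proof -
  have pos: "real (k + 1) * m \<noteq> 0" "real (CARD('n) - k + 1) * m \<noteq> 0" "real k * m \<noteq> 0"
    using measure_pos k by auto
  note A = moments_Alt[OF \<mu>]
  define a where "a = (1 / (real (k + 1) * m)) *\<^sub>R (LINT x:U|lebesgue. \<mu>1 x)"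
  define b where "b = (- 1 / (real (CARD('n) - k + 1) * m)) *\<^sub>R (LINT x:U|lebesgue. \<mu>2 x)"
  define w where "w = (- 1 / (real k * m)) *\<^sub>R mom4 \<mu> \<mu>2"
  have abw: "a \<in> Alt (k + 1)" "b \<in> Alt (k - 1)" "w \<in> Alt k"
    unfolding a_def b_def w_def by (intro Alt_scaleR A)+
  have "(1 / 2) *\<^sub>R (mom2 \<mu> \<mu>1 - (real (CARD('n) - k) * m) *\<^sub>R w) \<in> gram ` Alt k"
    unfolding gram_surj by (intro Alt_scaleR Alt_diff A abw)
  then obtain c where c': "c \<in> Alt k" "(1 / 2) *\<^sub>R (mom2 \<mu> \<mu>1 - (real (CARD('n) - k) * m) *\<^sub>R w) = gram c"
    by blast
  then have c: "c \<in> Alt k" "2 *\<^sub>R gram c = mom2 \<mu> \<mu>1 - (real (CARD('n) - k) * m) *\<^sub>R w"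
    by (simp_all flip: c'(2))
  have iff: "interp_cond \<mu> (pform w' a' b' c') \<longleftrightarrow> w' = w \<and> a' = a \<and> b' = b \<and> c' = c"
    if "w' \<in> Alt k" "a' \<in> Alt (k + 1)" "b' \<in> Alt (k - 1)" "c' \<in> Alt k" for w' a' b' c'
  proof -
    have "interp_cond \<mu> (pform w' a' b' c') \<longleftrightarrow>
        (real (k + 1) * m) *\<^sub>R a' = (LINT x:U|lebesgue. \<mu>1 x) \<and>
        2 *\<^sub>R gram c' + (real (CARD('n) - k) * m) *\<^sub>R w' = mom2 \<mu> \<mu>1 \<and>
        - ((real (CARD('n) - k + 1) * m) *\<^sub>R b') = (LINT x:U|lebesgue. \<mu>2 x) \<and>
        - ((real k * m) *\<^sub>R w') = mom4 \<mu> \<mu>2"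
      unfolding interp_cond_iff[OF pform_classical[OF that] \<mu>] same_moments_def pform_moments ..
    also have "\<dots> \<longleftrightarrow> (real (k + 1) * m) *\<^sub>R a' = (real (k + 1) * m) *\<^sub>R a \<and>
        2 *\<^sub>R gram c' + (real (CARD('n) - k) * m) *\<^sub>R w' = 2 *\<^sub>R gram c + (real (CARD('n) - k) * m) *\<^sub>R w \<and>
        (real (CARD('n) - k + 1) * m) *\<^sub>R b' = (real (CARD('n) - k + 1) * m) *\<^sub>R b \<and>
        (real k * m) *\<^sub>R w' = (real k * m) *\<^sub>R w"
    proof -
      have "(real (k + 1) * m) *\<^sub>R a = (LINT x:U|lebesgue. \<mu>1 x)"
        "- ((real (CARD('n) - k + 1) * m) *\<^sub>R b) = (LINT x:U|lebesgue. \<mu>2 x)"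
        "- ((real k * m) *\<^sub>R w) = mom4 \<mu> \<mu>2"
        unfolding a_def b_def w_def using pos by simp_all
      moreover have "2 *\<^sub>R gram c + (real (CARD('n) - k) * m) *\<^sub>R w = mom2 \<mu> \<mu>1" using c(2) by simp
      ultimately show ?thesis by (metis neg_equal_iff_equal)
    qed
    also have "\<dots> \<longleftrightarrow> w' = w \<and> a' = a \<and> b' = b \<and> gram c' = gram c"
      unfolding scaleR_cancel_left using pos by auto
    also have "gram c' = gram c \<longleftrightarrow> c' = c"
      using gram_eq_0[OF Alt_diff[OF that(4) c(1)]] linear_diff[OF linear_gram, of c' c] by auto
    finally show ?thesis .
  qed
  show ?thesis
  proof (rule ex1I[of _ "pform w a b c"])
    show "pform w a b c \<in> pforms \<and> interp_cond \<mu> (pform w a b c)"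
      using iff abw c(1) by (auto simp: pforms_def)
  qed (auto simp: pforms_def iff)
qed

end

section \<open>The local stability estimate\<close>

text \<open>The squared norm, since estimates on single elements can be summed in squares
  only.\<close>

definition sqn :: "('n::finite) point set \<Rightarrow> ('n point \<Rightarrow> 'b::euclidean_space) \<Rightarrow> real"
  where "sqn U f = (LINT x:U|lebesgue. (norm (f x))\<^sup>2)"

lemma sqn_nonneg: "0 \<le> sqn U f"
  by (simp add: sqn_def set_lebesgue_integral_def)

lemma L2_norm_eq_sqn: "L2_norm U f = sqrt (sqn U f)"
  by (simp add: L2_norm_def L2_inner_def sqn_def power2_norm_eq_inner)

lemma sqn_mono:
  assumes "sq_int U f" "set_integrable lebesgue U g" "\<And>x. x \<in> U \<Longrightarrow> (norm (f x))\<^sup>2 \<le> g x"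
  shows "sqn U f \<le> (LINT x:U|lebesgue. g x)"
  unfolding sqn_def using assms by (intro set_integral_mono) (auto simp: sq_int_def)

lemma sqn_add:
  assumes "sq_int U f" "sq_int U g" shows "sqn U (\<lambda>x. f x + g x) \<le> 2 * sqn U f + 2 * sqn U g"
proof -
  have "sqn U (\<lambda>x. f x + g x) \<le> (LINT x:U|lebesgue. 2 * (norm (f x))\<^sup>2 + 2 * (norm (g x))\<^sup>2)"
    using assms by (intro sqn_mono sq_int_add norm_add_square set_integral_add(1)) (auto simp: sq_int_def)
  also have "\<dots> = 2 * sqn U f + 2 * sqn U g"
    using assms by (subst set_integral_add(2)) (auto simp: sq_int_def sqn_def)
  finally show ?thesis .
qed

lemma sqn_diff:
  assumes "sq_int U f" "sq_int U g" shows "sqn U (\<lambda>x. f x - g x) \<le> 2 * sqn U f + 2 * sqn U g"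
  using sqn_add[OF assms(1) sq_int_scaleR[OF assms(2), of "- 1"]] by (simp add: sqn_def)

lemma power2_sum4: "(p + q + r + s)\<^sup>2 \<le> 4 * (p\<^sup>2 + q\<^sup>2 + r\<^sup>2 + s\<^sup>2)" for p q r s :: real
proof -
  have "0 \<le> (p - q)\<^sup>2 + (p - r)\<^sup>2 + (p - s)\<^sup>2 + (q - r)\<^sup>2 + (q - s)\<^sup>2 + (r - s)\<^sup>2"
    by (intro add_nonneg_nonneg zero_le_power2)
  then show ?thesis by (simp add: power2_eq_square algebra_simps)
qed

text \<open>Young's inequality from the square of \<open>r s f - g\<close>. The weight s stays free
  so that the last term can be absorbed into a coercive quantity.\<close>

lemma young_inner: "s > 0 \<Longrightarrow> r * (f \<bullet> g) \<le> r\<^sup>2 * s / 2 * (norm f)\<^sup>2 + (norm g)\<^sup>2 / (2 * s)"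
proof -
  assume s: "s > 0"
  have "0 \<le> (norm ((r * s) *\<^sub>R f - g))\<^sup>2" by simp
  also have "\<dots> = (r * s)\<^sup>2 * (norm f)\<^sup>2 - 2 * (r * s) * (f \<bullet> g) + (norm g)\<^sup>2"
    by (simp add: power2_norm_eq_inner inner_diff_left inner_diff_right inner_commute)
      (simp add: power2_eq_square algebra_simps)
  finally have "0 \<le> ((r * s)\<^sup>2 * (norm f)\<^sup>2 - 2 * (r * s) * (f \<bullet> g) + (norm g)\<^sup>2) / (2 * s)"
    using s by simp
  also have "\<dots> = r\<^sup>2 * s / 2 * (norm f)\<^sup>2 - r * (f \<bullet> g) + (norm g)\<^sup>2 / (2 * s)"
    using s by (simp add: field_simps power2_eq_square)
  finally show ?thesis by simp
qed

text \<open>One bound for both multiplications that depends on the dimension alone; the type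
  argument records that no element is involved.\<close>

definition ext_bound :: "'n::{finite,linorder} itself \<Rightarrow> real \<Rightarrow> bool"
  where "ext_bound _ K \<longleftrightarrow> K \<ge> 1 \<and>
    (\<forall>(v :: 'n point) w. norm (emul v w) \<le> K * norm v * norm w \<and> norm (imul v w) \<le> K * norm v * norm w)"

lemma ext_bound_exists: "\<exists>K. ext_bound TYPE('n::{finite,linorder}) K"
proof -
  obtain K1 where K1: "\<And>(v :: 'n point) w. norm (emul v w) \<le> norm v * norm w * K1"
    using emul.pos_bounded by blast
  obtain K2 where K2: "\<And>(v :: 'n point) w. norm (imul v w) \<le> norm v * norm w * K2"
    using imul.pos_bounded by blast
  define K where "K = max 1 (max K1 K2)"
  have "norm (emul v w) \<le> K * norm v * norm w" "norm (imul v w) \<le> K * norm v * norm w" for v :: "'n point" and w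
    using order_trans[OF K1[of v w] mult_left_mono[of K1 K "norm v * norm w"]]
      order_trans[OF K2[of v w] mult_left_mono[of K2 K "norm v * norm w"]]
    by (auto simp: K_def mult_ac)
  then show ?thesis by (auto simp: ext_bound_def K_def intro!: exI[of _ K])
qed

text \<open>The two recurring fractions are the quantities \<open>Ec\<close> and \<open>D\<close> of
  \<open>local_estimate\<close>. The total is chosen to dominate each of the three coefficients that
  end up in front of the squared data norms there.\<close>

definition est_const :: "real \<Rightarrow> real \<Rightarrow> real \<Rightarrow> real \<Rightarrow> real"
  where "est_const n K \<gamma> H = 8 + 12 * (K\<^sup>2 * H\<^sup>2) + 2 * (n\<^sup>2 * K ^ 4 * H\<^sup>2 / \<gamma>)
    + 4 * (n\<^sup>2 * K ^ 4 * H\<^sup>2 / \<gamma>) * (n\<^sup>2 * K\<^sup>2 / (2 * \<gamma>)) + 8 * (n\<^sup>2 * K\<^sup>2 / (2 * \<gamma>))"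

context bounded_open
begin

lemma sqn_const: "sqn U (\<lambda>x. c) = measure lebesgue U * (norm c)\<^sup>2"
  using integral_const[of "(norm c)\<^sup>2"] by (simp add: sqn_def)

lemma sqn_AE:
  assumes "sq_int U f" "sq_int U g" "AE x in lebesgue. x \<in> U \<longrightarrow> f x = g x"
  shows "sqn U f = sqn U (g :: 'n dform)"
  using L2_inner_AE(1)[OF assms(1,2,1,3)] L2_inner_AE(2)[OF assms(1,2,2,3)]
  by (simp add: sqn_def L2_inner_def power2_norm_eq_inner)

end

section \<open>Bounds for the coefficients of a local form by its data\<close>

context cell
begin

lemma M_bounds: "0 \<le> M b" "M b \<le> h\<^sup>2"
proof -
  have s: "sq_int U (\<lambda>x. x $ b - z $ b)" by (intro sq_int_continuous continuous_intros)
  then have i: "set_integrable lebesgue U (\<lambda>x. (x $ b - z $ b)\<^sup>2)"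
    by (simp add: sq_int_def)
  have "0 \<le> (LINT x:U|lebesgue. (x $ b - z $ b)\<^sup>2)"
    by (simp add: set_lebesgue_integral_def)
  then show "0 \<le> M b"
    using M[of b] measure_pos by (simp add: zero_le_mult_iff)
  have "(LINT x:U|lebesgue. (x $ b - z $ b)\<^sup>2) \<le> (LINT x:U|lebesgue. h\<^sup>2)"
  proof (intro set_integral_mono i const_integrable)
    fix x assume "x \<in> U"
    then have "\<bar>x $ b - z $ b\<bar> \<le> h"
      using component_le_norm_cart[of "x - z" b] h(2)[of x] by simp
    then show "(x $ b - z $ b)\<^sup>2 \<le> h\<^sup>2" by (rule abs_le_square_iff[THEN iffD1, OF order_trans[OF _ abs_ge_self]])
  qed
  then show "M b \<le> h\<^sup>2"
    using M[of b] measure_pos integral_const[of "h\<^sup>2"] by simp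
qed

lemma norm_quad:
  assumes K: "ext_bound TYPE('n) K" and x: "x \<in> U"
  shows "norm (quad c x) \<le> real CARD('n) * (K\<^sup>2 * h\<^sup>2 * norm c)"
proof -
  have K': "K \<ge> 1" "\<And>(v :: 'n point) w. norm (emul v w) \<le> K * norm v * norm w"
     "\<And>(v :: 'n point) w. norm (imul v w) \<le> K * norm v * norm w"
    using K by (auto simp: ext_bound_def)
  have "norm (((x $ b - z $ b)\<^sup>2 - M b) *\<^sub>R imul (axis b 1) (emul (axis b 1) c)) \<le> K\<^sup>2 * h\<^sup>2 * norm c" for b
  proof -
    have "\<bar>x $ b - z $ b\<bar> \<le> h"
      using component_le_norm_cart[of "x - z" b] h(2)[OF x] by simp
    then have "(x $ b - z $ b)\<^sup>2 \<le> h\<^sup>2" by (rule abs_le_square_iff[THEN iffD1, OF order_trans[OF _ abs_ge_self]])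
    then have 1: "\<bar>(x $ b - z $ b)\<^sup>2 - M b\<bar> \<le> h\<^sup>2"
      using M_bounds[of b] zero_le_power2[of "x $ b - z $ b"] by (intro abs_leI) linarith+
    have "norm (imul (axis b 1) (emul (axis b 1) c)) \<le> K * norm (emul (axis b 1) c)"
      using K'(3)[of "axis b 1"] by (simp add: norm_axis_1)
    also have "\<dots> \<le> K * (K * norm c)"
      using K'(2)[of "axis b 1" c] K'(1) by (intro mult_left_mono) (simp_all add: norm_axis_1)
    finally have 2: "norm (imul (axis b 1) (emul (axis b 1) c)) \<le> K\<^sup>2 * norm c"
      by (simp add: power2_eq_square mult_ac)
    show ?thesis
      using mult_mono[OF 1 2] by (simp add: mult_ac)
  qed
  from sum_norm_le[of UNIV, OF this] show ?thesis by (simp add: quad_def)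
qed

text \<open>The moment equations bound a, b and w directly. For c it suffices to bound
  \<open>Y\<close>, the squared norm of \<open>X \<and> c\<close>: coercivity converts this into a
  bound of c, and no inverse of \<open>gram\<close> has to be estimated.\<close>

lemma local_estimate:
  assumes K: "ext_bound TYPE('n) K" and H: "h \<le> H"
    and A: "w \<in> Alt k" "a \<in> Alt (k + 1)" "b \<in> Alt (k - 1)" "c \<in> Alt k"
    and f: "sq_int U f0" "sq_int U f1" "sq_int U f2"
    and mom: "same_moments (pform w a b c) (pform_d a c) (pform_delta b) f0 f1 f2"
  shows "sqn U (pform w a b c) + sqn U (pform_d a c) + sqn U (pform_delta b)
    \<le> est_const (real CARD('n)) K \<gamma> H * (sqn U f0 + sqn U f1 + sqn U f2)"
proof -
  have K': "K \<ge> 1" "\<And>(v :: 'n point) w. norm (emul v w) \<le> K * norm v * norm w"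
     "\<And>(v :: 'n point) w. norm (imul v w) \<le> K * norm v * norm w"
    using K by (auto simp: ext_bound_def)
  have X: "norm (emul (x - z) w) \<le> K * h * norm w" "norm (imul (x - z) w) \<le> K * h * norm w" if "x \<in> U" for x w
  proof -
    have "K * norm (x - z) * norm w \<le> K * h * norm w"
      using h(2)[OF that] K'(1) by (intro mult_right_mono mult_left_mono) auto
    then show "norm (emul (x - z) w) \<le> K * h * norm w" "norm (imul (x - z) w) \<le> K * h * norm w"
      using K'(2,3)[of "x - z" w] by linarith+
  qed
  define n where "n = real CARD('n)"
  define D where "D = n\<^sup>2 * K\<^sup>2 / (2 * \<gamma>)"
  define F0 F1 F2 where "F0 = sqn U f0" and "F1 = sqn U f1" and "F2 = sqn U f2"
  define Y where "Y = sqn U (\<lambda>x. emul (x - z) c)"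
  have m: "m > 0" by (rule measure_pos)
  have F: "F0 \<ge> 0" "F1 \<ge> 0" "F2 \<ge> 0" "Y \<ge> 0" by (simp_all add: F0_def F1_def F2_def Y_def sqn_nonneg)
  have hH: "h\<^sup>2 \<le> H\<^sup>2" using h(1) H by (intro power_mono) auto
  have rk: "real k \<ge> 1" "real (CARD('n) - k) \<ge> 1" "real (CARD('n) - k) \<le> n" "real k \<le> n"
    using k by (auto simp: n_def)
  have M1: "(real (k + 1) * m) *\<^sub>R a = (LINT x:U|lebesgue. f1 x)"
    and M2: "2 *\<^sub>R gram c + (real (CARD('n) - k) * m) *\<^sub>R w = mom2 f0 f1"
    and M3: "- ((real (CARD('n) - k + 1) * m) *\<^sub>R b) = (LINT x:U|lebesgue. f2 x)"
    and M4: "- ((real k * m) *\<^sub>R w) = mom4 f0 f2"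
    using mom by (simp_all only: same_moments_def pform_moments)
  have sqi: "sq_int U (\<lambda>x. emul (x - z) (f2 x))" "sq_int U (\<lambda>x. imul (x - z) (f1 x))"
    using sq_int_moments f by auto
  have E2: "sqn U (\<lambda>x. emul (x - z) (f2 x)) \<le> K\<^sup>2 * h\<^sup>2 * F2"
  proof -
    have "sqn U (\<lambda>x. emul (x - z) (f2 x)) \<le> (LINT x:U|lebesgue. (K\<^sup>2 * h\<^sup>2) * (norm (f2 x))\<^sup>2)"
    proof (intro sqn_mono sqi)
      fix x assume "x \<in> U"
      from power_mono[OF X(1)[OF this, of "f2 x"] norm_ge_zero, of 2]
      show "(norm (emul (x - z) (f2 x)))\<^sup>2 \<le> (K\<^sup>2 * h\<^sup>2) * (norm (f2 x))\<^sup>2"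
        by (simp add: power_mult_distrib)
    qed (use f in \<open>auto simp: sq_int_def\<close>)
    then show ?thesis by (simp add: F2_def sqn_def)
  qed
  \<comment> \<open>Shared by a and b, whose equations have the same form. The version with the
    square of the factor serves the norms of dp and \<delta>p, the other one the norm of p.\<close>
  have moment: "m * (c\<^sup>2 * (norm v)\<^sup>2) \<le> sqn U f" "1 \<le> c \<Longrightarrow> m * (norm v)\<^sup>2 \<le> sqn U f"
    if v: "(c * m) *\<^sub>R v = (LINT x:U|lebesgue. f x)" and f: "sq_int U f" for c v and f :: "'n dform"
  proof -
    have "m * (m * (c\<^sup>2 * (norm v)\<^sup>2)) = (norm ((c * m) *\<^sub>R v))\<^sup>2"
      using m by (simp add: power_mult_distrib power2_eq_square)
    also have "\<dots> \<le> m * sqn U f" unfolding v sqn_def by (rule norm_integral_le[OF f m])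
    finally show 1: "m * (c\<^sup>2 * (norm v)\<^sup>2) \<le> sqn U f" using m by simp
    assume "1 \<le> c"
    then have "1 * (norm v)\<^sup>2 \<le> c\<^sup>2 * (norm v)\<^sup>2" by (intro mult_right_mono one_le_power) auto
    then have "m * (norm v)\<^sup>2 \<le> m * (c\<^sup>2 * (norm v)\<^sup>2)" using m by (intro mult_left_mono) auto
    then show "m * (norm v)\<^sup>2 \<le> sqn U f" using 1 by linarith
  qed
  have M3': "(real (CARD('n) - k + 1) * m) *\<^sub>R (- b) = (LINT x:U|lebesgue. f2 x)"
    using M3 by simp
  note a = moment[OF M1 f(2), folded F1_def] and b = moment[OF M3' f(3), folded F2_def, unfolded norm_minus_cancel]
  \<comment> \<open>In the fourth equation w and the integral of f0 carry the same factor k.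
    Division by \<open>k\<^sup>2\<close>, which is at least 1, therefore preserves the f0 term and
    can only shrink the f2 term.\<close>
  have w: "m * (norm w)\<^sup>2 \<le> 2 * F0 + 2 * (K\<^sup>2 * h\<^sup>2 * F2)"
  proof -
    have "(real k)\<^sup>2 * (m * (m * (norm w)\<^sup>2)) = (norm (mom4 f0 f2))\<^sup>2"
      unfolding M4[symmetric] using m by (simp add: power_mult_distrib power2_eq_square)
    also have "\<dots> \<le> 2 * (norm (LINT x:U|lebesgue. emul (x - z) (f2 x)))\<^sup>2 + 2 * (norm (- real k *\<^sub>R (LINT x:U|lebesgue. f0 x)))\<^sup>2"
      unfolding mom4_def diff_conv_add_uminus scaleR_minus_left[symmetric] by (rule norm_add_square)
    also have "\<dots> \<le> 2 * (m * (K\<^sup>2 * h\<^sup>2 * F2)) + 2 * ((real k)\<^sup>2 * (m * F0))"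
    proof -
      have "(norm (LINT x:U|lebesgue. emul (x - z) (f2 x)))\<^sup>2 \<le> m * sqn U (\<lambda>x. emul (x - z) (f2 x))"
        unfolding sqn_def by (rule norm_integral_le[OF sqi(1) m])
      also have "\<dots> \<le> m * (K\<^sup>2 * h\<^sup>2 * F2)" using E2 m by simp
      finally have 1: "(norm (LINT x:U|lebesgue. emul (x - z) (f2 x)))\<^sup>2 \<le> m * (K\<^sup>2 * h\<^sup>2 * F2)" .
      have "(norm (LINT x:U|lebesgue. f0 x))\<^sup>2 \<le> m * F0"
        unfolding F0_def sqn_def by (rule norm_integral_le[OF f(1) m])
      then have "(norm (- real k *\<^sub>R (LINT x:U|lebesgue. f0 x)))\<^sup>2 \<le> (real k)\<^sup>2 * (m * F0)"
        by (simp add: power_mult_distrib mult_left_mono)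
      with 1 show ?thesis by linarith
    qed
    also have "\<dots> \<le> (real k)\<^sup>2 * (m * (2 * F0 + 2 * (K\<^sup>2 * h\<^sup>2 * F2)))"
    proof -
      have "1 * (m * (K\<^sup>2 * h\<^sup>2 * F2)) \<le> (real k)\<^sup>2 * (m * (K\<^sup>2 * h\<^sup>2 * F2))"
        using rk(1) m F by (intro mult_right_mono) (auto simp: one_le_power)
      then show ?thesis by (simp add: algebra_simps)
    qed
    finally show ?thesis using rk(1) m by simp
  qed
  define r where "r = real (CARD('n) - k) / real k"
  have r: "0 \<le> r" "r \<le> n"
  proof -
    have "n * 1 \<le> n * real k" using rk by (intro mult_left_mono) auto
    then have "real (CARD('n) - k) \<le> n * real k" using rk(3) by linarith
    moreover have "real k > 0" using rk(1) by linarith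
    ultimately show "r \<le> n" unfolding r_def by (simp only: pos_divide_le_eq)
  qed (simp add: r_def)
  have sc: "sq_int U (\<lambda>x. emul (x - z) c)" "sq_int U (\<lambda>x. imul (x - z) c)"
    by (intro sq_int_continuous continuous_intros imul.continuous_on emul.continuous_on)+
  have cY: "\<gamma> * h\<^sup>2 * m * (norm c)\<^sup>2 \<le> Y"
    using coercive[OF A(4)] by (simp add: Y_def sqn_def)
  have Y: "Y \<le> F1 / 2 + D * F2"
  proof -
    \<comment> \<open>Here w is eliminated by the fourth equation. The integrals of f0 in
      \<open>mom2\<close> and \<open>mom4\<close> have the factors n - k and - k, and the
      multipliers k and n - k make them cancel.\<close>
    have "real k *\<^sub>R (2 *\<^sub>R gram c) = real k *\<^sub>R mom2 f0 f1 - real (CARD('n) - k) *\<^sub>R ((real k * m) *\<^sub>R w)"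
      unfolding M2[symmetric] by (simp add: scaleR_add_right mult_ac)
    also have "(real k * m) *\<^sub>R w = - mom4 f0 f2" unfolding M4[symmetric] by simp
    finally have "real k *\<^sub>R (2 *\<^sub>R gram c) = real k *\<^sub>R (LINT x:U|lebesgue. imul (x - z) (f1 x)) + real (CARD('n) - k) *\<^sub>R (LINT x:U|lebesgue. emul (x - z) (f2 x))"
      by (simp add: mom2_def mom4_def algebra_simps)
    then have "(1 / real k) *\<^sub>R (real k *\<^sub>R (2 *\<^sub>R gram c)) =
        (1 / real k) *\<^sub>R (real k *\<^sub>R (LINT x:U|lebesgue. imul (x - z) (f1 x)) + real (CARD('n) - k) *\<^sub>R (LINT x:U|lebesgue. emul (x - z) (f2 x)))"
      by simp
    then have G: "2 *\<^sub>R gram c = (LINT x:U|lebesgue. imul (x - z) (f1 x)) + r *\<^sub>R (LINT x:U|lebesgue. emul (x - z) (f2 x))"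
      using k by (simp add: scaleR_add_right r_def)
    have "2 * Y = c \<bullet> (2 *\<^sub>R gram c)"
      using gram_inner[of c] by (simp add: Y_def sqn_def)
    also have "\<dots> = (LINT x:U|lebesgue. imul (x - z) (f1 x)) \<bullet> c + r * ((LINT x:U|lebesgue. emul (x - z) (f2 x)) \<bullet> c)"
      unfolding G by (simp add: inner_add_right inner_commute)
    also have "(LINT x:U|lebesgue. imul (x - z) (f1 x)) \<bullet> c = (LINT x:U|lebesgue. f1 x \<bullet> emul (x - z) c)"
      unfolding integral_inner_const[OF sqi(2), symmetric]
      by (intro set_integral_cong_on) (metis inner_commute inner_emul)
    also have "(LINT x:U|lebesgue. emul (x - z) (f2 x)) \<bullet> c = (LINT x:U|lebesgue. f2 x \<bullet> imul (x - z) c)"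
      unfolding integral_inner_const[OF sqi(1), symmetric] inner_emul ..
    \<comment> \<open>Each of the two inner products is allowed Y / 2, so one of the two copies of Y
      on the left remains.\<close>
    also have "(LINT x:U|lebesgue. f1 x \<bullet> emul (x - z) c) \<le> F1 / 2 + Y / 2"
    proof -
      have "(LINT x:U|lebesgue. f1 x \<bullet> emul (x - z) c) \<le> (LINT x:U|lebesgue. 1 / 2 * (norm (f1 x))\<^sup>2 + 1 / 2 * (norm (emul (x - z) c))\<^sup>2)"
      proof (intro set_integral_mono sq_int_inner f sc)
        show "f1 x \<bullet> emul (x - z) c \<le> 1 / 2 * (norm (f1 x))\<^sup>2 + 1 / 2 * (norm (emul (x - z) c))\<^sup>2" for x
          using young_inner[of 1 1 "f1 x" "emul (x - z) c"] by simp
      qed (use f sc in \<open>auto simp: sq_int_def intro!: set_integral_add(1)\<close>)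
      also have "\<dots> = 1 / 2 * F1 + 1 / 2 * Y"
        using f sc by (subst set_integral_add(2)) (auto simp: sq_int_def F1_def Y_def sqn_def)
      finally show ?thesis by simp
    qed
    also have "r * (LINT x:U|lebesgue. f2 x \<bullet> imul (x - z) c) \<le> D * F2 + Y / 2"
    proof -
      \<comment> \<open>This weight turns \<open>(K h |c|)\<^sup>2 / (2 s)\<close> into
        \<open>\<gamma> h\<^sup>2 |c|\<^sup>2 / 2\<close>, whose integral is at most Y / 2 by
        coercivity.\<close>
      define s where "s = K\<^sup>2 / \<gamma>"
      have s: "s > 0" using K'(1) \<gamma> by (simp add: s_def)
      have "r * (LINT x:U|lebesgue. f2 x \<bullet> imul (x - z) c) = (LINT x:U|lebesgue. r * (f2 x \<bullet> imul (x - z) c))"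
        by simp
      also have "\<dots> \<le> (LINT x:U|lebesgue. D * (norm (f2 x))\<^sup>2 + \<gamma> * h\<^sup>2 * (norm c)\<^sup>2 / 2)"
      proof (intro set_integral_mono set_integrable_mult_right sq_int_inner f sc)
        fix x assume x: "x \<in> U"
        have "r * (f2 x \<bullet> imul (x - z) c) \<le> r\<^sup>2 * s / 2 * (norm (f2 x))\<^sup>2 + (norm (imul (x - z) c))\<^sup>2 / (2 * s)"
          by (rule young_inner[OF s])
        also have "r\<^sup>2 * s / 2 * (norm (f2 x))\<^sup>2 \<le> D * (norm (f2 x))\<^sup>2"
        proof (intro mult_right_mono)
          have "r\<^sup>2 * s \<le> n\<^sup>2 * s" using r s by (intro mult_right_mono power_mono) auto
          then show "r\<^sup>2 * s / 2 \<le> D" by (simp add: D_def s_def field_simps)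
        qed simp
        also have "(norm (imul (x - z) c))\<^sup>2 / (2 * s) \<le> (K * h * norm c)\<^sup>2 / (2 * s)"
          using s by (intro divide_right_mono power_mono X(2)[OF x]) auto
        also have "\<dots> = \<gamma> * h\<^sup>2 * (norm c)\<^sup>2 / 2"
          using K'(1) \<gamma> by (simp add: s_def field_simps power2_eq_square)
        finally show "r * (f2 x \<bullet> imul (x - z) c) \<le> D * (norm (f2 x))\<^sup>2 + \<gamma> * h\<^sup>2 * (norm c)\<^sup>2 / 2" by simp
      qed (use f in \<open>auto simp: sq_int_def intro!: set_integral_add(1) const_integrable\<close>)
      also have "\<dots> = D * F2 + m * (\<gamma> * h\<^sup>2 * (norm c)\<^sup>2 / 2)"
        using f const_integrable[of "\<gamma> * h\<^sup>2 * (norm c)\<^sup>2 / 2"] integral_const[of "\<gamma> * h\<^sup>2 * (norm c)\<^sup>2 / 2"]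
        by (subst set_integral_add(2)) (auto simp: sq_int_def F2_def sqn_def)
      also have "m * (\<gamma> * h\<^sup>2 * (norm c)\<^sup>2 / 2) \<le> Y / 2" using cY by (simp add: mult_ac)
      finally show ?thesis by simp
    qed
    finally show ?thesis by simp
  qed
  have Nd: "sqn U (pform_d a c) \<le> 2 * F1 + 8 * Y"
  proof -
    have "sqn U (pform_d a c) \<le> 2 * sqn U (\<lambda>x. real (k + 1) *\<^sub>R a) + 2 * sqn U (\<lambda>x. 2 *\<^sub>R emul (x - z) c)"
      unfolding pform_d_def[abs_def] by (rule sqn_add[OF sq_int_const sq_int_scaleR[OF sc(1)]])
    also have "sqn U (\<lambda>x. real (k + 1) *\<^sub>R a) \<le> F1"
      using a(1) unfolding sqn_const by (simp add: power_mult_distrib)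
    also have "sqn U (\<lambda>x. 2 *\<^sub>R emul (x - z) c) = 4 * Y"
      by (simp add: sqn_def Y_def power_mult_distrib)
    finally show ?thesis by simp
  qed
  have Ndelta: "sqn U (pform_delta b) \<le> F2"
    using b(1) unfolding pform_delta_def[abs_def] sqn_const by (simp add: power_mult_distrib)
  define Ec where "Ec = n\<^sup>2 * K ^ 4 * H\<^sup>2 / \<gamma>"
  have N: "sqn U (pform w a b c) \<le> 4 * ((2 * F0 + 2 * (K\<^sup>2 * H\<^sup>2 * F2)) + K\<^sup>2 * H\<^sup>2 * F1 + K\<^sup>2 * H\<^sup>2 * F2 + Ec * Y)"
  proof -
    have "sqn U (pform w a b c) \<le> (LINT x:U|lebesgue. 4 * ((norm w)\<^sup>2 + (K * h * norm a)\<^sup>2 + (K * h * norm b)\<^sup>2 + (n * (K\<^sup>2 * h\<^sup>2 * norm c))\<^sup>2))"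
    proof (intro sqn_mono const_integrable sq_int_continuous continuous_pform)
      fix x assume x: "x \<in> U"
      have "norm (pform w a b c x) \<le> norm w + norm (imul (x - z) a) + norm (emul (x - z) b) + norm (quad c x)"
        unfolding pform_def by (intro order_trans[OF norm_triangle_ineq] add_right_mono) auto
      also have "\<dots> \<le> norm w + K * h * norm a + K * h * norm b + n * (K\<^sup>2 * h\<^sup>2 * norm c)"
        using X[OF x] norm_quad[OF K x, of c] unfolding n_def by (intro add_mono) auto
      finally show "(norm (pform w a b c x))\<^sup>2 \<le> 4 * ((norm w)\<^sup>2 + (K * h * norm a)\<^sup>2 + (K * h * norm b)\<^sup>2 + (n * (K\<^sup>2 * h\<^sup>2 * norm c))\<^sup>2)"
        by (intro order_trans[OF power_mono power2_sum4]) auto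
    qed
    \<comment> \<open>The quadratic part is of order \<open>h\<^sup>4 |c|\<^sup>2\<close>. Two
      powers go into the expression that coercivity bounds by Y, the other two are bounded by
      \<open>H\<^sup>2\<close>.\<close>
    also have "\<dots> = 4 * (m * (norm w)\<^sup>2 + (K\<^sup>2 * h\<^sup>2) * (m * (norm a)\<^sup>2) + (K\<^sup>2 * h\<^sup>2) * (m * (norm b)\<^sup>2) + (n\<^sup>2 * K ^ 4 * h\<^sup>2 / \<gamma>) * (\<gamma> * h\<^sup>2 * m * (norm c)\<^sup>2))"
      using \<gamma> unfolding integral_const by (simp add: power_mult_distrib algebra_simps flip: power_mult)
    also have "\<dots> \<le> 4 * ((2 * F0 + 2 * (K\<^sup>2 * H\<^sup>2 * F2)) + K\<^sup>2 * H\<^sup>2 * F1 + K\<^sup>2 * H\<^sup>2 * F2 + Ec * Y)"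
    proof -
      have KH: "K\<^sup>2 * h\<^sup>2 \<le> K\<^sup>2 * H\<^sup>2" using hH by (intro mult_left_mono) auto
      have "m * (norm a)\<^sup>2 \<le> F1" using a(2) by simp
      then have 1: "(K\<^sup>2 * h\<^sup>2) * (m * (norm a)\<^sup>2) \<le> K\<^sup>2 * H\<^sup>2 * F1"
        by (rule mult_mono[OF KH]) (use m in simp_all)
      have "m * (norm b)\<^sup>2 \<le> F2" using b(2) by simp
      then have 2: "(K\<^sup>2 * h\<^sup>2) * (m * (norm b)\<^sup>2) \<le> K\<^sup>2 * H\<^sup>2 * F2"
        by (rule mult_mono[OF KH]) (use m in simp_all)
      have 3: "(n\<^sup>2 * K ^ 4 * h\<^sup>2 / \<gamma>) * (\<gamma> * h\<^sup>2 * m * (norm c)\<^sup>2) \<le> Ec * Y"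
      proof (rule mult_mono[OF _ cY])
        show "n\<^sup>2 * K ^ 4 * h\<^sup>2 / \<gamma> \<le> Ec"
          unfolding Ec_def using hH \<gamma> by (intro divide_right_mono mult_left_mono) auto
        show "0 \<le> Ec" "0 \<le> \<gamma> * h\<^sup>2 * m * (norm c)\<^sup>2"
          unfolding Ec_def using \<gamma> m by simp_all
      qed
      have 4: "K\<^sup>2 * h\<^sup>2 * F2 \<le> K\<^sup>2 * H\<^sup>2 * F2" using KH F by (intro mult_right_mono) auto
      have "m * (norm w)\<^sup>2 \<le> 2 * F0 + 2 * (K\<^sup>2 * H\<^sup>2 * F2)" using w 4 by linarith
      from add_mono[OF add_mono[OF add_mono[OF this 1] 2] 3] show ?thesis
        by (rule mult_left_mono) simp
    qed
    finally show ?thesis .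
  qed
  have Ec: "Ec \<ge> 0" "D \<ge> 0" "K\<^sup>2 * H\<^sup>2 \<ge> 0" using \<gamma> by (auto simp: Ec_def D_def)
  have EY: "Ec * Y \<le> Ec * (F1 / 2 + D * F2)" by (rule mult_left_mono[OF Y Ec(1)])
  have est: "est_const n K \<gamma> H = 8 + 12 * (K\<^sup>2 * H\<^sup>2) + 2 * Ec + 4 * Ec * D + 8 * D"
    by (simp add: est_const_def Ec_def D_def)
  \<comment> \<open>Y is replaced by its bound F1 / 2 + D F2. It occurs with factor 8 in the norm of
    dp and with factor 4 Ec in that of p, whence 8 / 2 + 2 = 6 and 2 Ec in front of F1.\<close>
  have "sqn U (pform w a b c) + sqn U (pform_d a c) + sqn U (pform_delta b)
      \<le> 8 * F0 + (6 + 4 * (K\<^sup>2 * H\<^sup>2) + 2 * Ec) * F1 + (1 + 12 * (K\<^sup>2 * H\<^sup>2) + 4 * Ec * D + 8 * D) * F2"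
    using N Nd Ndelta EY Y by (simp add: algebra_simps)
  also have "\<dots> \<le> est_const n K \<gamma> H * F0 + est_const n K \<gamma> H * F1 + est_const n K \<gamma> H * F2"
  proof -
    have ED: "0 \<le> Ec * D" using Ec by simp
    have "8 \<le> est_const n K \<gamma> H" "6 + 4 * (K\<^sup>2 * H\<^sup>2) + 2 * Ec \<le> est_const n K \<gamma> H"
      "1 + 12 * (K\<^sup>2 * H\<^sup>2) + 4 * Ec * D + 8 * D \<le> est_const n K \<gamma> H"
      unfolding est using Ec ED by linarith+
    then show ?thesis using F by (intro add_mono) (auto intro: mult_right_mono)
  qed
  finally show ?thesis
    by (simp add: n_def F0_def F1_def F2_def distrib_left)
qed

end

section \<open>Identification of the local space, and quasi-optimality on one element\<close>

lemma bex_form_sum: "(\<exists>p\<in>A \<oplus>\<^sub>f B. P p) \<longleftrightarrow> (\<exists>p\<in>A. \<exists>q\<in>B. P (\<lambda>x. p x + q x))"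
  unfolding form_sum_def by blast

lemma bex_range: "(\<exists>p\<in>{f a |a. a \<in> A}. P p) \<longleftrightarrow> (\<exists>a\<in>A. P (f a))"
  by blast

context cell
begin

lemma quad_nth: "quad c x $ \<beta> = (\<Sum>b\<in>- \<beta>. (x $ b - z $ b)\<^sup>2 - M b) * c $ \<beta>"
proof -
  have "imul (axis b 1) (emul (axis b 1) c) $ \<beta> = (if b \<in> - \<beta> then c $ \<beta> else 0)" for b
    by (auto simp: imul_axis_nth emul_axis_nth)
  then have "quad c x $ \<beta> = (\<Sum>b\<in>UNIV. if b \<in> - \<beta> then ((x $ b - z $ b)\<^sup>2 - M b) * c $ \<beta> else 0)"
    unfolding quad_def sum_component by (intro sum.cong) auto
  also have "\<dots> = (\<Sum>b\<in>- \<beta>. ((x $ b - z $ b)\<^sup>2 - M b) * c $ \<beta>)"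
    by (simp add: sum.If_cases Compl_eq)
  finally show ?thesis by (simp add: sum_distrib_right)
qed

lemma H2_d_eq:
  assumes "centroid T = z" "\<And>b. mean T (\<lambda>y. (y $ b - z $ b)\<^sup>2) = M b"
  shows "H2_d T k = {quad c |c. c \<in> Alt k}"
proof -
  have eq: "(\<lambda>x. \<Sum>\<alpha> | card \<alpha> = k. a \<alpha> *\<^sub>R mu_d T \<alpha> x) = quad (\<chi> \<alpha>. if card \<alpha> = k then a \<alpha> else 0)" for a
  proof (intro ext, subst vec_eq_iff, intro allI)
    fix x \<beta>
    have "(\<Sum>\<alpha> | card \<alpha> = k. a \<alpha> *\<^sub>R mu_d T \<alpha> x) $ \<beta> =
        (\<Sum>\<alpha> | card \<alpha> = k. if \<alpha> = \<beta> then (\<Sum>b\<in>- \<beta>. (x $ b - z $ b)\<^sup>2 - M b) * a \<beta> else 0)"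
      unfolding sum_component by (intro sum.cong refl) (auto simp: mu_d_def dx_def axis_def assms)
    then show "(\<Sum>\<alpha> | card \<alpha> = k. a \<alpha> *\<^sub>R mu_d T \<alpha> x) $ \<beta> = quad (\<chi> \<alpha>. if card \<alpha> = k then a \<alpha> else 0) x $ \<beta>"
      by (simp add: quad_nth)
  qed
  show ?thesis
  proof (intro set_eqI iffI)
    fix \<omega> assume "\<omega> \<in> H2_d T k"
    then obtain a where "\<omega> = quad (\<chi> \<alpha>. if card \<alpha> = k then a \<alpha> else 0)"
      unfolding H2_d_def eq by blast
    then show "\<omega> \<in> {quad c |c. c \<in> Alt k}" by (auto simp: Alt_def)
  next
    fix \<omega> assume "\<omega> \<in> {quad c |c. c \<in> Alt k}"
    then obtain c where c: "c \<in> Alt k" "\<omega> = quad c" by blast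
    then have "c = (\<chi> \<alpha>. if card \<alpha> = k then c $ \<alpha> else 0)" by (simp add: vec_eq_iff Alt_def)
    then show "\<omega> \<in> H2_d T k" unfolding H2_d_def eq using c(2) by (intro CollectI exI[of _ "\<lambda>\<alpha>. c $ \<alpha>"]) simp
  qed
qed

lemma P_local_eq:
  assumes "centroid T = z" "\<And>b. mean T (\<lambda>y. (y $ b - z $ b)\<^sup>2) = M b"
  shows "P_local T k = pforms"
proof (rule set_eqI)
  fix \<omega>
  have S: "star_koszul_star z k = {\<lambda>x. emul (x - z) v |v. v \<in> Alt (k - 1)}"
    using star_koszul_star_eq[of "k - 1" z] k by simp
  have "\<omega> \<in> P_local T k \<longleftrightarrow> (\<exists>p\<in>P_local T k. \<omega> = p)" by simp
  also have "\<dots> \<longleftrightarrow> (\<exists>w\<in>Alt k. \<exists>a\<in>Alt (k + 1). \<exists>b\<in>Alt (k - 1). \<exists>c\<in>Alt k. \<omega> = (\<lambda>x. w + imul (x - z) a + emul (x - z) b + quad c x))"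
    unfolding P_local_def assms(1) koszul_P0_eq S H2_d_eq[OF assms] bex_form_sum bex_range
    unfolding P0_def bex_range ..
  also have "\<dots> \<longleftrightarrow> \<omega> \<in> pforms"
    unfolding pforms_def pform_def[abs_def] by blast
  finally show "\<omega> \<in> P_local T k \<longleftrightarrow> \<omega> \<in> pforms" .
qed

lemma mom_diff:
  assumes "sq_int U g" "sq_int U g'" "sq_int U f" "sq_int U f'"
  shows "mom2 (\<lambda>x. g x - g' x) (\<lambda>x. f x - f' x) = mom2 g f - mom2 g' f'"
    and "mom4 (\<lambda>x. g x - g' x) (\<lambda>x. f x - f' x) = mom4 g f - mom4 g' f'"
  by (simp_all add: mom2_def mom4_def imul.diff_right emul.diff_right integral_diff assms sq_int_moments algebra_simps)

lemma same_moments_diff: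
  assumes "same_moments g g1 g2 f f1 f2"
    and "sq_int U g" "sq_int U g1" "sq_int U g2" "sq_int U f" "sq_int U f1" "sq_int U f2" "sq_int U p" "sq_int U p1" "sq_int U p2"
  shows "same_moments (\<lambda>x. g x - p x) (\<lambda>x. g1 x - p1 x) (\<lambda>x. g2 x - p2 x) (\<lambda>x. f x - p x) (\<lambda>x. f1 x - p1 x) (\<lambda>x. f2 x - p2 x)"
  using assms unfolding same_moments_def by (simp add: mom_diff integral_diff)

lemma is_delta_sq_int: "is_delta k g g2 \<Longrightarrow> sq_int U g2"
  using is_delta_L2[of k g g2] k by (simp add: L2_forms_iff)

text \<open>The difference between the interpolant and p0 lies in the local space and has the
  moments of \<mu> - p0, so stability applies to it; the triangle inequality in squares gives the
  factors 2. J and \<nu> stand for global functions known on U only, hence the congruence steps. The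
  first four claims supply the square integrability needed when elements are put together.\<close>

lemma cell_estimate:
  assumes T: "interior T = U" "P_local T k = pforms"
    and \<mu>: "is_d k \<mu> \<mu>1" "is_delta k \<mu> \<mu>2"
    and \<nu>: "p0 \<in> pforms" "\<And>x. x \<in> U \<Longrightarrow> \<nu> x = p0 x"
    and J: "\<And>x. x \<in> U \<Longrightarrow> J x = interp_local T k \<mu> x"
    and K: "ext_bound TYPE('n) K" and H: "h \<le> H"
  defines "C \<equiv> 2 + 2 * est_const (real CARD('n)) K \<gamma> H"
  shows "is_d k J (ext_d U k J)" "is_delta k J (codiff U k J)"
    and "is_d k (\<lambda>x. \<mu> x - \<nu> x) (ext_d U k (\<lambda>x. \<mu> x - \<nu> x))"
    and "is_delta k (\<lambda>x. \<mu> x - \<nu> x) (codiff U k (\<lambda>x. \<mu> x - \<nu> x))"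
    and "sqn U (\<lambda>x. \<mu> x - J x) + sqn U (\<lambda>x. \<mu>1 x - ext_d U k J x) + sqn U (\<lambda>x. \<mu>2 x - codiff U k J x)
      \<le> C * (sqn U (\<lambda>x. \<mu> x - \<nu> x) + sqn U (ext_d U k (\<lambda>x. \<mu> x - \<nu> x)) + sqn U (codiff U k (\<lambda>x. \<mu> x - \<nu> x)))"
proof -
  have "interp_local T k \<mu> = (THE p. p \<in> pforms \<and> interp_cond \<mu> p)"
    unfolding interp_local_def interp_cond_def T ..
  with theI'[OF interp_unique[OF \<mu>]] have I: "interp_local T k \<mu> \<in> pforms" "interp_cond \<mu> (interp_local T k \<mu>)"
    by auto
  then obtain w a b c where A: "w \<in> Alt k" "a \<in> Alt (k + 1)" "b \<in> Alt (k - 1)" "c \<in> Alt k"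
    and Ieq: "interp_local T k \<mu> = pform w a b c"
    by (auto simp: pforms_def)
  obtain w' a' b' c' where A': "w' \<in> Alt k" "a' \<in> Alt (k + 1)" "b' \<in> Alt (k - 1)" "c' \<in> Alt k"
    and p0: "p0 = pform w' a' b' c'"
    using \<nu>(1) by (auto simp: pforms_def)
  note P = pform_classical[OF A] and P' = pform_classical[OF A']
  have mom: "same_moments (pform w a b c) (pform_d a c) (pform_delta b) \<mu> \<mu>1 \<mu>2"
    using I(2) unfolding Ieq interp_cond_iff[OF P \<mu>] .
  have s: "sq_int U (pform w a b c)" "sq_int U (pform_d a c)" "sq_int U (pform_delta b)" "sq_int U \<mu>" "sq_int U \<mu>1" "sq_int U \<mu>2"
    "sq_int U (pform w' a' b' c')" "sq_int U (pform_d a' c')" "sq_int U (pform_delta b')"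
    using P P' \<mu> is_delta_sq_int by (auto simp: is_d_def L2_forms_iff)
  have J': "is_d k J (pform_d a c)" "is_delta k J (pform_delta b)"
    by (rule is_d_cong[OF P(1)] is_delta_cong[OF P(2)]; simp add: J Ieq)+
  show Jd: "is_d k J (ext_d U k J)" and Jdelta: "is_delta k J (codiff U k J)"
    by (rule ext_d_spec(1)[OF J'(1)] codiff_spec(1)[OF J'(2)])+
  have E: "is_d k (\<lambda>x. \<mu> x - \<nu> x) (\<lambda>x. \<mu>1 x - pform_d a' c' x)" "is_delta k (\<lambda>x. \<mu> x - \<nu> x) (\<lambda>x. \<mu>2 x - pform_delta b' x)"
    by (rule is_d_cong[OF is_d_diff[OF \<mu>(1) P'(1)]] is_delta_cong[OF is_delta_diff[OF \<mu>(2) P'(2)]]; simp add: \<nu>(2) p0)+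
  show Ed: "is_d k (\<lambda>x. \<mu> x - \<nu> x) (ext_d U k (\<lambda>x. \<mu> x - \<nu> x))"
    and Edelta: "is_delta k (\<lambda>x. \<mu> x - \<nu> x) (codiff U k (\<lambda>x. \<mu> x - \<nu> x))"
    by (rule ext_d_spec(1)[OF E(1)] codiff_spec(1)[OF E(2)])+
  define F0 F1 F2 where "F0 = sqn U (\<lambda>x. \<mu> x - pform w' a' b' c' x)" and "F1 = sqn U (\<lambda>x. \<mu>1 x - pform_d a' c' x)"
    and "F2 = sqn U (\<lambda>x. \<mu>2 x - pform_delta b' x)"
  have "sqn U (\<lambda>x. \<mu> x - \<nu> x) = F0"
    unfolding F0_def sqn_def by (rule set_integral_cong_on) (simp add: \<nu>(2) p0)
  moreover have "sqn U (ext_d U k (\<lambda>x. \<mu> x - \<nu> x)) = F1"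
    unfolding F1_def using Ed s by (intro sqn_AE ext_d_spec(2)[OF E(1)] sq_int_diff) (auto simp: is_d_def L2_forms_iff)
  moreover have "sqn U (codiff U k (\<lambda>x. \<mu> x - \<nu> x)) = F2"
    unfolding F2_def using is_delta_sq_int[OF Edelta] s by (intro sqn_AE codiff_spec(2)[OF E(2)] sq_int_diff)
  moreover define Q0 Q1 Q2 where "Q0 = sqn U (pform (w - w') (a - a') (b - b') (c - c'))"
    and "Q1 = sqn U (pform_d (a - a') (c - c'))" and "Q2 = sqn U (pform_delta (b - b'))"
  have Q: "pform (w - w') (a - a') (b - b') (c - c') = (\<lambda>x. pform w a b c x - pform w' a' b' c' x)"
    "pform_d (a - a') (c - c') = (\<lambda>x. pform_d a c x - pform_d a' c' x)"
    "pform_delta (b - b') = (\<lambda>x. pform_delta b x - pform_delta b' x)"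
    by (simp_all add: fun_eq_iff pform_diff pform_d_def pform_delta_def emul.diff_right scaleR_diff_right)
  have loc: "Q0 + Q1 + Q2 \<le> est_const (real CARD('n)) K \<gamma> H * (F0 + F1 + F2)"
    unfolding Q0_def Q1_def Q2_def F0_def F1_def F2_def
    by (rule local_estimate[OF K H], (intro Alt_diff A A' sq_int_diff s)+)
      (unfold Q, rule same_moments_diff[OF mom s])
  have "sqn U (\<lambda>x. \<mu> x - J x) \<le> 2 * F0 + 2 * Q0"
  proof -
    have "sqn U (\<lambda>x. \<mu> x - J x) = sqn U (\<lambda>x. (\<mu> x - pform w' a' b' c' x) - pform (w - w') (a - a') (b - b') (c - c') x)"
      unfolding sqn_def Q by (rule set_integral_cong_on) (simp add: J Ieq)
    also have "\<dots> \<le> 2 * F0 + 2 * Q0"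
      unfolding F0_def Q0_def Q by (intro sqn_diff sq_int_diff s)
    finally show ?thesis .
  qed
  moreover have "sqn U (\<lambda>x. \<mu>1 x - ext_d U k J x) \<le> 2 * F1 + 2 * Q1"
  proof -
    have "sqn U (\<lambda>x. \<mu>1 x - ext_d U k J x) = sqn U (\<lambda>x. (\<mu>1 x - pform_d a' c' x) - pform_d (a - a') (c - c') x)"
      unfolding Q using Jd s ext_d_spec(2)[OF J'(1)]
      by (intro sqn_AE sq_int_diff) (auto simp: is_d_def L2_forms_iff elim!: eventually_mono)
    also have "\<dots> \<le> 2 * F1 + 2 * Q1"
      unfolding F1_def Q1_def Q by (intro sqn_diff sq_int_diff s)
    finally show ?thesis .
  qed
  moreover have "sqn U (\<lambda>x. \<mu>2 x - codiff U k J x) \<le> 2 * F2 + 2 * Q2"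
  proof -
    have "sqn U (\<lambda>x. \<mu>2 x - codiff U k J x) = sqn U (\<lambda>x. (\<mu>2 x - pform_delta b' x) - pform_delta (b - b') x)"
      unfolding Q using is_delta_sq_int[OF Jdelta] s codiff_spec(2)[OF J'(2)]
      by (intro sqn_AE sq_int_diff) (auto elim!: eventually_mono)
    also have "\<dots> \<le> 2 * F2 + 2 * Q2"
      unfolding F2_def Q2_def Q by (intro sqn_diff sq_int_diff s)
    finally show ?thesis .
  qed
  ultimately show "sqn U (\<lambda>x. \<mu> x - J x) + sqn U (\<lambda>x. \<mu>1 x - ext_d U k J x) + sqn U (\<lambda>x. \<mu>2 x - codiff U k J x)
      \<le> C * (sqn U (\<lambda>x. \<mu> x - \<nu> x) + sqn U (ext_d U k (\<lambda>x. \<mu> x - \<nu> x)) + sqn U (codiff U k (\<lambda>x. \<mu> x - \<nu> x)))"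
    using loc by (simp add: C_def algebra_simps)
qed

end

section \<open>Geometry of simplexes and Lipschitz domains\<close>

lemma sum_norm_emul_axis:
  fixes c :: "('n::{finite,linorder}) extalg"
  assumes "c \<in> Alt k"
  shows "(\<Sum>i\<in>UNIV. (norm (emul (axis i 1) c))\<^sup>2) = (real CARD('n) - real k) * (norm c)\<^sup>2"
proof -
  have "(norm (emul (axis i 1) c))\<^sup>2 = c \<bullet> imul (axis i 1) (emul (axis i 1) c)" for i :: 'n
    by (simp add: power2_norm_eq_inner inner_emul)
  then have "(\<Sum>i\<in>UNIV. (norm (emul (axis i 1) c))\<^sup>2) = c \<bullet> ((real CARD('n) - real k) *\<^sub>R c)"
    by (simp only: sum_imul_emul[OF assms] flip: inner_sum_right)
  then show ?thesis by (simp add: power2_norm_eq_inner)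
qed

text \<open>
  The parallelogram law gives \<open>q (x + t e) + q (x - t e) \<ge> 2 t\<^sup>2 q e\<close> for the quadratic function
  \<open>q v = |v \<and> c|\<^sup>2\<close>, and both translates of the half ball stay inside the ball.
\<close>

lemma emul_coercive_on_ball:
  fixes c :: "('n::{finite,linorder}) extalg"
  assumes U: "bounded_open U" and B: "ball c0 r \<subseteq> U" and r: "r > 0" and c: "c \<in> Alt k" and k: "k < CARD('n)"
  shows "(r / 2)\<^sup>2 * measure lebesgue (ball (0 :: 'n point) (r / 2)) * (norm c)\<^sup>2
    \<le> real CARD('n) * (LINT x:U|lebesgue. (norm (emul (x - z) c))\<^sup>2)"
proof -
  interpret bounded_open U by fact
  define t where "t = r / 2"
  define q where "q x = (norm (emul (x - z) c))\<^sup>2" for x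
  define B0 where "B0 = ball c0 t"
  have t: "t > 0" using r by (simp add: t_def)
  have qc: "continuous_on UNIV q"
    unfolding q_def by (intro continuous_intros emul.continuous_on)
  have qm: "q \<in> borel_measurable borel" by (rule borel_measurable_continuous_onI[OF qc])
  have q0: "q x \<ge> 0" for x by (simp add: q_def)
  have qi: "set_integrable lebesgue U q"
  proof -
    have "sq_int U (\<lambda>x. emul (x - z) c)"
      by (intro sq_int_continuous continuous_intros emul.continuous_on)
    then show ?thesis by (simp add: sq_int_def q_def[abs_def])
  qed
  have mB: "measure lebesgue B0 = measure lebesgue (ball (0 :: 'n point) t)"
    using t by (simp add: B0_def content_ball)
  have mI: "set_integrable lebesgue B0 (\<lambda>x. b)" for b :: real
    unfolding B0_def by (rule bounded_open.const_integrable) (simp add: bounded_open_def)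
  have I: "integral\<^sup>L lborel (\<lambda>x. indicator B0 x * q (v + x)) \<le> (LINT x:U|lebesgue. q x)"
    "integrable lborel (\<lambda>x. indicator B0 x * q (v + x))"
    if v: "norm v \<le> t" for v
  proof -
    have sub: "ball (v + c0) t \<subseteq> U"
    proof -
      have "dist (v + c0) c0 + t \<le> r" using v by (simp add: dist_norm t_def)
      then have "ball (v + c0) t \<subseteq> ball c0 r" by (intro ball_subset_ball_iff[THEN iffD2]) auto
      then show ?thesis using B by blast
    qed
    define F where "F x = indicator (ball (v + c0) t) x * q x" for x
    have Fm: "F \<in> borel_measurable borel"
      unfolding F_def[abs_def] by (intro borel_measurable_times borel_measurable_indicator qm) simp
    have bi: "set_integrable lebesgue (ball (v + c0) t) q"
      by (rule set_integrable_subset[OF qi _ sub]) simp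
    then have "integrable lebesgue F" by (simp add: set_integrable_def F_def[abs_def])
    then have Fi: "integrable lborel F" using Fm by (simp add: integrable_completion)
    have sh: "F (v + x) = indicator B0 x * q (v + x)" for x
      by (simp add: F_def B0_def indicator_def dist_norm algebra_simps)
    show "integrable lborel (\<lambda>x. indicator B0 x * q (v + x))"
      using lborel_integral_translation(2)[OF Fm Fi, of v] by (simp add: sh)
    have "integral\<^sup>L lborel (\<lambda>x. indicator B0 x * q (v + x)) = integral\<^sup>L lborel F"
      using lborel_integral_translation(1)[OF Fm, of v] by (simp add: sh)
    also have "\<dots> = integral\<^sup>L lebesgue F"
      using Fm by (simp add: integral_completion)
    also have "\<dots> \<le> (LINT x:U|lebesgue. q x)"
      unfolding set_lebesgue_integral_def using qi \<open>integrable lebesgue F\<close> sub q0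
      by (intro integral_mono) (auto simp: F_def set_integrable_def indicator_def)
    finally show "integral\<^sup>L lborel (\<lambda>x. indicator B0 x * q (v + x)) \<le> (LINT x:U|lebesgue. q x)" .
  qed
  have key: "t\<^sup>2 * (norm (emul (axis i 1) c))\<^sup>2 * measure lebesgue (ball (0 :: 'n point) t) \<le> (LINT x:U|lebesgue. q x)" for i
  proof -
    define e :: "'n point" where "e = t *\<^sub>R axis i 1"
    have e: "norm e \<le> t" "norm (- e) \<le> t" using t by (auto simp: e_def norm_axis_1)
    have pw: "2 * (t\<^sup>2 * (norm (emul (axis i 1) c))\<^sup>2) \<le> q (e + x) + q (- e + x)" for x
    proof -
      define u where "u = emul (x - z) c"
      define w where "w = emul e c"
      have "q (e + x) = (norm (u + w))\<^sup>2" "q (- e + x) = (norm (u - w))\<^sup>2"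
        by (simp_all add: q_def u_def w_def emul.diff_left emul.add_left emul.minus_left algebra_simps)
      then have "q (e + x) + q (- e + x) = 2 * (norm u)\<^sup>2 + 2 * (norm w)\<^sup>2"
        by (simp add: power2_norm_eq_inner inner_add_left inner_add_right inner_diff_left inner_diff_right)
      moreover have "(norm w)\<^sup>2 = t\<^sup>2 * (norm (emul (axis i 1) c))\<^sup>2"
        by (simp add: w_def e_def emul.scaleR_left power_mult_distrib)
      ultimately show ?thesis by simp
    qed
    have "2 * (t\<^sup>2 * (norm (emul (axis i 1) c))\<^sup>2) * measure lebesgue B0
        = integral\<^sup>L lborel (\<lambda>x. indicator B0 x * (2 * (t\<^sup>2 * (norm (emul (axis i 1) c))\<^sup>2)))"
      by (simp add: B0_def)
    also have "\<dots> \<le> integral\<^sup>L lborel (\<lambda>x. indicator B0 x * q (e + x) + indicator B0 x * q (- e + x))"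
    proof (intro integral_mono Bochner_Integration.integrable_add I(2) e)
      show "integrable lborel (\<lambda>x. indicator B0 x * (2 * (t\<^sup>2 * (norm (emul (axis i 1) c))\<^sup>2)))"
        using emeasure_bounded_finite[OF bounded_ball, of c0 t]
        by (intro integrable_mult_left integrable_real_indicator) (auto simp: B0_def)
      show "indicator B0 x * (2 * (t\<^sup>2 * (norm (emul (axis i 1) c))\<^sup>2)) \<le> indicator B0 x * q (e + x) + indicator B0 x * q (- e + x)" for x
        using pw[of x] by (simp add: indicator_def)
    qed
    also have "\<dots> \<le> 2 * (LINT x:U|lebesgue. q x)"
      using I[OF e(1)] I[OF e(2)] by simp
    finally show ?thesis by (simp add: mB)
  qed
  \<comment> \<open>Summing \<open>key\<close> over all directions yields the factor n - k, which is
    at least 1 because k < n; in top degree \<open>X \<and> c\<close> would vanish.\<close>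
  have "t\<^sup>2 * measure lebesgue (ball (0 :: 'n point) t) * (norm c)\<^sup>2 \<le>
      t\<^sup>2 * measure lebesgue (ball (0 :: 'n point) t) * ((real CARD('n) - real k) * (norm c)\<^sup>2)"
  proof (intro mult_left_mono)
    have "1 * (norm c)\<^sup>2 \<le> (real CARD('n) - real k) * (norm c)\<^sup>2"
      using k by (intro mult_right_mono) auto
    then show "(norm c)\<^sup>2 \<le> (real CARD('n) - real k) * (norm c)\<^sup>2" by simp
  qed simp
  also have "\<dots> = (\<Sum>i\<in>UNIV. t\<^sup>2 * (norm (emul (axis i 1) c))\<^sup>2 * measure lebesgue (ball (0 :: 'n point) t))"
    unfolding sum_norm_emul_axis[OF c, symmetric] by (simp add: sum_distrib_left mult_ac)
  also have "\<dots> \<le> (\<Sum>i\<in>(UNIV :: 'n set). LINT x:U|lebesgue. q x)"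
    by (intro sum_mono key)
  finally show ?thesis by (simp add: t_def q_def)
qed

text \<open>This places the interiors of the elements inside \<Omega>, as restriction of weak
  derivatives requires. An arbitrary open set may have a slit; here, arbitrarily close to a frontier
  point, there are points below the graph with a neighbourhood free of \<Omega>.\<close>

lemma interior_closure_lipschitz_domain:
  assumes "lipschitz_domain \<Omega>" shows "interior (closure \<Omega>) \<subseteq> \<Omega>"
proof
  fix p assume p: "p \<in> interior (closure \<Omega>)"
  show "p \<in> \<Omega>"
  proof (rule ccontr)
    assume np: "p \<notin> \<Omega>"
    have op: "open \<Omega>" using assms by (simp add: lipschitz_domain_def)
    have "p \<in> frontier \<Omega>"
      using p np op interior_subset[of "closure \<Omega>"] by (auto simp: frontier_def interior_open)
    then obtain r e L and g :: "'a point \<Rightarrow> real" where r: "r > 0" and e: "norm e = 1"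
      and g: "L-lipschitz_on {y. y \<bullet> e = 0} g"
      and eq: "\<Omega> \<inter> ball p r = {x \<in> ball p r. g (x - (x \<bullet> e) *\<^sub>R e) < x \<bullet> e}"
      using assms unfolding lipschitz_domain_def by blast
    obtain \<epsilon> where \<epsilon>: "\<epsilon> > 0" "ball p \<epsilon> \<subseteq> closure \<Omega>"
      using p by (auto simp: mem_interior)
    define s where "s = min \<epsilon> r / 2"
    have s: "s > 0" "s < \<epsilon>" "s < r" using \<epsilon> r by (auto simp: s_def)
    \<comment> \<open>Moving p against e keeps its projection and lowers its height strictly below
      the graph, since p itself is not above it.\<close>
    define x where "x = p - s *\<^sub>R e"
    have ee: "e \<bullet> e = 1" using e by (simp add: norm_eq_1)
    have pe: "g (p - (p \<bullet> e) *\<^sub>R e) \<ge> p \<bullet> e"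
      using np eq r by (force simp: not_less)
    have proj: "x - (x \<bullet> e) *\<^sub>R e = p - (p \<bullet> e) *\<^sub>R e"
      by (simp add: x_def inner_diff_left ee algebra_simps)
    have cont: "continuous_on UNIV (\<lambda>y. g (y - (y \<bullet> e) *\<^sub>R e) - y \<bullet> e)"
      by (intro continuous_intros continuous_on_compose2[OF lipschitz_on_continuous_on[OF g]])
        (auto simp: inner_diff_left ee)
    define V where "V = {y. 0 < g (y - (y \<bullet> e) *\<^sub>R e) - y \<bullet> e} \<inter> ball p r"
    have "open V"
      unfolding V_def by (intro open_Int open_Collect_less continuous_intros cont) simp
    moreover have "x \<in> V"
      using pe s unfolding V_def by (simp add: proj) (simp add: x_def inner_diff_left ee dist_norm e)
    moreover have "V \<inter> \<Omega> = {}"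
      using eq unfolding V_def by force
    ultimately have "x \<notin> closure \<Omega>"
      using open_Int_closure_eq_empty by blast
    moreover have "x \<in> ball p \<epsilon>" using s e by (simp add: x_def dist_norm)
    ultimately show False using \<epsilon> by blast
  qed
qed

text \<open>The supremum in \<open>inball_diameter\<close> is approached, not attained, so a factor
  2 is given away: \<open>4 \<sigma>\<close> instead of \<open>2 \<sigma>\<close>. The sign of
  \<sigma> follows from the positivity of both diameters.\<close>

lemma inball_exists:
  fixes T :: "('n::finite) point set"
  assumes T: "bounded T" "interior T \<noteq> {}" and reg: "diameter T \<le> \<sigma> * inball_diameter T"
  shows "0 < diameter T" "0 < \<sigma>" "\<exists>c r. cball c r \<subseteq> T \<and> diameter T / (4 * \<sigma>) < r"
proof -
  let ?S = "{r. 0 \<le> r \<and> (\<exists>c. cball c r \<subseteq> T)}"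
  obtain x where x: "x \<in> interior T" using T(2) by blast
  then obtain \<epsilon> where \<epsilon>: "\<epsilon> > 0" "cball x \<epsilon> \<subseteq> T" by (auto simp: mem_interior_cball)
  have bd: "2 * r \<le> diameter T" if rS: "r \<in> ?S" for r
  proof -
    obtain c where "cball c r \<subseteq> T" "r \<ge> 0" using rS by blast
    then show ?thesis using diameter_subset[of "cball c r" T] T(1) by simp
  qed
  show d: "0 < diameter T" using bd[of \<epsilon>] \<epsilon> by force
  have bdd: "bdd_above ((\<lambda>r. 2 * r) ` ?S)" using bd by (intro bdd_aboveI[of _ "diameter T"]) auto
  have inS: "\<epsilon> \<in> ?S" using \<epsilon> by force
  have "2 * \<epsilon> \<le> inball_diameter T"
    unfolding inball_diameter_def by (rule cSUP_upper[OF inS bdd])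
  then have "inball_diameter T > 0" using \<epsilon> by simp
  then show \<sigma>: "0 < \<sigma>" using d reg by (metis less_le_trans zero_less_mult_pos2)
  have "diameter T / (2 * \<sigma>) < diameter T / \<sigma>" using d \<sigma> by (simp add: field_simps)
  also have "\<dots> \<le> inball_diameter T" using reg \<sigma> by (simp add: pos_divide_le_eq mult.commute)
  finally have "\<exists>r\<in>?S. diameter T / (2 * \<sigma>) < 2 * r"
    unfolding inball_diameter_def using inS by (subst (asm) less_cSUP_iff[OF _ bdd]) auto
  then show "\<exists>c r. cball c r \<subseteq> T \<and> diameter T / (4 * \<sigma>) < r"
    using \<sigma> by (auto simp: field_simps)
qed

section \<open>The global estimate\<close>

text \<open>The constant of \<open>emul_coercive_on_ball\<close> when half the radius exceeds
  \<open>h / (8 \<sigma>)\<close>: n powers come from the volume of the half ball relative to a ball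
  of radius h, two from the displacement, and 1 / n from the sum over directions.\<close>

definition cell_const :: "real \<Rightarrow> nat \<Rightarrow> real"
  where "cell_const \<sigma> n = (1 / (8 * \<sigma>)) ^ (n + 2) / real n"

text \<open>No sign of \<sigma> is prescribed in the final theorem, yet its constant must be
  positive; hence the absolute value.\<close>

lemma est_const_nonneg: "0 \<le> est_const n K (cell_const \<bar>\<sigma>\<bar> d) H"
proof -
  have "0 \<le> cell_const \<bar>\<sigma>\<bar> d" by (simp add: cell_const_def)
  then show ?thesis
    unfolding est_const_def by (intro add_nonneg_nonneg mult_nonneg_nonneg divide_nonneg_nonneg) auto
qed

lemma simplex_interior_nonempty:
  assumes "int CARD('n) simplex (T :: ('n::finite) point set)" shows "interior T \<noteq> {}"
proof -
  have "aff_dim T = int DIM('n point)" using aff_dim_simplex[OF assms] by simp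
  then have "interior T = rel_interior T" by (simp add: interior_rel_interior_gen)
  moreover have "T \<noteq> {}" using assms by auto
  ultimately show ?thesis using convex_simplex[OF assms] by (simp add: rel_interior_eq_empty)
qed

text \<open>\<open>mean\<close> integrates over the closed simplex while forms live on its interior;
  the frontier of a convex set is null.\<close>

lemma set_integral_interior:
  fixes f :: "('n::finite) point \<Rightarrow> 'b::euclidean_space"
  assumes T: "convex T" "closed T" and f: "continuous_on UNIV f"
  shows "(LINT x:T|lebesgue. f x) = (LINT x:interior T|lebesgue. f x)"
  unfolding set_lebesgue_integral_def
proof (rule integral_cong_AE)
  have fm [measurable]: "f \<in> borel_measurable lebesgue"
    using f by (simp add: borel_measurable_continuous_onI measurable_completion)
  have [measurable]: "T \<in> sets lebesgue" "interior T \<in> sets lebesgue" using T(2) by simp_all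
  show "(\<lambda>x. indicator T x *\<^sub>R f x) \<in> borel_measurable lebesgue"
    "(\<lambda>x. indicator (interior T) x *\<^sub>R f x) \<in> borel_measurable lebesgue" by measurable
  have "frontier T \<in> null_sets lebesgue"
    using negligible_convex_frontier[OF T(1)] by (simp add: negligible_iff_null_sets)
  from AE_not_in[OF this] show "AE x in lebesgue. indicator T x *\<^sub>R f x = indicator (interior T) x *\<^sub>R f x"
    by eventually_elim (use interior_subset[of T] closure_subset[of T] in \<open>auto simp: frontier_def indicator_def\<close>)
qed

lemma simplex_cell:
  fixes T :: "('n::{finite,linorder}) point set"
  assumes T: "int CARD('n) simplex T" and reg: "diameter T \<le> \<sigma> * inball_diameter T"
    and k: "1 \<le> k" "k < CARD('n)"
  shows "cell (interior T) k (centroid T) (\<lambda>b. mean T (\<lambda>y. (y $ b - centroid T $ b)\<^sup>2)) (diameter T) (cell_const \<sigma> CARD('n))"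
proof -
  let ?U = "interior T"
  define z where "z = centroid T"
  define h where "h = diameter T"
  have Tb: "bounded T" and Tc: "convex T" "closed T"
    using compact_simplex[OF T] convex_simplex[OF T] by (auto intro: compact_imp_bounded compact_imp_closed)
  have ne: "?U \<noteq> {}" by (rule simplex_interior_nonempty[OF T])
  note inb = inball_exists[OF Tb ne reg]
  interpret bounded_open ?U
    using Tb bounded_subset[OF Tb interior_subset] by (simp add: bounded_open_def)
  define m where "m = measure lebesgue ?U"
  have m: "m > 0"
    using open_not_negligible[OF open_U ne] lmeasurable_U negligible_iff_measure0
    unfolding m_def by (metis measure_nonneg order_less_le)
  have mT: "measure lebesgue T = m"
    using set_integral_interior[OF Tc, of "\<lambda>x. 1 :: real"] lmeasurable_compact[OF compact_simplex[OF T]]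
      set_integral_const[of T lebesgue "1 :: real"] integral_const[of "1 :: real"]
    by (auto simp: m_def fmeasurable_def)
  have mean: "(LINT x:?U|lebesgue. f x) = m * mean T f" if "continuous_on UNIV f" for f :: "'n point \<Rightarrow> real"
    using m by (simp add: mean_def mT set_integral_interior[OF Tc that])
  have sid: "sq_int ?U (\<lambda>x. x)" by (intro sq_int_continuous continuous_intros)
  have int_id: "(LINT x:?U|lebesgue. x) = m *\<^sub>R z"
  proof (subst vec_eq_iff, intro allI)
    fix i
    have "(LINT x:?U|lebesgue. x) $ i = (LINT x:?U|lebesgue. x $ i)"
      by (rule set_integral_bounded_linear(1)[OF bounded_linear_vec_nth sq_int_integrable[OF sid], symmetric])
    also have "\<dots> = (m *\<^sub>R z) $ i"
      by (subst mean) (auto simp: z_def centroid_def intro!: continuous_intros)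
    finally show "(LINT x:?U|lebesgue. x) $ i = (m *\<^sub>R z) $ i" .
  qed
  have centered: "(LINT x:?U|lebesgue. x - z) = 0"
    using integral_diff[OF sid sq_int_const[of z]] by (simp add: int_id integral_const m_def)
  \<comment> \<open>The centroid is an average: x - z is the mean of x - y over y in the interior,
    and each of these vectors has length at most the diameter.\<close>
  have hz: "norm (x - z) \<le> h" if x: "x \<in> ?U" for x
  proof -
    have sx: "sq_int ?U (\<lambda>y. x - y)" by (intro sq_int_continuous continuous_intros)
    have "m *\<^sub>R (x - z) = (LINT y:?U|lebesgue. x - y)"
      using integral_diff[OF sq_int_const[of x] sid] by (simp add: int_id integral_const m_def scaleR_diff_right)
    then have "m * norm (x - z) = norm (LINT y:?U|lebesgue. x - y)"
      using m by (metis abs_of_pos norm_scaleR)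
    also have "\<dots> \<le> (LINT y:?U|lebesgue. norm (x - y))"
      by (rule set_integral_norm_bound[OF sq_int_integrable[OF sx]])
    also have "\<dots> \<le> (LINT y:?U|lebesgue. h)"
    proof (intro set_integral_mono const_integrable)
      show "set_integrable lebesgue ?U (\<lambda>y. norm (x - y))"
        by (rule set_integrable_norm[OF sq_int_integrable[OF sx]])
      fix y assume "y \<in> ?U"
      then show "norm (x - y) \<le> h"
        using diameter_bounded_bound[OF Tb, of x y] x interior_subset[of T] by (auto simp: h_def dist_norm)
    qed
    also have "\<dots> = m * h" using integral_const[of h] by (simp add: m_def)
    finally show ?thesis using m by simp
  qed
  obtain c0 r where r: "cball c0 r \<subseteq> T" "h / (4 * \<sigma>) < r" using inb(3) by (auto simp: h_def)
  have \<sigma>: "\<sigma> > 0" and h: "h > 0" using inb by (simp_all add: h_def)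
  have rpos: "r > 0" using r(2) \<sigma> h by (meson divide_pos_pos less_trans mult_pos_pos zero_less_numeral)
  have B: "ball c0 r \<subseteq> ?U" using r(1) ball_subset_cball by (intro interior_maximal) auto
  have \<gamma>: "cell_const \<sigma> CARD('n) * h\<^sup>2 * m * (norm c)\<^sup>2 \<le> (LINT x:?U|lebesgue. (norm (emul (x - z) c))\<^sup>2)"
    if c: "c \<in> Alt k" for c
  proof -
    define \<omega> where "\<omega> = measure lebesgue (ball (0 :: 'n point) 1)"
    have \<omega>: "\<omega> \<ge> 0" by (simp add: \<omega>_def)
    define t where "t = r / 2"
    have t: "h * (1 / (8 * \<sigma>)) \<le> t" "t > 0" using r(2) rpos by (simp_all add: t_def)
    \<comment> \<open>All of the interior is within h of z. This volume comparison makes the lower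
      bound proportional to the measure of the element rather than to that of the inscribed
      ball.\<close>
    have "m \<le> measure lebesgue (cball z h)"
      unfolding m_def using hz by (intro measure_mono_fmeasurable) (auto simp: dist_norm norm_minus_commute)
    also have "\<dots> = h ^ CARD('n) * \<omega>"
      using h content_ball_conv_unit_ball[of h z] by (simp add: content_cball_conv_ball \<omega>_def)
    finally have mle: "m \<le> h ^ CARD('n) * \<omega>" .
    have Bt: "measure lebesgue (ball (0 :: 'n point) t) = t ^ CARD('n) * \<omega>"
      using t content_ball_conv_unit_ball[of t "0 :: 'n point"] by (simp add: \<omega>_def)
    have "(1 / (8 * \<sigma>)) ^ (CARD('n) + 2) * h\<^sup>2 * m * (norm c)\<^sup>2
        \<le> (1 / (8 * \<sigma>)) ^ (CARD('n) + 2) * h\<^sup>2 * (h ^ CARD('n) * \<omega>) * (norm c)\<^sup>2"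
      using \<sigma> by (intro mult_right_mono mult_left_mono mle) auto
    also have "\<dots> = (h * (1 / (8 * \<sigma>)))\<^sup>2 * ((h * (1 / (8 * \<sigma>))) ^ CARD('n) * \<omega>) * (norm c)\<^sup>2"
    proof -
      have "s ^ (CARD('n) + 2) * h\<^sup>2 * (h ^ CARD('n) * \<omega>) * (norm c)\<^sup>2
          = (h * s)\<^sup>2 * ((h * s) ^ CARD('n) * \<omega>) * (norm c)\<^sup>2" for s
        by (simp add: power_mult_distrib power_add power2_eq_square mult_ac)
      then show ?thesis .
    qed
    also have "\<dots> \<le> t\<^sup>2 * (t ^ CARD('n) * \<omega>) * (norm c)\<^sup>2"
      using h \<sigma> t \<omega> by (intro mult_right_mono mult_mono power_mono) auto
    also have "\<dots> \<le> real CARD('n) * (LINT x:?U|lebesgue. (norm (emul (x - z) c))\<^sup>2)"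
      using emul_coercive_on_ball[OF _ B rpos c k(2), of z] bounded_open_axioms by (simp add: Bt flip: t_def)
    finally have "(1 / (8 * \<sigma>)) ^ (CARD('n) + 2) * h\<^sup>2 * m * (norm c)\<^sup>2 / real CARD('n)
        \<le> (LINT x:?U|lebesgue. (norm (emul (x - z) c))\<^sup>2)"
      by (subst pos_divide_le_eq) (simp_all only: of_nat_0_less_iff zero_less_card_finite mult.commute)
    then show ?thesis by (simp add: cell_const_def)
  qed
  show ?thesis
  proof (unfold_locales)
    show "(LINT x:?U|lebesgue. (x $ b - centroid T $ b)\<^sup>2) = measure lebesgue ?U * mean T (\<lambda>y. (y $ b - centroid T $ b)\<^sup>2)" for b
      unfolding m_def[symmetric] by (intro mean continuous_intros)
    show "cell_const \<sigma> CARD('n) > 0" using \<sigma> by (simp add: cell_const_def)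
  qed (use k m h hz centered \<gamma> in \<open>simp_all add: m_def z_def h_def\<close>)
qed

text \<open>The interiors miss only a null subset of \<Omega>, so the integral may be taken over
  their disjoint union, where finite additivity applies.\<close>

lemma sqn_decompose:
  fixes f :: "('n::finite) point \<Rightarrow> 'b::euclidean_space"
  assumes G: "finite \<G>" "\<And>S T. S \<in> \<G> \<Longrightarrow> T \<in> \<G> \<Longrightarrow> S \<noteq> T \<Longrightarrow> interior S \<inter> interior T = {}"
    and sub: "\<And>T. T \<in> \<G> \<Longrightarrow> interior T \<subseteq> \<Omega>" and null: "\<Omega> - (\<Union>T\<in>\<G>. interior T) \<in> null_sets lebesgue"
    and f: "set_borel_measurable lebesgue \<Omega> f" "\<And>T. T \<in> \<G> \<Longrightarrow> sq_int (interior T) f"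
  shows "sqn \<Omega> f = (\<Sum>T\<in>\<G>. sqn (interior T) f)"
proof -
  let ?V = "\<Union>T\<in>\<G>. interior T"
  have [measurable]: "(\<lambda>x. indicator \<Omega> x *\<^sub>R f x) \<in> borel_measurable lebesgue"
    using f(1) by (simp add: set_borel_measurable_def)
  have "(\<lambda>x. (norm (indicator \<Omega> x *\<^sub>R f x))\<^sup>2) \<in> borel_measurable lebesgue"
    by measurable
  moreover have "(\<lambda>x. (norm (indicator \<Omega> x *\<^sub>R f x))\<^sup>2) = (\<lambda>x. indicator \<Omega> x *\<^sub>R (norm (f x))\<^sup>2)"
    by (auto simp: fun_eq_iff indicator_def)
  ultimately have m: "set_borel_measurable lebesgue \<Omega> (\<lambda>x. (norm (f x))\<^sup>2)"
    by (simp add: set_borel_measurable_def)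
  have "open ?V" by auto
  then have "?V \<in> sets lebesgue" by simp
  then have m': "set_borel_measurable lebesgue ?V (\<lambda>x. (norm (f x))\<^sup>2)"
    using sub by (intro set_borel_measurable_subset[OF m]) auto
  have "sqn \<Omega> f = (LINT x:?V|lebesgue. (norm (f x))\<^sup>2)"
    unfolding sqn_def
  proof (rule set_integral_cong_set[OF m' m])
    show "AE x in lebesgue. (x \<in> ?V) = (x \<in> \<Omega>)"
      using AE_not_in[OF null] by eventually_elim (use sub in auto)
  qed
  also have "\<dots> = (\<Sum>T\<in>\<G>. sqn (interior T) f)"
    unfolding sqn_def using G f(2)
    by (intro set_integral_finite_Union) (auto simp: disjoint_family_on_def sq_int_def)
  finally show ?thesis .
qed

section \<open>Piecewise forms and assembly over the subdivision\<close>

lemma piecewise_eq: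
  assumes "finite \<G>" "\<And>S T. S \<in> \<G> \<Longrightarrow> T \<in> \<G> \<Longrightarrow> S \<noteq> T \<Longrightarrow> interior S \<inter> interior T = {}"
    and "T \<in> \<G>" "x \<in> interior T"
  shows "piecewise \<G> F x = F T x"
proof -
  have "piecewise \<G> F x = (\<Sum>S\<in>\<G>. if S = T then F T x else 0)"
    unfolding piecewise_def using assms by (intro sum.cong refl) (auto simp: indicator_def)
  then show ?thesis using assms by simp
qed

lemma piecewise_measurable:
  assumes "\<And>T. T \<in> \<G> \<Longrightarrow> sq_int (interior T) (F T)" "\<Omega> \<in> sets lebesgue"
  shows "set_borel_measurable lebesgue \<Omega> (piecewise \<G> F)"
proof -
  have "piecewise \<G> F \<in> borel_measurable lebesgue"
    unfolding piecewise_def[abs_def] using assms(1)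
    by (intro borel_measurable_sum) (simp add: sq_int_def set_borel_measurable_def)
  then show ?thesis
    unfolding set_borel_measurable_def using assms(2)
    by (intro borel_measurable_scaleR borel_measurable_indicator)
qed

text \<open>The passage from squares back to norms. The factor 3 is Cauchy-Schwarz for three terms
  on the left; on the right it is enough to drop the nonnegative cross terms.\<close>

lemma sqrt_sum3_le:
  assumes "a \<ge> 0" "b \<ge> 0" "c \<ge> 0" "x \<ge> 0" "y \<ge> 0" "z \<ge> 0" "C \<ge> 0" "a + b + c \<le> C * (x + y + z)"
  shows "sqrt a + sqrt b + sqrt c \<le> sqrt (3 * C) * (sqrt x + sqrt y + sqrt z)"
proof -
  have "(sqrt a + sqrt b + sqrt c)\<^sup>2 \<le> 3 * (a + b + c)"
  proof -
    have "0 \<le> (sqrt a - sqrt b)\<^sup>2 + (sqrt a - sqrt c)\<^sup>2 + (sqrt b - sqrt c)\<^sup>2"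
      by (intro add_nonneg_nonneg zero_le_power2)
    then show ?thesis using assms by (simp add: power2_diff power2_sum algebra_simps)
  qed
  also have "\<dots> \<le> 3 * C * (x + y + z)" using assms by simp
  also have "\<dots> \<le> 3 * C * (sqrt x + sqrt y + sqrt z)\<^sup>2"
  proof (intro mult_left_mono)
    have "0 \<le> sqrt x * sqrt y" "0 \<le> sqrt x * sqrt z" "0 \<le> sqrt y * sqrt z" using assms by simp_all
    then show "x + y + z \<le> (sqrt x + sqrt y + sqrt z)\<^sup>2" using assms by (simp add: power2_sum algebra_simps)
  qed (use assms in simp)
  also have "\<dots> = (sqrt (3 * C) * (sqrt x + sqrt y + sqrt z))\<^sup>2"
    using assms by (simp add: power_mult_distrib)
  finally show ?thesis
    by (rule power2_le_imp_le) (use assms in simp)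
qed


lemma subdivision_props:
  assumes \<Omega>: "lipschitz_domain \<Omega>" and G: "simplicial_subdivision \<Omega> \<G>"
  shows "finite \<G>" "\<And>S T. S \<in> \<G> \<Longrightarrow> T \<in> \<G> \<Longrightarrow> S \<noteq> T \<Longrightarrow> interior S \<inter> interior T = {}"
    and "\<And>T. T \<in> \<G> \<Longrightarrow> interior T \<subseteq> \<Omega>" "\<Omega> - (\<Union>T\<in>\<G>. interior T) \<in> null_sets lebesgue"
    and "bounded \<Omega>" "open \<Omega>" "\<G> \<noteq> {}"
proof -
  show fin: "finite \<G>" and "\<And>S T. S \<in> \<G> \<Longrightarrow> T \<in> \<G> \<Longrightarrow> S \<noteq> T \<Longrightarrow> interior S \<inter> interior T = {}"
    using G by (auto simp: simplicial_subdivision_def)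
  have U: "\<Union>\<G> = closure \<Omega>" and simp: "\<And>T. T \<in> \<G> \<Longrightarrow> int CARD('a) simplex T"
    using G by (auto simp: simplicial_subdivision_def)
  show "open \<Omega>" using \<Omega> by (simp add: lipschitz_domain_def)
  show "\<G> \<noteq> {}" using U \<Omega> closure_subset[of \<Omega>] by (auto simp: lipschitz_domain_def)
  show "interior T \<subseteq> \<Omega>" if T: "T \<in> \<G>" for T
  proof -
    have "T \<subseteq> closure \<Omega>" using U T by blast
    then show ?thesis
      using interior_mono interior_closure_lipschitz_domain[OF \<Omega>] by blast
  qed
  have "bounded (\<Union>\<G>)"
    using fin simp compact_simplex compact_imp_bounded by (intro bounded_Union) blast+
  then show "bounded \<Omega>" unfolding U using bounded_subset closure_subset by blast
  have "negligible (\<Union>T\<in>\<G>. frontier T)"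
    using fin simp convex_simplex by (intro negligible_Union) (auto intro: negligible_convex_frontier)
  moreover have "\<Omega> - (\<Union>T\<in>\<G>. interior T) \<subseteq> (\<Union>T\<in>\<G>. frontier T)"
  proof
    fix x assume x: "x \<in> \<Omega> - (\<Union>T\<in>\<G>. interior T)"
    then have "x \<in> \<Union>\<G>" unfolding U using closure_subset by blast
    then obtain T where "T \<in> \<G>" "x \<in> T" by blast
    then show "x \<in> (\<Union>T\<in>\<G>. frontier T)"
      using x closure_subset[of T] unfolding frontier_def by blast
  qed
  ultimately show "\<Omega> - (\<Union>T\<in>\<G>. interior T) \<in> null_sets lebesgue"
    using negligible_subset by (simp add: negligible_iff_null_sets[symmetric]) blast
qed

text \<open>Needed because the infimum over an empty set of reals carries no information.\<close>

lemma zero_in_P_global: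
  fixes \<Omega> :: "('n::{finite,linorder}) point set"
  assumes "lipschitz_domain \<Omega>" "simplicial_subdivision \<Omega> \<G>" "shape_regular \<sigma> \<G>" "1 \<le> k" "k < CARD('n)"
  shows "(\<lambda>x. 0) \<in> P_global \<Omega> \<G> k"
proof -
  have "bounded_open \<Omega>"
    using subdivision_props(5,6)[OF assms(1,2)] by (simp add: bounded_open_def)
  then have "(\<lambda>x. 0) \<in> L2_forms \<Omega> k" by (simp add: L2_forms_iff bounded_open.sq_int_const)
  moreover have "(\<lambda>x. 0) \<in> P_local T k" if T: "T \<in> \<G>" for T
  proof -
    interpret cell "interior T" k "centroid T" "\<lambda>b. mean T (\<lambda>y. (y $ b - centroid T $ b)\<^sup>2)" "diameter T" "cell_const \<sigma> CARD('n)"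
      using assms T by (intro simplex_cell) (auto simp: simplicial_subdivision_def shape_regular_def)
    have "pform 0 0 0 0 = (\<lambda>x. 0)"
      by (simp add: fun_eq_iff pform_def quad_def imul.zero_right emul.zero_right)
    moreover have "pform 0 0 0 0 \<in> pforms" unfolding pforms_def using Alt_0 by blast
    ultimately have "(\<lambda>x. 0) \<in> pforms" by simp
    then show ?thesis by (subst P_local_eq) simp_all
  qed
  ultimately show ?thesis by (auto simp: P_global_def)
qed

text \<open>The estimate against one competitor \<mu>. Squares are summed over the elements first
  and roots are taken last, so the constant does not see the number of elements.\<close>

lemma interpolation_quasi_optimal:
  fixes \<Omega> :: "('n::{finite,linorder}) point set"
  assumes \<Omega>: "lipschitz_domain \<Omega>" and G: "simplicial_subdivision \<Omega> \<G>" and reg: "shape_regular \<sigma> \<G>"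
    and H: "\<forall>T\<in>\<G>. diameter T \<le> h\<^sub>0" and \<omega>: "\<omega> \<in> H_d \<Omega> k" "\<omega> \<in> H_delta \<Omega> k"
    and \<mu>: "\<mu> \<in> P_global \<Omega> \<G> k" and k: "1 \<le> k" "k < CARD('n)" and K: "ext_bound TYPE('n) K"
  defines "C \<equiv> 2 + 2 * est_const (real CARD('n)) K (cell_const \<bar>\<sigma>\<bar> CARD('n)) h\<^sub>0"
  shows "L2_norm \<Omega> (\<lambda>x. \<omega> x - interp \<G> k \<omega> x)
      + L2_norm \<Omega> (\<lambda>x. ext_d \<Omega> k \<omega> x - ext_d_h \<G> k (interp \<G> k \<omega>) x)
      + L2_norm \<Omega> (\<lambda>x. codiff \<Omega> k \<omega> x - codiff_h \<G> k (interp \<G> k \<omega>) x)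
    \<le> sqrt (3 * C) * (L2_norm \<Omega> (\<lambda>x. \<omega> x - \<mu> x)
          + L2_norm \<Omega> (ext_d_h \<G> k (\<lambda>x. \<omega> x - \<mu> x))
          + L2_norm \<Omega> (codiff_h \<G> k (\<lambda>x. \<omega> x - \<mu> x)))"
proof -
  let ?I = "interior :: 'n point set \<Rightarrow> _" and ?e = "\<lambda>x. \<omega> x - \<mu> x"
  note sub = subdivision_props[OF \<Omega> G]
  interpret O: bounded_open \<Omega> using sub(5,6) by (simp add: bounded_open_def)
  define J where "J = interp \<G> k \<omega>"
  obtain \<zeta> where "O.is_d k \<omega> \<zeta>"
    using \<omega>(1) by (auto simp: H_d_def O.is_d_def)
  then have d\<omega>: "O.is_d k \<omega> (ext_d \<Omega> k \<omega>)" by (rule O.ext_d_spec)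
  obtain \<xi> where "O.is_d (CARD('n) - k) (hodge_form \<omega>) \<xi>"
    using \<omega>(2) by (auto simp: H_delta_def H_d_def O.is_d_def)
  then have "O.is_delta k \<omega> (\<lambda>x. (- 1) ^ (k * CARD('n)) *\<^sub>R hodge (\<xi> x))"
    using \<omega>(2) by (auto simp: O.is_delta_def H_delta_def)
  then have delta\<omega>: "O.is_delta k \<omega> (codiff \<Omega> k \<omega>)" by (rule O.codiff_spec)
  have s\<omega>: "sq_int \<Omega> \<omega>" "sq_int \<Omega> (ext_d \<Omega> k \<omega>)" "sq_int \<Omega> (codiff \<Omega> k \<omega>)" "sq_int \<Omega> \<mu>"
    using d\<omega> O.is_delta_L2[OF delta\<omega>] k \<mu> by (auto simp: O.is_d_def L2_forms_iff P_global_def)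
  have pw: "piecewise \<G> F x = F T x" if "T \<in> \<G>" "x \<in> ?I T" for F :: "'n point set \<Rightarrow> 'n dform" and T x
    by (rule piecewise_eq[OF sub(1,2) that])
  have C: "C \<ge> 0"
    using est_const_nonneg by (simp add: C_def)
  have loc: "sq_int (?I T) J \<and> sq_int (?I T) (ext_d (?I T) k J) \<and> sq_int (?I T) (codiff (?I T) k J)
    \<and> sq_int (?I T) (ext_d (?I T) k ?e) \<and> sq_int (?I T) (codiff (?I T) k ?e)
    \<and> sqn (?I T) (\<lambda>x. \<omega> x - J x) + sqn (?I T) (\<lambda>x. ext_d \<Omega> k \<omega> x - ext_d (?I T) k J x)
        + sqn (?I T) (\<lambda>x. codiff \<Omega> k \<omega> x - codiff (?I T) k J x)
      \<le> C * (sqn (?I T) ?e + sqn (?I T) (ext_d (?I T) k ?e)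
        + sqn (?I T) (codiff (?I T) k ?e))"
    if T: "T \<in> \<G>" for T
  proof -
    have simp: "int CARD('n) simplex T" and regT: "diameter T \<le> \<sigma> * inball_diameter T"
      using G T reg by (auto simp: simplicial_subdivision_def shape_regular_def)
    \<comment> \<open>The constant is formed with the absolute value of \<sigma>; the presence of
      one element already forces \<sigma> to be positive.\<close>
    have "\<sigma> > 0"
      using inball_exists(2)[OF compact_imp_bounded[OF compact_simplex[OF simp]] simplex_interior_nonempty[OF simp] regT] .
    then have \<sigma>: "\<bar>\<sigma>\<bar> = \<sigma>" by simp
    interpret cell "?I T" k "centroid T" "\<lambda>b. mean T (\<lambda>y. (y $ b - centroid T $ b)\<^sup>2)" "diameter T" "cell_const \<sigma> CARD('n)"
      by (rule simplex_cell[OF simp regT k])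
    have P: "P_local T k = pforms" by (rule P_local_eq) simp_all
    have l: "is_d k \<omega> (ext_d \<Omega> k \<omega>)" "is_delta k \<omega> (codiff \<Omega> k \<omega>)"
      by (rule is_d_subset[OF O.bounded_open_axioms bounded_open_axioms sub(3)[OF T] d\<omega>]
          is_delta_subset[OF O.bounded_open_axioms bounded_open_axioms sub(3)[OF T] delta\<omega>])+
    obtain p0 where "p0 \<in> P_local T k" and p0\<mu>: "\<And>x. x \<in> ?I T \<Longrightarrow> \<mu> x = p0 x"
      using \<mu> T unfolding P_global_def by blast
    then have p0: "p0 \<in> pforms" unfolding P by blast
    have J: "J x = interp_local T k \<omega> x" if "x \<in> ?I T" for x
      unfolding J_def interp_def by (rule pw[OF T that])
    note est = cell_estimate[OF refl P l p0 p0\<mu> J K H[rule_format, OF T], folded C_def[unfolded \<sigma>]]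
    have "sq_int (?I T) J" "sq_int (?I T) (ext_d (?I T) k J)" "sq_int (?I T) (ext_d (?I T) k ?e)"
      using est(1,3) by (auto simp: is_d_def L2_forms_iff)
    then show ?thesis
      using est(5) is_delta_sq_int[OF est(2)] is_delta_sq_int[OF est(4)] by blast
  qed
  have s\<omega>T: "sq_int (?I T) \<omega>" "sq_int (?I T) (ext_d \<Omega> k \<omega>)" "sq_int (?I T) (codiff \<Omega> k \<omega>)" "sq_int (?I T) \<mu>"
    if T: "T \<in> \<G>" for T
    using s\<omega> sub(3)[OF T] by (auto intro: sq_int_subset)
  \<comment> \<open>Used also with f = 0, to decompose the piecewise derivatives of the
    error.\<close>
  have dec: "sqn \<Omega> (\<lambda>x. f x - piecewise \<G> F x) = (\<Sum>T\<in>\<G>. sqn (?I T) (\<lambda>x. f x - F T x))"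
    if f: "sq_int \<Omega> f" and F: "\<And>T. T \<in> \<G> \<Longrightarrow> sq_int (?I T) (F T)" for f and F :: "'n point set \<Rightarrow> 'n dform"
  proof -
    have fF: "sq_int (?I T) (\<lambda>x. f x - F T x)" if T: "T \<in> \<G>" for T
      using sq_int_subset[OF f sub(3)[OF T]] F[OF T] by (intro sq_int_diff) auto
    have "sqn \<Omega> (\<lambda>x. f x - piecewise \<G> F x) = (\<Sum>T\<in>\<G>. sqn (?I T) (\<lambda>x. f x - piecewise \<G> F x))"
    proof (rule sqn_decompose[OF sub(1,2,3,4)])
      show "set_borel_measurable lebesgue \<Omega> (\<lambda>x. f x - piecewise \<G> F x)"
        using f piecewise_measurable[OF F O.sets_U]
        by (auto simp: sq_int_def set_borel_measurable_def scaleR_diff_right)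
      show "sq_int (?I T) (\<lambda>x. f x - piecewise \<G> F x)" if T: "T \<in> \<G>" for T
        using fF[OF T] by (subst sq_int_cong[of _ _ "\<lambda>x. f x - F T x"]) (simp_all add: pw[OF T])
    qed
    also have "\<dots> = (\<Sum>T\<in>\<G>. sqn (?I T) (\<lambda>x. f x - F T x))"
      unfolding sqn_def by (intro sum.cong refl set_integral_cong_on) (simp add: pw)
    finally show ?thesis .
  qed
  have s0: "sq_int \<Omega> (\<lambda>x. 0 :: 'n extalg)" by (rule O.sq_int_const)
  have neg: "sqn V (\<lambda>x. 0 - F x) = sqn V F" for V and F :: "'n dform" by (simp add: sqn_def)
  have "sqn \<Omega> (\<lambda>x. \<omega> x - J x) = (\<Sum>T\<in>\<G>. sqn (?I T) (\<lambda>x. \<omega> x - J x))"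
  proof -
    have "sqn \<Omega> (\<lambda>x. \<omega> x - J x) = (\<Sum>T\<in>\<G>. sqn (?I T) (\<lambda>x. \<omega> x - interp_local T k \<omega> x))"
      unfolding J_def interp_def
    proof (rule dec[OF s\<omega>(1)])
      fix T assume T: "T \<in> \<G>"
      then have "sq_int (?I T) J" using loc by blast
      then show "sq_int (?I T) (interp_local T k \<omega>)"
        by (subst sq_int_cong[of _ _ J]) (simp_all add: J_def interp_def pw[OF T])
    qed
    also have "\<dots> = (\<Sum>T\<in>\<G>. sqn (?I T) (\<lambda>x. \<omega> x - J x))"
      unfolding sqn_def J_def interp_def by (intro sum.cong refl set_integral_cong_on) (simp add: pw)
    finally show ?thesis .
  qed
  moreover have "sqn \<Omega> (\<lambda>x. ext_d \<Omega> k \<omega> x - ext_d_h \<G> k J x) =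
      (\<Sum>T\<in>\<G>. sqn (?I T) (\<lambda>x. ext_d \<Omega> k \<omega> x - ext_d (?I T) k J x))"
    unfolding ext_d_h_def by (rule dec[OF s\<omega>(2)]) (use loc in blast)
  moreover have "sqn \<Omega> (\<lambda>x. codiff \<Omega> k \<omega> x - codiff_h \<G> k J x) =
      (\<Sum>T\<in>\<G>. sqn (?I T) (\<lambda>x. codiff \<Omega> k \<omega> x - codiff (?I T) k J x))"
    unfolding codiff_h_def by (rule dec[OF s\<omega>(3)]) (use loc in blast)
  moreover have "sqn \<Omega> ?e = (\<Sum>T\<in>\<G>. sqn (?I T) ?e)"
    using sq_int_diff[OF s\<omega>(1,4)] s\<omega>T
    by (intro sqn_decompose[OF sub(1,2,3,4)] sq_int_diff) (auto simp: sq_int_def)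
  moreover have "sqn \<Omega> (ext_d_h \<G> k ?e) =
      (\<Sum>T\<in>\<G>. sqn (?I T) (ext_d (?I T) k ?e))"
    using dec[OF s0, of "\<lambda>T. ext_d (?I T) k ?e"] loc unfolding ext_d_h_def neg by blast
  moreover have "sqn \<Omega> (codiff_h \<G> k ?e) =
      (\<Sum>T\<in>\<G>. sqn (?I T) (codiff (?I T) k ?e))"
    using dec[OF s0, of "\<lambda>T. codiff (?I T) k ?e"] loc unfolding codiff_h_def neg by blast
  moreover have "(\<Sum>T\<in>\<G>. sqn (?I T) (\<lambda>x. \<omega> x - J x) + sqn (?I T) (\<lambda>x. ext_d \<Omega> k \<omega> x - ext_d (?I T) k J x)
        + sqn (?I T) (\<lambda>x. codiff \<Omega> k \<omega> x - codiff (?I T) k J x))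
     \<le> (\<Sum>T\<in>\<G>. C * (sqn (?I T) ?e + sqn (?I T) (ext_d (?I T) k ?e)
        + sqn (?I T) (codiff (?I T) k ?e)))"
    by (rule sum_mono) (use loc in blast)
  ultimately have "sqn \<Omega> (\<lambda>x. \<omega> x - J x) + sqn \<Omega> (\<lambda>x. ext_d \<Omega> k \<omega> x - ext_d_h \<G> k J x) + sqn \<Omega> (\<lambda>x. codiff \<Omega> k \<omega> x - codiff_h \<G> k J x)
     \<le> C * (sqn \<Omega> ?e + sqn \<Omega> (ext_d_h \<G> k ?e) + sqn \<Omega> (codiff_h \<G> k ?e))"
    by (simp only: sum.distrib flip: sum_distrib_left)
  from sqrt_sum3_le[OF sqn_nonneg sqn_nonneg sqn_nonneg sqn_nonneg sqn_nonneg sqn_nonneg C this]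
  show ?thesis unfolding L2_norm_eq_sqn J_def .
qed

theorem lemma2p11:
  fixes k :: nat and \<sigma> h\<^sub>0 :: real
  assumes "2 \<le> CARD('n::{finite,linorder})" and "1 \<le> k" and "k \<le> CARD('n) - 1"
  shows "\<exists>C>0. \<forall>(\<Omega> :: 'n point set) \<G> \<omega>.
    lipschitz_domain \<Omega> \<longrightarrow> simplicial_subdivision \<Omega> \<G> \<longrightarrow> shape_regular \<sigma> \<G> \<longrightarrow>
    (\<forall>T\<in>\<G>. diameter T \<le> h\<^sub>0) \<longrightarrow> \<omega> \<in> H_d \<Omega> k \<inter> H_delta_0 \<Omega> k \<longrightarrow>
    L2_norm \<Omega> (\<lambda>x. \<omega> x - interp \<G> k \<omega> x)
      + L2_norm \<Omega> (\<lambda>x. ext_d \<Omega> k \<omega> x - ext_d_h \<G> k (interp \<G> k \<omega>) x)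
      + L2_norm \<Omega> (\<lambda>x. codiff \<Omega> k \<omega> x - codiff_h \<G> k (interp \<G> k \<omega>) x)
    \<le> C * (INF \<mu> \<in> P_global \<Omega> \<G> k.
        L2_norm \<Omega> (\<lambda>x. \<omega> x - \<mu> x)
          + L2_norm \<Omega> (ext_d_h \<G> k (\<lambda>x. \<omega> x - \<mu> x))
          + L2_norm \<Omega> (codiff_h \<G> k (\<lambda>x. \<omega> x - \<mu> x)))"
proof -
  have k: "1 \<le> k" "k < CARD('n)" using assms by auto
  obtain K where K: "ext_bound TYPE('n) K" using ext_bound_exists by blast
  \<comment> \<open>K is a bound for the exterior algebra alone, so C is fixed before the domain,
    the subdivision and the form.\<close>
  define C where "C = sqrt (3 * (2 + 2 * est_const (real CARD('n)) K (cell_const \<bar>\<sigma>\<bar> CARD('n)) h\<^sub>0))"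
  have "est_const (real CARD('n)) K (cell_const \<bar>\<sigma>\<bar> CARD('n)) h\<^sub>0 \<ge> 0"
    by (rule est_const_nonneg)
  then have C: "C > 0" by (simp add: C_def)
  show ?thesis
  proof (intro exI[of _ C] conjI C allI impI)
    fix \<Omega> :: "'n point set" and \<G> \<omega>
    assume \<Omega>: "lipschitz_domain \<Omega>" and G: "simplicial_subdivision \<Omega> \<G>" and reg: "shape_regular \<sigma> \<G>"
      and H: "\<forall>T\<in>\<G>. diameter T \<le> h\<^sub>0" and \<omega>: "\<omega> \<in> H_d \<Omega> k \<inter> H_delta_0 \<Omega> k"
    let ?L = "L2_norm \<Omega> (\<lambda>x. \<omega> x - interp \<G> k \<omega> x)
      + L2_norm \<Omega> (\<lambda>x. ext_d \<Omega> k \<omega> x - ext_d_h \<G> k (interp \<G> k \<omega>) x)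
      + L2_norm \<Omega> (\<lambda>x. codiff \<Omega> k \<omega> x - codiff_h \<G> k (interp \<G> k \<omega>) x)"
    let ?R = "\<lambda>\<mu>. L2_norm \<Omega> (\<lambda>x. \<omega> x - \<mu> x)
          + L2_norm \<Omega> (ext_d_h \<G> k (\<lambda>x. \<omega> x - \<mu> x))
          + L2_norm \<Omega> (codiff_h \<G> k (\<lambda>x. \<omega> x - \<mu> x))"
    have "(\<lambda>x. 0) \<in> P_global \<Omega> \<G> k"
      by (rule zero_in_P_global[OF \<Omega> G reg k])
    \<comment> \<open>After division by C the left side is a lower bound for every competitor, hence
      for the infimum.\<close>
    then have "?L / C \<le> (INF \<mu> \<in> P_global \<Omega> \<G> k. ?R \<mu>)"
    proof (intro cINF_greatest)
      fix \<mu> assume \<mu>: "\<mu> \<in> P_global \<Omega> \<G> k"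
      have "?L \<le> C * ?R \<mu>"
        unfolding C_def using \<omega>
        by (intro interpolation_quasi_optimal[OF \<Omega> G reg H _ _ \<mu> k K]) (auto simp: H_delta_0_def)
      then show "?L / C \<le> ?R \<mu>" using C by (simp add: pos_divide_le_eq mult.commute)
    qed auto
    then show "?L \<le> C * (INF \<mu> \<in> P_global \<Omega> \<G> k. ?R \<mu>)"
      using C by (simp add: pos_divide_le_eq mult.commute)
  qed
qed

end
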